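(* Let $\mathbf{T}=(T_1,\dots,T_m),\ \mathbf{S}=(S_1,\dots,S_m)\in\mathcal{B}_1^m(\Omega)$ be such that $\{\mathbf{S}\}'\cong H^\infty(\Omega)$. Suppose that $$\mathcal{K}_{\mathbf{S}}(w)-\mathcal{K}_{\mathbf{T}}(w)=\sum_{i,j=1}^m\frac{\partial^2\psi(w)}{\partial w_i\partial\overline{w}_j}\,dw_i\wedge d\overline{w}_j,\qquad w\in\Omega,$$ for some $\psi(w)=\log\sum_{k=1}^n|\phi_k(w)|^2$, where $\phi_1,\dots,\phi_n$ are holomorphic functions on $\Omega$. If there exists an integer $l\le n$ satisfying $\frac{\phi_k}{\phi_l}\in H^\infty(\Omega)$ for all $k\le n$, then $\mathbf{T}\sim_s\mathbf{S}$, and $K_{\mathbf{T}}\le K_{\mathbf{S}}$. In particular, when $m=1$, $\mathbf{T}$ and $\mathbf{S}$ are unitarily equivalent.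
   Context: $\Omega\subset\mathbb{C}^m$ is a bounded domain; $H^\infty(\Omega)$ is the algebra of bounded holomorphic functions on $\Omega$. For a commuting tuple $\mathbf{T}=(T_1,\dots,T_m)\in\mathcal{L}(\mathcal{H})^m$ on a complex separable Hilbert space let $\mathscr{D}_{\mathbf{T}}h=(T_1h,\dots,T_mh)$ and $\mathbf{T}-w=(T_1-w_1,\dots,T_m-w_m)$, so $\ker\mathscr{D}_{\mathbf{T}-w}=\bigcap_i\ker(T_i-w_i)$. $\mathcal{B}_n^m(\Omega)$ consists of commuting $m$-tuples with (1) $\operatorname{ran}\mathscr{D}_{\mathbf{T}-w}$ closed, (2) $\dim\ker\mathscr{D}_{\mathbf{T}-w}=n$ for all $w\in\Omega$, and (3) the span of $\bigcup_{w\in\Omega}\ker\mathscr{D}_{\mathbf{T}-w}$ dense in $\mathcal{H}$. For $\mathbf{T}\in\mathcal{B}_1^m(\Omega)$ and a non-vanishing holomorphic section $\gamma$ of the eigenvector bundle $\mathcal{E}_{\mathbf{T}}$ (fibre $\ker\mathscr{D}_{\mathbf{T}-w}$), the curvature is $\mathcal{K}_{\mathbf{T}}(w)=-\sum_{i,j}\frac{\partial^2\log\|\gamma(w)\|^2}{\partial w_i\partial\overline{w}_j}dw_i\wedge d\overline{w}_j$ and the curvature matrix is $K_{\mathbf{T}}(w)=\left(-\frac{\partial^2\log\|\gamma(w)\|^2}{\partial w_i\partial\overline{w}_j}\right)_{i,j=1}^m$; $K_{\mathbf{T}}\le K_{\mathbf{S}}$ means $K_{\mathbf{S}}(w)-K_{\mathbf{T}}(w)$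 is positive semidefinite for every $w\in\Omega$. $\{\mathbf{S}\}'=\bigcap_{j=1}^m\{S_j\}'$ is the commutant. $\{\mathbf{S}\}'\cong H^\infty(\Omega)$ means that the correspondence $X\mapsto\phi$ given by $Xt(w)=\phi(w)t(w)$, for $t$ a non-vanishing holomorphic section of $\mathcal{E}_{\mathbf{S}}$, identifies $\{\mathbf{S}\}'$ with $H^\infty(\Omega)$; in particular each $\phi\in H^\infty(\Omega)$ comes from a bounded $X\in\{\mathbf{S}\}'$. $\mathbf{T}\sim_s\mathbf{S}$ (similar): there is a bounded invertible $X$ with $XT_i=S_iX$ for all $i$. Unitarily equivalent: such an $X$ can be taken unitary.
   Formalization: The final clause "when m=1" is false as stated (unit disc, φ_1=1, φ_2=w gives similar but not unitarily equivalent operators); it is proved instead for n=1, for every m. Also φ_l is required to have no zeros on Ω, as needed for ψ to be defined. *)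

theory Defs
  imports "HOL-Analysis.Analysis"
begin

subsection \<open>Complex Hilbert spaces\<close>

text \<open>The norm, the metric and completeness come from the underlying real Hilbert space, whose
  inner product is the real part of the complex one. The complex inner product is linear in its
  first argument.\<close>

class complex_hilbert_space = real_inner + complete_space +
  fixes scaleC :: "complex \<Rightarrow> 'a \<Rightarrow> 'a" (infixr "*\<^sub>C" 75)
    and cinner :: "'a \<Rightarrow> 'a \<Rightarrow> complex"
  assumes scaleC_add_right: "a *\<^sub>C (x + y) = a *\<^sub>C x + a *\<^sub>C y"
    and scaleC_add_left: "(a + b) *\<^sub>C x = a *\<^sub>C x + b *\<^sub>C x"
    and scaleC_scaleC: "a *\<^sub>C (b *\<^sub>C x) = (a * b) *\<^sub>C x"
    and scaleR_scaleC: "r *\<^sub>R x = complex_of_real r *\<^sub>C x"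
    and cinner_commute: "cinner x y = cnj (cinner y x)"
    and cinner_add_left: "cinner (x + y) z = cinner x z + cinner y z"
    and cinner_scaleC_left: "cinner (a *\<^sub>C x) y = a * cinner x y"
    and inner_eq_Re_cinner: "inner x y = Re (cinner x y)"

global_interpretation complex_vs:
  vector_space "scaleC :: complex \<Rightarrow> 'a \<Rightarrow> 'a::complex_hilbert_space"
proof
  fix x :: 'a
  show "1 *\<^sub>C x = x"
    using scaleR_scaleC[of 1 x] by simp
qed (simp_all add: scaleC_add_right scaleC_add_left scaleC_scaleC)

instantiation complex :: complex_hilbert_space
begin

definition scaleC_complex :: "complex \<Rightarrow> complex \<Rightarrow> complex"
  where "scaleC_complex a x = a * x"

definition cinner_complex :: "complex \<Rightarrow> complex \<Rightarrow> complex"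
  where "cinner_complex x y = x * cnj y"

instance
  by standard
    (simp_all add: scaleC_complex_def cinner_complex_def algebra_simps scaleR_conv_of_real
      inner_complex_def)

end

definition bounded_clinear ::
    "('a::complex_hilbert_space \<Rightarrow> 'b::complex_hilbert_space) \<Rightarrow> bool"
  where "bounded_clinear X \<longleftrightarrow> bounded_linear X \<and> (\<forall>c x. X (c *\<^sub>C x) = c *\<^sub>C X x)"


subsection \<open>Holomorphic functions of several variables\<close>

text \<open>Complex Frechet differentiability at every point; used for open \<open>U\<close> only. Values lie in
  a Hilbert space, so this covers scalar functions and sections of vector bundles.\<close>

definition holomorphic_Cm ::
    "(complex^'m::finite \<Rightarrow> 'a::complex_hilbert_space) \<Rightarrow> (complex^'m) set \<Rightarrow> bool"
  where "holomorphic_Cm f U \<longleftrightarrow>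
    (\<forall>w\<in>U. \<exists>D. (f has_derivative D) (at w) \<and> (\<forall>c v. D (c *s v) = c *\<^sub>C D v))"

text \<open>\<open>H\<^sup>\<infinity>(\<Omega>)\<close>; the values of its members outside \<open>\<Omega>\<close> are irrelevant.\<close>

definition Hinf :: "(complex^'m::finite) set \<Rightarrow> (complex^'m \<Rightarrow> complex) set"
  where "Hinf \<Omega> = {f. holomorphic_Cm f \<Omega> \<and> bounded (f ` \<Omega>)}"

definition partial_w :: "'m::finite \<Rightarrow> (complex^'m \<Rightarrow> complex) \<Rightarrow> complex^'m \<Rightarrow> complex"
  where "partial_w i f w =
    (vector_derivative (\<lambda>t::real. f (w + axis i (of_real t))) (at 0)
      - \<i> * vector_derivative (\<lambda>t::real. f (w + axis i (\<i> * of_real t))) (at 0)) / 2"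

definition partial_wbar :: "'m::finite \<Rightarrow> (complex^'m \<Rightarrow> complex) \<Rightarrow> complex^'m \<Rightarrow> complex"
  where "partial_wbar i f w =
    (vector_derivative (\<lambda>t::real. f (w + axis i (of_real t))) (at 0)
      + \<i> * vector_derivative (\<lambda>t::real. f (w + axis i (\<i> * of_real t))) (at 0)) / 2"

definition mixed_partial ::
    "'m::finite \<Rightarrow> 'm \<Rightarrow> (complex^'m \<Rightarrow> real) \<Rightarrow> complex^'m \<Rightarrow> complex"
  where "mixed_partial i j u w = partial_w i (partial_wbar j (\<lambda>z. complex_of_real (u z))) w"

text \<open>\<open>dw\<^sub>i \<and> d\<bar>w\<^sub>j\<close> as an alternating real-bilinear form on tangent vectors of \<open>\<complex>\<^sup>m\<close>,
  and the form \<open>\<Sum>\<^sub>i\<^sub>,\<^sub>j A\<^sub>i\<^sub>j dw\<^sub>i \<and> d\<bar>w\<^sub>j\<close> with coefficient matrix \<open>A\<close>.\<close>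

definition dw_wedge_dwbar ::
    "'m::finite \<Rightarrow> 'm \<Rightarrow> complex^'m \<Rightarrow> complex^'m \<Rightarrow> complex"
  where "dw_wedge_dwbar i j u v = (u $ i) * cnj (v $ j) - (v $ i) * cnj (u $ j)"

definition form11 :: "complex^'m^'m \<Rightarrow> complex^'m::finite \<Rightarrow> complex^'m \<Rightarrow> complex"
  where "form11 A u v = (\<Sum>i\<in>UNIV. \<Sum>j\<in>UNIV. A $ i $ j * dw_wedge_dwbar i j u v)"

definition pos_semidef :: "complex^'m^'m::finite \<Rightarrow> bool"
  where "pos_semidef A \<longleftrightarrow>
    (\<forall>x. (\<Sum>i\<in>UNIV. \<Sum>j\<in>UNIV. cnj (x $ i) * A $ i $ j * x $ j) \<in> \<real>\<^sub>\<ge>\<^sub>0)"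


subsection \<open>Tuples of operators and the Cowen--Douglas class\<close>

definition tuple_op ::
    "('m::finite \<Rightarrow> 'a \<Rightarrow> 'a) \<Rightarrow> 'a::complex_hilbert_space \<Rightarrow> 'a^'m"
  where "tuple_op T h = (\<chi> i. T i h)"

definition tuple_shift ::
    "('m::finite \<Rightarrow> 'a \<Rightarrow> 'a) \<Rightarrow> complex^'m \<Rightarrow> 'm \<Rightarrow> 'a::complex_hilbert_space \<Rightarrow> 'a"
  where "tuple_shift T w i h = T i h - (w $ i) *\<^sub>C h"

definition joint_eigenspace ::
    "('m::finite \<Rightarrow> 'a \<Rightarrow> 'a) \<Rightarrow> complex^'m \<Rightarrow> 'a::complex_hilbert_space set"
  where "joint_eigenspace T w = {h. tuple_op (tuple_shift T w) h = 0}"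

text \<open>The condition \<open>n > 0\<close> makes \<open>dim = n\<close> include finite-dimensionality: the library's
  dimension of an infinite-dimensional space is \<open>0\<close>.\<close>

definition cowen_douglas ::
    "nat \<Rightarrow> (complex^'m::finite) set \<Rightarrow> ('m \<Rightarrow> 'a \<Rightarrow> 'a::complex_hilbert_space) set"
  where "cowen_douglas n \<Omega> = {T. n > 0 \<and>
    (\<forall>i. bounded_clinear (T i)) \<and> (\<forall>i j. T i \<circ> T j = T j \<circ> T i) \<and>
    (\<forall>w\<in>\<Omega>. closed (range (tuple_op (tuple_shift T w)))) \<and>
    (\<forall>w\<in>\<Omega>. complex_vs.dim (joint_eigenspace T w) = n) \<and>
    closure (complex_vs.span (\<Union>w\<in>\<Omega>. joint_eigenspace T w)) = UNIV}"

text \<open>Sections are local: over a general domain in \<open>\<complex>\<^sup>m\<close> the eigenvector bundle need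
  not have a global non-vanishing holomorphic section.\<close>

definition nonvanishing_section ::
    "('m::finite \<Rightarrow> 'a \<Rightarrow> 'a) \<Rightarrow> (complex^'m) set \<Rightarrow>
      (complex^'m \<Rightarrow> 'a::complex_hilbert_space) \<Rightarrow> bool"
  where "nonvanishing_section T U \<gamma> \<longleftrightarrow>
    open U \<and> holomorphic_Cm \<gamma> U \<and> (\<forall>w\<in>U. \<gamma> w \<in> joint_eigenspace T w \<and> \<gamma> w \<noteq> 0)"

text \<open>Two non-vanishing sections of a line bundle differ by a non-vanishing holomorphic factor
  near \<open>w\<close>, so the choice of \<open>\<gamma>\<close> does not affect the curvature.\<close>

definition curvature_matrix ::
    "('m::finite \<Rightarrow> 'a \<Rightarrow> 'a::complex_hilbert_space) \<Rightarrow> complex^'m \<Rightarrow> complex^'m^'m"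
  where "curvature_matrix T w =
    (let \<gamma> = (SOME \<gamma>. \<exists>U. w \<in> U \<and> nonvanishing_section T U \<gamma>)
     in \<chi> i j. - mixed_partial i j (\<lambda>z. ln ((norm (\<gamma> z))\<^sup>2)) w)"

definition curvature_form ::
    "('m::finite \<Rightarrow> 'a \<Rightarrow> 'a::complex_hilbert_space) \<Rightarrow> complex^'m \<Rightarrow>
      complex^'m \<Rightarrow> complex^'m \<Rightarrow> complex"
  where "curvature_form T w = form11 (curvature_matrix T w)"

definition curvature_le ::
    "(complex^'m) set \<Rightarrow> ('m::finite \<Rightarrow> 'a \<Rightarrow> 'a::complex_hilbert_space) \<Rightarrow>
      ('m \<Rightarrow> 'b \<Rightarrow> 'b::complex_hilbert_space) \<Rightarrow> bool"
  where "curvature_le \<Omega> T S \<longleftrightarrow>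
    (\<forall>w\<in>\<Omega>. pos_semidef (curvature_matrix S w - curvature_matrix T w))"


subsection \<open>Commutants, similarity and unitary equivalence\<close>

definition commutant :: "('m \<Rightarrow> 'a \<Rightarrow> 'a) \<Rightarrow> ('a \<Rightarrow> 'a::complex_hilbert_space) set"
  where "commutant S = {X. bounded_clinear X \<and> (\<forall>j. X \<circ> S j = S j \<circ> X)}"

definition has_symbol ::
    "(complex^'m) set \<Rightarrow> ('m::finite \<Rightarrow> 'a \<Rightarrow> 'a) \<Rightarrow>
      ('a \<Rightarrow> 'a::complex_hilbert_space) \<Rightarrow> (complex^'m \<Rightarrow> complex) \<Rightarrow> bool"
  where "has_symbol \<Omega> S X \<phi> \<longleftrightarrow>
    (\<forall>U t. U \<subseteq> \<Omega> \<and> nonvanishing_section S U t \<longrightarrow> (\<forall>w\<in>U. X (t w) = \<phi> w *\<^sub>C t w))"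

text \<open>The relation \<open>X t(w) = \<phi>(w) t(w)\<close> is a one-to-one correspondence between the commutant
  and \<open>H\<^sup>\<infinity>(\<Omega>)\<close>, where \<open>\<phi>\<close> is unique as a function on \<open>\<Omega>\<close>.\<close>

definition commutant_iso_Hinf ::
    "(complex^'m) set \<Rightarrow> ('m::finite \<Rightarrow> 'a \<Rightarrow> 'a::complex_hilbert_space) \<Rightarrow> bool"
  where "commutant_iso_Hinf \<Omega> S \<longleftrightarrow>
    (\<forall>X\<in>commutant S. \<exists>\<phi>\<in>Hinf \<Omega>. has_symbol \<Omega> S X \<phi> \<and>
        (\<forall>\<phi>'\<in>Hinf \<Omega>. has_symbol \<Omega> S X \<phi>' \<longrightarrow> (\<forall>w\<in>\<Omega>. \<phi>' w = \<phi> w))) \<and>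
    (\<forall>\<phi>\<in>Hinf \<Omega>. \<exists>!X. X \<in> commutant S \<and> has_symbol \<Omega> S X \<phi>)"

definition similar_tuples ::
    "('m \<Rightarrow> 'a \<Rightarrow> 'a::complex_hilbert_space) \<Rightarrow> ('m \<Rightarrow> 'b \<Rightarrow> 'b::complex_hilbert_space) \<Rightarrow> bool"
  where "similar_tuples T S \<longleftrightarrow>
    (\<exists>X Y. bounded_clinear X \<and> bounded_clinear Y \<and> Y \<circ> X = id \<and> X \<circ> Y = id \<and>
      (\<forall>i. X \<circ> T i = S i \<circ> X))"

definition unitarily_equivalent_tuples ::
    "('m \<Rightarrow> 'a \<Rightarrow> 'a::complex_hilbert_space) \<Rightarrow> ('m \<Rightarrow> 'b \<Rightarrow> 'b::complex_hilbert_space) \<Rightarrow> bool"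
  where "unitarily_equivalent_tuples T S \<longleftrightarrow>
    (\<exists>X. bounded_clinear X \<and> surj X \<and> (\<forall>x y. cinner (X x) (X y) = cinner x y) \<and>
      (\<forall>i. X \<circ> T i = S i \<circ> X))"

end

theory Submission
  imports Defs "HOL-Complex_Analysis.Conformal_Mappings"
begin

text \<open>
  Put \<open>f\<^sub>k = \<phi>\<^sub>k / \<phi>\<^sub>l\<close>, so that \<open>f\<^sub>l = 1\<close>. Since \<open>log |\<phi>\<^sub>l|\<^sup>2\<close> is pluriharmonic, the hypothesis on the
  curvatures says that \<open>log \<parallel>\<gamma>\<parallel>\<^sup>2\<close> and \<open>log (\<Sum>\<^sub>k |f\<^sub>k|\<^sup>2 \<parallel>\<sigma>\<parallel>\<^sup>2)\<close> have the same mixed partial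
  derivatives, for all local sections \<open>\<gamma>\<close> of the eigenvector bundle of \<open>T\<close> and \<open>\<sigma>\<close> of that of \<open>S\<close>.
  The inequality between the curvatures is then the positivity of the complex Hessian of
  \<open>log (\<Sum>\<^sub>k |f\<^sub>k|\<^sup>2)\<close>, which is the Cauchy-Schwarz inequality.

  For the similarity, normalize both kernels \<open>\<langle>\<gamma>(p), \<gamma>(q)\<rangle>\<close> and \<open>\<Sum>\<^sub>k \<langle>f\<^sub>k(p) \<sigma>(p), f\<^sub>k(q) \<sigma>(q)\<rangle>\<close>
  at a base point \<open>w\<^sub>0\<close>, that is, make them equal to \<open>1\<close> for \<open>q = w\<^sub>0\<close>. A kernel normalized in this
  way is determined by the complex Hessian of the logarithm of its diagonal, so the two kernels agree on a
  ball (\<open>gram_rigidity\<close>, \<open>matched_local_sections\<close>). Let \<open>X\<^sub>k\<close> be the operator in the commutant of \<open>S\<close>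
  with symbol \<open>f\<^sub>k\<close>, and \<open>X\<^sub>l = id\<close>. Because \<open>X\<^sub>k \<sigma>(p) = f\<^sub>k(p) \<sigma>(p)\<close>, the equality of the kernels
  gives \<open>\<parallel>\<Sum> c\<^sub>j \<gamma>(p\<^sub>j)\<parallel>\<^sup>2 = \<Sum>\<^sub>k \<parallel>X\<^sub>k \<Sum> c\<^sub>j \<sigma>(p\<^sub>j)\<parallel>\<^sup>2\<close>. The right-hand side is comparable to
  \<open>\<parallel>\<Sum> c\<^sub>j \<sigma>(p\<^sub>j)\<parallel>\<^sup>2\<close>, from below by its \<open>l\<close>-th term and from above because every \<open>X\<^sub>k\<close> is bounded.
  Hence \<open>\<gamma>(p) \<mapsto> \<sigma>(p)\<close> extends to an isomorphism that intertwines \<open>T\<close> and \<open>S\<close>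
  (\<open>intertwiner_of_matched_sections\<close>), and it is isometric if \<open>l\<close> is the only index.

  Two facts about the class \<open>\<B>\<^sub>1\<close> enter. Holomorphic sections exist near each point, because a
  closed range makes the operators bounded below on the complement of the kernel
  (\<open>local_section_exists\<close>). The eigenvectors over a ball already span a dense subspace, by the identity
  theorem and the connectedness of the domain (\<open>eigenspaces_over_open_set_dense\<close>).

  The function theory for several variables and for values in a Hilbert space is reduced to scalar
  functions of one variable: by restriction to complex lines, which reach any two points of a convex
  set, and by pairing with a vector of the Hilbert space.
\<close>

section \<open>Complex inner products\<close>

subclass (in complex_hilbert_space) banach ..

lemma cinner_add_right: "cinner x (y + z) = cinner x y + cinner x z"
  by (metis cinner_add_left cinner_commute complex_cnj_add)

lemma cinner_scaleC_right: "cinner x (a *\<^sub>C y) = cnj a * cinner x y"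
  by (metis cinner_commute cinner_scaleC_left complex_cnj_mult)

lemma cinner_scaleR_left: "cinner (r *\<^sub>R x) y = r *\<^sub>R cinner x y"
  by (simp add: scaleR_scaleC[of r x] cinner_scaleC_left scaleR_conv_of_real)

lemma cinner_scaleR_right: "cinner x (r *\<^sub>R y) = r *\<^sub>R cinner x y"
  by (simp add: scaleR_scaleC[of r y] cinner_scaleC_right scaleR_conv_of_real)

lemma cinner_self: "cinner x x = complex_of_real ((norm x)\<^sup>2)"
proof -
  have "Im (cinner x x) = 0"
    using arg_cong[OF cinner_commute[of x x], of Im] by simp
  moreover have "Re (cinner x x) = (norm x)\<^sup>2"
    by (metis inner_eq_Re_cinner power2_norm_eq_inner)
  ultimately show ?thesis
    by (simp add: complex_eq_iff)
qed

lemma norm_scaleC: "norm (a *\<^sub>C x) = cmod a * norm x"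
proof -
  have "complex_of_real ((norm (a *\<^sub>C x))\<^sup>2) = complex_of_real ((cmod a * norm x)\<^sup>2)"
    by (simp only: cinner_self[symmetric] cinner_scaleC_left cinner_scaleC_right)
      (simp add: cinner_self power_mult_distrib complex_norm_square mult_ac del: of_real_power)
  then have "(norm (a *\<^sub>C x))\<^sup>2 = (cmod a * norm x)\<^sup>2"
    by (simp only: of_real_eq_iff)
  then show ?thesis
    by (simp add: power2_eq_iff_nonneg)
qed

lemma cinner_Cauchy_Schwarz: "cmod (cinner x y) \<le> norm x * norm y"
proof (cases "cinner x y = 0")
  case False
  define c where "c = cnj (sgn (cinner x y))"
  have "cmod c = 1"
    using False by (simp add: c_def norm_sgn)
  have "c * cinner x y = complex_of_real (cmod (cinner x y))"
    using False unfolding c_def sgn_eq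
    by (simp add: complex_norm_square[symmetric] power2_eq_square field_simps del: of_real_power)
  then have "cmod (cinner x y) = inner (c *\<^sub>C x) y"
    by (simp add: inner_eq_Re_cinner cinner_scaleC_left)
  also have "\<dots> \<le> norm (c *\<^sub>C x) * norm y"
    by (rule norm_cauchy_schwarz)
  finally show ?thesis
    using \<open>cmod c = 1\<close> by (simp add: norm_scaleC)
qed simp

lemma bounded_bilinear_cinner: "bounded_bilinear cinner"
  by unfold_locales
    (auto simp: cinner_add_left cinner_add_right cinner_scaleR_left cinner_scaleR_right
      intro!: exI[of _ 1] cinner_Cauchy_Schwarz)

lemma bounded_bilinear_scaleC: "bounded_bilinear scaleC"
proof
  fix r :: real and a :: complex and x :: 'a
  show "(r *\<^sub>R a) *\<^sub>C x = r *\<^sub>R (a *\<^sub>C x)" "a *\<^sub>C (r *\<^sub>R x) = r *\<^sub>R (a *\<^sub>C x)"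
    by (simp_all add: scaleR_scaleC[where 'a='a] scaleC_scaleC scaleR_conv_of_real mult_ac)
qed (auto simp: scaleC_add_left scaleC_add_right norm_scaleC intro!: exI[of _ 1])

lemmas has_derivative_cinner = bounded_bilinear.FDERIV[OF bounded_bilinear_cinner]
lemmas has_derivative_scaleC = bounded_bilinear.FDERIV[OF bounded_bilinear_scaleC]

lemma cinner_zero_left [simp]: "cinner 0 y = 0"
  and cinner_zero_right [simp]: "cinner x 0 = 0"
  and cinner_diff_left: "cinner (x - x') y = cinner x y - cinner x' y"
  using bounded_bilinear.zero_left[OF bounded_bilinear_cinner]
    bounded_bilinear.zero_right[OF bounded_bilinear_cinner]
    bounded_bilinear.diff_left[OF bounded_bilinear_cinner] by auto

lemma cinner_sum_left: "cinner (sum f A) y = (\<Sum>i\<in>A. cinner (f i) y)"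
  and cinner_sum_right: "cinner x (sum g A) = (\<Sum>i\<in>A. cinner x (g i))"
  by (rule bounded_bilinear.sum_left[OF bounded_bilinear_cinner]
      bounded_bilinear.sum_right[OF bounded_bilinear_cinner])+

lemma continuous_cinner_left: "continuous_on A (\<lambda>x. cinner x y)"
  by (rule bounded_linear.continuous_on[OF
      bounded_bilinear.bounded_linear_left[OF bounded_bilinear_cinner] continuous_on_id])

text \<open>Turns an estimate for scalar functions \<open>\<langle>a(z), x\<rangle>\<close> that is uniform in the unit vector \<open>x\<close> into an
  estimate for the Hilbert-valued function \<open>a\<close>.\<close>

lemma norm_le_if_cinner_le:
  assumes "\<And>x. cmod (cinner y x) \<le> B * norm x" and "B \<ge> 0"
  shows "norm y \<le> B"
proof (cases "y = 0")
  case False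
  have "norm y * norm y \<le> B * norm y"
    using assms(1)[of y] by (simp add: cinner_self power2_eq_square norm_mult)
  then show ?thesis
    using False by simp
qed (use assms in simp)

section \<open>Orthogonal vectors and density\<close>

text \<open>The difference between a point outside \<open>M\<close> and its nearest point in \<open>M\<close> is orthogonal to \<open>M\<close>.
  A minimizing sequence for the distance converges by the parallelogram law.\<close>

lemma exists_orthogonal_vector:
  fixes M :: "'a::complex_hilbert_space set"
  assumes M: "complex_vs.subspace M" and cl: "closed M" and ne: "M \<noteq> UNIV"
  shows "\<exists>h. h \<noteq> 0 \<and> (\<forall>x\<in>M. cinner x h = 0)"
proof -
  obtain p where p: "p \<notin> M"
    using ne by blast
  have M0: "0 \<in> M" and Madd: "\<And>x y. x \<in> M \<Longrightarrow> y \<in> M \<Longrightarrow> x + y \<in> M"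
    and Msc: "\<And>c x. x \<in> M \<Longrightarrow> c *\<^sub>C x \<in> M"
    using M by (auto simp: complex_vs.subspace_def)
  have MscR: "r *\<^sub>R x \<in> M" if "x \<in> M" for r x
    using Msc[OF that] by (simp add: scaleR_scaleC)
  define d where "d = infdist p M"
  have d_le: "d \<le> norm (p - x)" if "x \<in> M" for x
    using infdist_le[OF that, of p] by (simp add: d_def dist_norm)
  have ne0: "M \<noteq> {}"
    using M0 by blast
  have "\<exists>x\<in>M. norm (p - x) < d + inverse (real (Suc n))" for n
  proof (rule ccontr)
    assume "\<not> ?thesis"
    then have "d + inverse (real (Suc n)) \<le> infdist p M"
      using M0 unfolding infdist_notempty[OF ne0]
      by (intro cINF_greatest) (auto simp: dist_norm not_less)
    then show False
      by (simp add: d_def)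
  qed
  then obtain x where x: "\<And>n. x n \<in> M" and xd: "\<And>n. norm (p - x n) < d + inverse (real (Suc n))"
    by metis
  have d0: "d \<ge> 0"
    by (simp add: d_def infdist_nonneg)
  have par: "(norm (x m - x n))\<^sup>2 \<le> 2 * (norm (p - x m))\<^sup>2 + 2 * (norm (p - x n))\<^sup>2 - 4 * d\<^sup>2" for m n
  proof -
    have mid: "(1/2) *\<^sub>R (x m + x n) \<in> M"
      by (intro MscR Madd x)
    have "d\<^sup>2 \<le> (norm (p - (1/2) *\<^sub>R (x m + x n)))\<^sup>2"
      using d_le[OF mid] d0 by (simp add: power_mono)
    moreover have "(norm (x m - x n))\<^sup>2 + 4 * (norm (p - (1/2) *\<^sub>R (x m + x n)))\<^sup>2
      = 2 * (norm (p - x m))\<^sup>2 + 2 * (norm (p - x n))\<^sup>2"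
      by (simp add: power2_norm_eq_inner inner_diff_left inner_diff_right inner_add_left
          inner_add_right inner_commute algebra_simps)
    ultimately show ?thesis
      by linarith
  qed
  have "Cauchy x"
  proof (rule metric_CauchyI)
    fix e :: real assume "e > 0"
    have "(\<lambda>n. 4 * (d + inverse (real (Suc n)))\<^sup>2 - 4 * d\<^sup>2) \<longlonglongrightarrow> 4 * (d + 0)\<^sup>2 - 4 * d\<^sup>2"
      by (intro tendsto_intros LIMSEQ_inverse_real_of_nat)
    then have "\<forall>\<^sub>F n in sequentially. 4 * (d + inverse (real (Suc n)))\<^sup>2 - 4 * d\<^sup>2 < e\<^sup>2"
      using \<open>e > 0\<close> by (intro order_tendstoD(2)) auto
    then obtain N where N: "4 * (d + inverse (real (Suc N)))\<^sup>2 - 4 * d\<^sup>2 < e\<^sup>2"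
      by (auto simp: eventually_sequentially)
    have bd: "(norm (p - x n))\<^sup>2 \<le> (d + inverse (real (Suc N)))\<^sup>2" if "n \<ge> N" for n
    proof (rule power_mono)
      have "inverse (real (Suc n)) \<le> inverse (real (Suc N))"
        using that by (intro le_imp_inverse_le) auto
      then show "norm (p - x n) \<le> d + inverse (real (Suc N))"
        using xd[of n] by linarith
    qed simp
    have "dist (x m) (x n) < e" if "m \<ge> N" "n \<ge> N" for m n
    proof -
      have "(norm (x m - x n))\<^sup>2 < e\<^sup>2"
        using par[of m n] bd[OF that(1)] bd[OF that(2)] N by linarith
      then show ?thesis
        using \<open>e > 0\<close> by (simp add: dist_norm power_less_imp_less_base)
    qed
    then show "\<exists>N. \<forall>m\<ge>N. \<forall>n\<ge>N. dist (x m) (x n) < e"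
      by blast
  qed
  then obtain y where y: "x \<longlonglongrightarrow> y"
    using Cauchy_convergent convergent_def by blast
  have yM: "y \<in> M"
    using closed_sequentially[OF cl] x y by blast
  have "norm (p - y) \<le> d"
  proof (rule LIMSEQ_le)
    show "(\<lambda>n. norm (p - x n)) \<longlonglongrightarrow> norm (p - y)"
      by (intro tendsto_intros y)
    show "(\<lambda>n. d + inverse (real (Suc n))) \<longlonglongrightarrow> d"
      using tendsto_add[OF tendsto_const LIMSEQ_inverse_real_of_nat, of d] by simp
  qed (use xd less_imp_le in blast)
  define h where "h = p - y"
  have h_min: "norm h \<le> norm (h - z)" if "z \<in> M" for z
    using d_le[OF Madd[OF yM that]] \<open>norm (p - y) \<le> d\<close> by (simp add: h_def algebra_simps)
  \<comment> \<open>Minimality along the real line through \<open>z\<close> gives real orthogonality.\<close>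
  have re0: "inner z h = 0" if "z \<in> M" for z
  proof (rule ccontr)
    assume nz: "inner z h \<noteq> 0"
    then have "inner z z > 0"
      by auto
    define t where "t = inner z h / inner z z"
    have "(norm h)\<^sup>2 \<le> (norm (h - t *\<^sub>R z))\<^sup>2"
      using h_min[OF MscR[OF that]] by (simp add: power_mono)
    also have "\<dots> = (norm h)\<^sup>2 - 2 * t * inner z h + t * t * inner z z"
      by (simp add: power2_norm_eq_inner inner_diff_left inner_diff_right inner_commute algebra_simps)
    also have "\<dots> = (norm h)\<^sup>2 - (inner z h)\<^sup>2 / inner z z"
      using \<open>inner z z > 0\<close> by (simp add: t_def power2_eq_square field_simps)
    finally show False
      using nz \<open>inner z z > 0\<close> by (simp add: divide_le_0_iff)
  qed
  have "cinner z h = 0" if "z \<in> M" for z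
  proof -
    have "Re (cinner z h) = 0" "Re (cinner (\<i> *\<^sub>C z) h) = 0"
      using re0[OF that] re0[OF Msc[OF that]] by (simp_all add: inner_eq_Re_cinner)
    then show ?thesis
      by (simp add: cinner_scaleC_left complex_eq_iff)
  qed
  moreover have "h \<noteq> 0"
    using p yM by (auto simp: h_def)
  ultimately show ?thesis
    by blast
qed

lemma subspace_closure:
  fixes M :: "'a::complex_hilbert_space set"
  assumes "complex_vs.subspace M"
  shows "complex_vs.subspace (closure M)"
  unfolding complex_vs.subspace_def
proof (intro conjI allI impI ballI)
  show "0 \<in> closure M"
    using assms closure_subset by (auto simp: complex_vs.subspace_def)
next
  fix x y assume "x \<in> closure M" "y \<in> closure M"
  then obtain a b where "\<And>n. a n \<in> M" "a \<longlonglongrightarrow> x" "\<And>n. b n \<in> M" "b \<longlonglongrightarrow> y"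
    by (auto simp: closure_sequential)
  then have "\<And>n. a n + b n \<in> M" "(\<lambda>n. a n + b n) \<longlonglongrightarrow> x + y"
    using assms by (auto simp: complex_vs.subspace_def intro: tendsto_add)
  then show "x + y \<in> closure M"
    unfolding closure_sequential by (intro exI conjI) auto
next
  fix c :: complex and x assume "x \<in> closure M"
  then obtain a where "\<And>n. a n \<in> M" "a \<longlonglongrightarrow> x"
    by (auto simp: closure_sequential)
  then have "\<And>n. c *\<^sub>C a n \<in> M" "(\<lambda>n. c *\<^sub>C a n) \<longlonglongrightarrow> c *\<^sub>C x"
    using assms by (auto simp: complex_vs.subspace_def
        intro: bounded_bilinear.tendsto[OF bounded_bilinear_scaleC tendsto_const])
  then show "c *\<^sub>C x \<in> closure M"
    unfolding closure_sequential by (intro exI conjI) auto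
qed

lemma dense_span_iff:
  fixes A :: "'a::complex_hilbert_space set"
  shows "closure (complex_vs.span A) = UNIV \<longleftrightarrow> (\<forall>h. (\<forall>x\<in>A. cinner x h = 0) \<longrightarrow> h = 0)"
proof
  assume dense: "closure (complex_vs.span A) = UNIV"
  show "\<forall>h. (\<forall>x\<in>A. cinner x h = 0) \<longrightarrow> h = 0"
  proof (intro allI impI)
    fix h assume A: "\<forall>x\<in>A. cinner x h = 0"
    have "cinner x h = 0" if "x \<in> complex_vs.span A" for x
      using that by (induction rule: complex_vs.span_induct_alt)
        (use A in \<open>auto simp: cinner_add_left cinner_scaleC_left\<close>)
    moreover have "closed {x. cinner x h = 0}"
      using continuous_closed_vimage[of "{0}" "\<lambda>x. cinner x h"] continuous_cinner_left[of UNIV h]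
      by (auto simp: continuous_on_eq_continuous_at vimage_def)
    ultimately have "closure (complex_vs.span A) \<subseteq> {x. cinner x h = 0}"
      by (intro closure_minimal) auto
    then have "cinner h h = 0"
      using dense by auto
    then show "h = 0"
      by (simp add: cinner_self)
  qed
next
  assume orth: "\<forall>h. (\<forall>x\<in>A. cinner x h = 0) \<longrightarrow> h = 0"
  show "closure (complex_vs.span A) = UNIV"
  proof (rule ccontr)
    assume "closure (complex_vs.span A) \<noteq> UNIV"
    then obtain h where "h \<noteq> 0" "\<forall>x\<in>closure (complex_vs.span A). cinner x h = 0"
      using exists_orthogonal_vector[OF subspace_closure[OF complex_vs.subspace_span]] closed_closure
      by blast
    then show False
      using orth closure_subset[of "complex_vs.span A"] complex_vs.span_superset[of A] by blast
  qed
qed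

section \<open>Isomorphisms from comparable families of vectors\<close>

text \<open>The complex structure on the product lets the graph of an operator be described as a closed complex
  subspace, generated by pairs of vectors.\<close>

instantiation prod :: (complex_hilbert_space, complex_hilbert_space) complex_hilbert_space
begin

definition scaleC_prod :: "complex \<Rightarrow> 'a \<times> 'b \<Rightarrow> 'a \<times> 'b"
  where "scaleC_prod c p = (c *\<^sub>C fst p, c *\<^sub>C snd p)"

definition cinner_prod :: "'a \<times> 'b \<Rightarrow> 'a \<times> 'b \<Rightarrow> complex"
  where "cinner_prod p q = cinner (fst p) (fst q) + cinner (snd p) (snd q)"

instance
proof
  show "cinner p q = cnj (cinner q p)" for p q :: "'a \<times> 'b"
    by (simp add: cinner_prod_def cinner_commute[of "fst p" "fst q"]
        cinner_commute[of "snd p" "snd q"])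
qed (simp_all add: scaleC_prod_def cinner_prod_def scaleC_add_right scaleC_add_left scaleC_scaleC
    scaleR_prod_def scaleR_scaleC cinner_add_left cinner_scaleC_left inner_prod_def
    inner_eq_Re_cinner algebra_simps)

end

text \<open>The estimate makes \<open>G\<close> single-valued, and it sends Cauchy sequences of first components to
  Cauchy sequences of second components. So the projection to the first factor is onto, not only
  dense.\<close>

lemma closed_graph_of_operator:
  fixes G :: "('a::complex_hilbert_space \<times> 'b::complex_hilbert_space) set"
  assumes sub: "complex_vs.subspace G" and cl: "closed G"
    and bd: "\<And>p. p \<in> G \<Longrightarrow> norm (snd p) \<le> C * norm (fst p)"
    and dense: "closure (fst ` G) = UNIV"
  shows "\<exists>X. bounded_clinear X \<and> (\<forall>x y. (x, y) \<in> G \<longleftrightarrow> y = X x)"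
proof -
  have add: "(x + x', y + y') \<in> G" if "(x, y) \<in> G" "(x', y') \<in> G" for x x' y y'
    using sub that unfolding complex_vs.subspace_def by (metis add_Pair)
  have sc: "(c *\<^sub>C x, c *\<^sub>C y) \<in> G" if "(x, y) \<in> G" for c x y
    using sub that unfolding complex_vs.subspace_def
    by (metis scaleC_prod_def fst_conv snd_conv)
  have diff: "(x - x', y - y') \<in> G" if "(x, y) \<in> G" "(x', y') \<in> G" for x x' y y'
    using complex_vs.subspace_diff[OF sub that] by simp
  have uniq: "y = y'" if "(x, y) \<in> G" "(x, y') \<in> G" for x y y'
    using bd[OF diff[OF that]] by simp
  have ex: "\<exists>y. (x, y) \<in> G" for x
  proof -
    have "x \<in> closure (fst ` G)"
      using dense by simp
    then obtain a where a: "\<And>n. a n \<in> fst ` G" "a \<longlonglongrightarrow> x"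
      by (auto simp: closure_sequential)
    then have "\<forall>n. \<exists>y. (a n, y) \<in> G"
      by force
    then obtain b where b: "\<And>n. (a n, b n) \<in> G"
      by metis
    have bm: "norm (b m - b n) \<le> (\<bar>C\<bar> + 1) * norm (a m - a n)" for m n
    proof -
      have "norm (b m - b n) \<le> C * norm (a m - a n)"
        using bd[OF diff[OF b b]] by simp
      also have "\<dots> \<le> (\<bar>C\<bar> + 1) * norm (a m - a n)"
        by (intro mult_right_mono) auto
      finally show ?thesis .
    qed
    have "Cauchy b"
    proof (rule metric_CauchyI)
      fix e :: real assume "e > 0"
      have "Cauchy a"
        using a(2) LIMSEQ_imp_Cauchy by blast
      then obtain N where N: "\<And>m n. m \<ge> N \<Longrightarrow> n \<ge> N \<Longrightarrow> norm (a m - a n) < e / (\<bar>C\<bar> + 1)"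
        using \<open>e > 0\<close> unfolding Cauchy_def dist_norm
        by (metis abs_add_one_gt_zero add.commute divide_pos_pos)
      have "dist (b m) (b n) < e" if "m \<ge> N" "n \<ge> N" for m n
      proof -
        have "(\<bar>C\<bar> + 1) * norm (a m - a n) < e"
          using N[OF that] by (simp add: pos_less_divide_eq mult.commute add_nonneg_pos)
        then show ?thesis
          using bm[of m n] by (simp add: dist_norm)
      qed
      then show "\<exists>N. \<forall>m\<ge>N. \<forall>n\<ge>N. dist (b m) (b n) < e"
        by blast
    qed
    then obtain y where "b \<longlonglongrightarrow> y"
      using Cauchy_convergent convergent_def by blast
    then have "(\<lambda>n. (a n, b n)) \<longlonglongrightarrow> (x, y)"
      using a(2) by (intro tendsto_Pair)
    then have "(x, y) \<in> G"
      by (intro closed_sequentially[OF cl b])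
    then show ?thesis ..
  qed
  define X where "X x = (THE y. (x, y) \<in> G)" for x
  have X: "(x, X x) \<in> G" for x
    unfolding X_def using ex[of x] uniq by (metis theI)
  have X_iff: "(x, y) \<in> G \<longleftrightarrow> y = X x" for x y
    using X uniq by blast
  have Xadd: "X (x + y) = X x + X y" for x y
    using add[OF X X] X_iff by metis
  have Xsc: "X (c *\<^sub>C x) = c *\<^sub>C X x" for c x
    using sc[OF X] X_iff by metis
  have "bounded_linear X"
    by (rule bounded_linear_intro[of _ C])
      (use Xadd Xsc bd[OF X] in \<open>auto simp: scaleR_scaleC mult.commute\<close>)
  then show ?thesis
    using Xsc X_iff by (auto simp: bounded_clinear_def)
qed

text \<open>Applied to the span of pairs \<open>(x\<^sub>w, y\<^sub>w)\<close>, this extends \<open>x\<^sub>w \<mapsto> y\<^sub>w\<close> to an isomorphism as soon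
  as linear combinations of the \<open>x\<^sub>w\<close> and of the \<open>y\<^sub>w\<close> have comparable norms.\<close>

lemma graph_closure_isomorphism:
  fixes G :: "('a::complex_hilbert_space \<times> 'b::complex_hilbert_space) set"
  assumes sub: "complex_vs.subspace G"
    and bd1: "\<And>p. p \<in> G \<Longrightarrow> norm (snd p) \<le> C * norm (fst p)"
    and bd2: "\<And>p. p \<in> G \<Longrightarrow> norm (fst p) \<le> C' * norm (snd p)"
    and dense1: "closure (fst ` G) = UNIV" and dense2: "closure (snd ` G) = UNIV"
  shows "\<exists>X Y. bounded_clinear X \<and> bounded_clinear Y \<and> Y \<circ> X = id \<and> X \<circ> Y = id \<and>
    (\<forall>x y. (x, y) \<in> closure G \<longleftrightarrow> y = X x)"
proof -
  have swap_cl: "closed (prod.swap ` closure G)"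
  proof -
    have "prod.swap ` closure G = prod.swap -` closure G"
      by force
    then show ?thesis
      using closed_vimage[OF closed_closure continuous_on_swap] by simp
  qed
  have swap_sub: "complex_vs.subspace (prod.swap ` closure G)"
  proof (rule complex_vs.subspaceI)
    note cl = subspace_closure[OF sub]
    show "0 \<in> prod.swap ` closure G"
      using complex_vs.subspace_0[OF cl] by (auto simp: zero_prod_def image_iff intro!: bexI[of _ "(0, 0)"])
    show "p + q \<in> prod.swap ` closure G"
      if "p \<in> prod.swap ` closure G" "q \<in> prod.swap ` closure G" for p q
    proof -
      have "prod.swap (p + q) \<in> closure G"
        using that complex_vs.subspace_add[OF cl] by fastforce
      then show ?thesis
        by (metis image_eqI swap_swap)
    qed
    show "c *\<^sub>C p \<in> prod.swap ` closure G" if "p \<in> prod.swap ` closure G" for c p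
    proof -
      have "c *\<^sub>C prod.swap p \<in> closure G"
        using that complex_vs.subspace_scale[OF cl] by auto
      then have "prod.swap (c *\<^sub>C p) \<in> closure G"
        by (simp add: scaleC_prod_def)
      then show ?thesis
        by (metis image_eqI swap_swap)
    qed
  qed
  have c1: "norm (snd p) \<le> C * norm (fst p)" if "p \<in> closure G" for p
  proof -
    have "closed {p :: 'a \<times> 'b. norm (snd p) \<le> C * norm (fst p)}"
      by (intro closed_Collect_le continuous_intros)
    then have "closure G \<subseteq> {p. norm (snd p) \<le> C * norm (fst p)}"
      using bd1 by (intro closure_minimal) auto
    then show ?thesis
      using that by blast
  qed
  have c2: "norm (fst p) \<le> C' * norm (snd p)" if "p \<in> closure G" for p
  proof -
    have "closed {p :: 'a \<times> 'b. norm (fst p) \<le> C' * norm (snd p)}"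
      by (intro closed_Collect_le continuous_intros)
    then have "closure G \<subseteq> {p. norm (fst p) \<le> C' * norm (snd p)}"
      using bd2 by (intro closure_minimal) auto
    then show ?thesis
      using that by blast
  qed
  have d1: "closure (fst ` closure G) = UNIV" and d2: "closure (snd ` closure G) = UNIV"
    using dense1 dense2 closure_mono[OF image_mono[OF closure_subset]] by (metis top.extremum_uniqueI)+
  obtain X where X: "bounded_clinear X" "\<And>x y. (x, y) \<in> closure G \<longleftrightarrow> y = X x"
    using closed_graph_of_operator[OF subspace_closure[OF sub] closed_closure c1 d1] by blast
  have "closure (fst ` (prod.swap ` closure G)) = UNIV"
    using d2 by (simp add: image_image)
  then obtain Y where Y: "bounded_clinear Y"
      "\<And>y x. (y, x) \<in> prod.swap ` closure G \<longleftrightarrow> x = Y y"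
    using closed_graph_of_operator[OF swap_sub swap_cl, of C'] c2 by fastforce
  have Y': "(x, y) \<in> closure G \<longleftrightarrow> x = Y y" for x y
    using Y(2)[of y x] by (force simp: image_iff)
  have "Y \<circ> X = id" "X \<circ> Y = id"
    using X(2) Y' by (metis comp_apply eq_id_iff)+
  then show ?thesis
    using X Y(1) by blast
qed

section \<open>Closed range and lower bounds\<close>

text \<open>A case of the open mapping theorem. The range is complete, so by Baire's theorem the closure of
  the image of some ball has an interior point; successive approximation then solves \<open>F h = z\<close> with a
  bound on \<open>h\<close>, and injectivity makes every vector of \<open>M\<close> such a solution.\<close>

lemma bounded_below_of_closed_range:
  fixes F :: "'x::banach \<Rightarrow> 'y::banach"
  assumes F: "bounded_linear F" and M: "subspace M" "closed M"
    and inj: "\<And>h. h \<in> M \<Longrightarrow> F h = 0 \<Longrightarrow> h = 0"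
    and R: "closed (F ` M)"
  shows "\<exists>c>0. \<forall>h\<in>M. c * norm h \<le> norm (F h)"
proof -
  interpret F: bounded_linear F by (rule F)
  define R where "R = F ` M"
  have subR: "subspace R"
    unfolding R_def by (intro linear_subspace_image F.linear_axioms M)
  define A where "A k = closure (F ` {h\<in>M. norm h \<le> real k})" for k :: nat
  have A_sub: "A k \<subseteq> R" for k
    unfolding A_def using R by (intro closure_minimal) (auto simp: R_def)
  have "R \<subseteq> (\<Union>k. A k)"
  proof
    fix y assume "y \<in> R"
    then obtain h where h: "h \<in> M" "y = F h"
      by (auto simp: R_def)
    obtain k where "norm h \<le> real k"
      using real_arch_simple by blast
    then have "y \<in> A k"
      unfolding A_def using h by (intro subsetD[OF closure_subset]) auto
    then show "y \<in> (\<Union>k. A k)"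
      by blast
  qed
  then have AR: "\<Union> (range A) = R"
    using A_sub by blast
  have cm: "completely_metrizable_space (top_of_set R)"
    using R unfolding R_def closed_closedin
    by (rule completely_metrizable_space_closedin[OF completely_metrizable_space_euclidean])
  have "\<exists>k. (top_of_set R) interior_of (A k) \<noteq> {}"
  proof (rule ccontr)
    assume "\<not> ?thesis"
    then have emp: "(top_of_set R) interior_of (A k) = {}" for k
      by blast
    have "closedin (top_of_set R) (A k)" for k
      by (rule closed_subset[OF A_sub]) (simp add: A_def)
    then have "(top_of_set R) interior_of (\<Union> (range A)) = {}"
      by (intro Baire_category_alt disjI1 cm) (use emp in blast)+
    then show False
      unfolding AR using interior_of_topspace[of "top_of_set R"] subspace_0[OF subR] by auto
  qed
  then obtain k y where y: "y \<in> (top_of_set R) interior_of (A k)"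
    by blast
  then obtain W where W: "openin (top_of_set R) W" "W \<subseteq> A k" "y \<in> W"
    by (auto simp: interior_of_def)
  then obtain e where e: "e > 0" "ball y e \<inter> R \<subseteq> A k" and yR: "y \<in> R"
    unfolding openin_contains_ball by (meson order_trans subsetD)
  have yA: "y \<in> A k"
    using e yR by auto
  \<comment> \<open>The image of a ball is dense in a ball of the range around \<open>0\<close>; a homothety and one approximation
    halve any vector of the range.\<close>
  define K where "K = 4 * real k / e"
  have K0: "K \<ge> 0"
    using e by (simp add: K_def)
  have half: "\<exists>h\<in>M. norm h \<le> K * norm z \<and> norm (z - F h) \<le> norm z / 2" if z: "z \<in> R" for z
  proof (cases "z = 0")
    case True
    then show ?thesis
      using subspace_0[OF M(1)] by (intro bexI[of _ 0]) (auto simp: F.zero)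
  next
    case False
    define s where "s = e / (2 * norm z)"
    have s: "s > 0"
      using e False by (simp add: s_def)
    have "s *\<^sub>R z \<in> R"
      using z subR by (simp add: subspace_scale)
    moreover have "norm (s *\<^sub>R z) < e"
      using False e by (simp add: s_def)
    ultimately have "y + s *\<^sub>R z \<in> A k"
      using subspace_add[OF subR yR] by (intro subsetD[OF e(2)]) (simp add: dist_norm)
    then obtain a where a: "a \<in> M" "norm a \<le> real k" "dist (F a) (y + s *\<^sub>R z) < e / 8"
      unfolding A_def closure_approachable using e by (force dest!: spec[of _ "e/8"])
    obtain b where b: "b \<in> M" "norm b \<le> real k" "dist (F b) y < e / 8"
      using yA unfolding A_def closure_approachable using e by (force dest!: spec[of _ "e/8"])
    define h where "h = (1 / s) *\<^sub>R (a - b)"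
    have "norm (a - b) \<le> 2 * real k"
      using norm_triangle_ineq4[of a b] a b by linarith
    then have "norm h \<le> 2 * real k / s"
      using s by (simp add: h_def divide_right_mono)
    also have "\<dots> = K * norm z"
      using e False by (simp add: s_def K_def field_simps)
    finally have h1: "norm h \<le> K * norm z" .
    have "z - F h = (1 / s) *\<^sub>R ((y + s *\<^sub>R z - F a) + (F b - y))"
      using s by (simp add: h_def F.scaleR F.diff algebra_simps)
    then have "norm (z - F h) = norm ((y + s *\<^sub>R z - F a) + (F b - y)) / s"
      using s by simp
    also have "\<dots> \<le> (e / 4) / s"
    proof (rule divide_right_mono)
      show "norm ((y + s *\<^sub>R z - F a) + (F b - y)) \<le> e / 4"
        using norm_triangle_ineq[of "y + s *\<^sub>R z - F a" "F b - y"] a(3) b(3)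
        by (simp add: dist_norm norm_minus_commute)
    qed (use s in simp)
    also have "\<dots> = norm z / 2"
      using e False by (simp add: s_def field_simps)
    finally have "norm (z - F h) \<le> norm z / 2" .
    moreover have "h \<in> M"
      unfolding h_def using a b M by (intro subspace_scale subspace_diff)
    ultimately show ?thesis
      using h1 by blast
  qed
  then obtain g where g: "\<And>z. z \<in> R \<Longrightarrow> g z \<in> M" "\<And>z. z \<in> R \<Longrightarrow> norm (g z) \<le> K * norm z"
      "\<And>z. z \<in> R \<Longrightarrow> norm (z - F (g z)) \<le> norm z / 2"
    by metis
  have bound: "norm h0 \<le> 2 * K * norm (F h0)" if h0: "h0 \<in> M" for h0
  proof -
    define z where "z = rec_nat (F h0) (\<lambda>_ z. z - F (g z))"
    have z0: "z 0 = F h0" and zS: "\<And>n. z (Suc n) = z n - F (g (z n))"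
      by (simp_all add: z_def)
    have zR: "z n \<in> R" for n
    proof (induction n)
      case (Suc n)
      have "F (g (z n)) \<in> R"
        using g(1)[OF Suc] by (simp add: R_def)
      then show ?case
        unfolding zS by (intro subspace_diff subR Suc)
    qed (use h0 in \<open>simp add: z0 R_def\<close>)
    have zn: "norm (z n) \<le> norm (F h0) * (1/2)^n" for n
    proof (induction n)
      case (Suc n)
      then show ?case
        using g(3)[OF zR[of n]] by (simp add: zS)
    qed (simp add: z0)
    define q where "q n = K * norm (F h0) * (1/2)^n" for n
    have hn: "norm (g (z n)) \<le> q n" for n
    proof -
      have "norm (g (z n)) \<le> K * norm (z n)"
        by (rule g(2)[OF zR])
      also have "\<dots> \<le> K * (norm (F h0) * (1/2)^n)"
        by (intro mult_left_mono zn K0)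
      finally show ?thesis
        by (simp add: q_def mult.assoc)
    qed
    have q: "q sums (2 * K * norm (F h0))"
      using sums_mult[OF geometric_sums[of "1/2::real"], of "K * norm (F h0)"]
      by (simp add: q_def[abs_def] mult_ac)
    have sumn: "summable (\<lambda>n. norm (g (z n)))"
      by (rule summable_comparison_test'[OF sums_summable[OF q]]) (use hn in simp)
    then have sum: "summable (\<lambda>n. g (z n))"
      by (rule summable_norm_cancel)
    define h where "h = (\<Sum>n. g (z n))"
    have lim: "(\<lambda>n. \<Sum>i<n. g (z i)) \<longlonglongrightarrow> h"
      unfolding h_def using sum by (rule summable_LIMSEQ)
    have hM: "h \<in> M"
      by (rule closed_sequentially[OF M(2) _ lim]) (intro subspace_sum M g(1) zR)
    have "F (\<Sum>i<n. g (z i)) = F h0 - z n" for n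
      by (induction n) (simp_all add: F.zero F.add z0 zS)
    moreover have "z \<longlonglongrightarrow> 0"
    proof (rule Lim_null_comparison)
      show "(\<lambda>n. norm (F h0) * (1/2)^n) \<longlonglongrightarrow> 0"
        by (intro tendsto_mult_right_zero LIMSEQ_power_zero) auto
    qed (use zn in simp)
    ultimately have "(\<lambda>n. F (\<Sum>i<n. g (z i))) \<longlonglongrightarrow> F h0"
      using tendsto_diff[OF tendsto_const[of "F h0"], of z 0] by simp
    moreover have "(\<lambda>n. F (\<Sum>i<n. g (z i))) \<longlonglongrightarrow> F h"
      by (rule F.tendsto[OF lim])
    ultimately have "F h = F h0"
      using LIMSEQ_unique by blast
    then have "h - h0 = 0"
      by (intro inj) (use hM h0 M in \<open>auto simp: F.diff subspace_diff\<close>)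
    then have "norm h0 = norm h"
      by simp
    also have "\<dots> \<le> (\<Sum>n. norm (g (z n)))"
      unfolding h_def by (rule summable_norm[OF sumn])
    also have "\<dots> \<le> (\<Sum>n. q n)"
      by (rule suminf_le[OF hn sumn sums_summable[OF q]])
    also have "\<dots> = 2 * K * norm (F h0)"
      using sums_unique[OF q] by simp
    finally show ?thesis .
  qed
  show ?thesis
  proof (intro exI[of _ "1 / (2 * K + 1)"] conjI ballI)
    fix h assume "h \<in> M"
    then have "norm h \<le> 2 * K * norm (F h) + norm (F h)"
      using bound[of h] norm_ge_zero[of "F h"] by linarith
    then have "norm h \<le> (2 * K + 1) * norm (F h)"
      by (simp add: distrib_right)
    then show "1 / (2 * K + 1) * norm h \<le> norm (F h)"
      using K0 by (simp add: pos_divide_le_eq mult.commute)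
  qed (use K0 in simp)
qed

section \<open>Holomorphic maps with values in a Hilbert space\<close>

lemma norm_vector_smult: "norm (c *s v) = cmod c * norm v"
  for v :: "complex^'m::finite"
  by (simp add: norm_vec_def norm_mult L2_set_right_distrib)

lemma bounded_linear_smult_left: "bounded_linear (\<lambda>h. h *s v)"
  for v :: "complex^'m::finite"
  by (rule bounded_linear_intro[of _ "norm v"])
    (auto simp: norm_vector_smult vec_eq_iff algebra_simps)

lemma axis_eq_smult: "axis i c = c *s axis i (1::complex)"
  by (auto simp: vec_eq_iff axis_def)

lemma has_derivative_quadratic_error:
  fixes f :: "'a::real_normed_vector \<Rightarrow> 'b::real_normed_vector"
  assumes D: "bounded_linear D" and e: "e > 0"
    and err: "\<And>y. dist y x < e \<Longrightarrow> norm (f y - f x - D (y - x)) \<le> C * (norm (y - x))\<^sup>2"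
  shows "(f has_derivative D) (at x)"
proof (rule has_derivativeI_sandwich[OF e D])
  fix y assume "y \<noteq> x" "dist y x < e"
  then show "norm (f y - f x - D (y - x)) / norm (y - x) \<le> C * norm (y - x)"
    using err[of y] by (simp add: divide_le_eq power2_eq_square mult.assoc)
next
  have "((\<lambda>y. C * norm (y - x)) \<longlongrightarrow> C * norm (x - x)) (at x)"
    by (intro tendsto_intros)
  then show "((\<lambda>y. C * norm (y - x)) \<longlongrightarrow> 0) (at x)"
    by simp
qed

definition has_cderiv :: "(complex \<Rightarrow> 'a::complex_hilbert_space) \<Rightarrow> 'a \<Rightarrow> complex \<Rightarrow> bool"
  where "has_cderiv a a' z \<longleftrightarrow> (a has_derivative (\<lambda>h. h *\<^sub>C a')) (at z)"

lemma bounded_linear_scaleC_left: "bounded_linear (\<lambda>h. h *\<^sub>C x)"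
  by (rule bounded_bilinear.bounded_linear_left[OF bounded_bilinear_scaleC])

lemma bounded_linear_scaleC_right: "bounded_linear (\<lambda>x. c *\<^sub>C x)"
  by (rule bounded_bilinear.bounded_linear_right[OF bounded_bilinear_scaleC])

lemma scaleC_diff_right: "c *\<^sub>C (x - y) = c *\<^sub>C x - c *\<^sub>C y"
  by (rule bounded_bilinear.diff_right[OF bounded_bilinear_scaleC])

lemma scaleC_diff_left: "(c - d) *\<^sub>C x = c *\<^sub>C x - d *\<^sub>C x"
  by (rule bounded_bilinear.diff_left[OF bounded_bilinear_scaleC])

lemma scaleC_one [simp]: "1 *\<^sub>C x = x"
  by (rule complex_vs.scale_one)

lemma has_cderiv_diff:
  "has_cderiv a a' z \<Longrightarrow> has_cderiv b b' z \<Longrightarrow> has_cderiv (\<lambda>z. a z - b z) (a' - b') z"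
  unfolding has_cderiv_def by (drule (1) has_derivative_diff) (simp add: scaleC_diff_right)

lemma has_cderiv_scaleC:
  "has_cderiv a a' z \<Longrightarrow> has_cderiv (\<lambda>z. c *\<^sub>C a z) (c *\<^sub>C a') z"
  unfolding has_cderiv_def
  by (drule bounded_linear.has_derivative[OF bounded_linear_scaleC_right[of c]])
    (simp add: scaleC_scaleC mult.commute)

lemma has_cderiv_cinner_left:
  assumes "has_cderiv a a' z"
  shows "((\<lambda>z. cinner (a z) x) has_field_derivative cinner a' x) (at z)"
proof -
  have "((\<lambda>z. cinner (a z) x) has_derivative (\<lambda>h. cinner (h *\<^sub>C a') x)) (at z)"
    using assms unfolding has_cderiv_def
    by (rule bounded_linear.has_derivative[OF
          bounded_bilinear.bounded_linear_left[OF bounded_bilinear_cinner]])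
  then show ?thesis
    by (simp add: has_field_derivative_def cinner_scaleC_left mult.commute[of _ "cinner a' x"])
qed

text \<open>The circle of radius \<open>r / 2\<close> is used because nothing is assumed on the boundary of the ball.\<close>

lemma Cauchy_estimate_first:
  assumes a: "\<And>z. z \<in> ball c r \<Longrightarrow> has_cderiv a (a' z) z"
    and M: "\<And>z. z \<in> ball c r \<Longrightarrow> norm (a z) \<le> M" and r: "r > 0"
  shows "norm (a' c) \<le> 2 * M / r"
proof (rule norm_le_if_cinner_le)
  have "M \<ge> 0"
    using M[of c] r norm_ge_zero[of "a c"] by (metis centre_in_ball order_trans)
  then show "2 * M / r \<ge> 0"
    using r by simp
  fix x
  let ?g = "\<lambda>z. cinner (a z) x"
  have g: "(?g has_field_derivative cinner (a' z) x) (at z)" if "z \<in> ball c r" for z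
    by (rule has_cderiv_cinner_left[OF a[OF that]])
  have hol: "?g holomorphic_on ball c r"
    unfolding holomorphic_on_open[OF open_ball] using g by blast
  have "norm ((deriv ^^ 1) ?g c) \<le> fact 1 * (M * norm x) / (r / 2) ^ 1"
  proof (rule Cauchy_inequality)
    show "?g holomorphic_on ball c (r / 2)"
      using r by (intro holomorphic_on_subset[OF hol]) (auto simp: dist_norm)
    show "continuous_on (cball c (r / 2)) ?g"
      using r by (intro continuous_on_subset[OF holomorphic_on_imp_continuous_on[OF hol]])
        (auto simp: dist_norm)
    fix z assume "norm (c - z) = r / 2"
    then have "z \<in> ball c r"
      using r by (simp add: dist_norm)
    then show "norm (?g z) \<le> M * norm x"
      using M by (intro order_trans[OF cinner_Cauchy_Schwarz] mult_right_mono) auto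
  qed (use r in simp)
  moreover have "deriv ?g c = cinner (a' c) x"
    using g r by (intro DERIV_imp_deriv) simp
  ultimately show "cmod (cinner (a' c) x) \<le> 2 * M / r * norm x"
    by (simp add: mult_ac)
qed

text \<open>The second derivative at each point of the ball of radius \<open>r / 4\<close> is estimated on the circle
  of radius \<open>r / 2\<close> around that point, which stays inside the original ball.\<close>

lemma Cauchy_estimate_Taylor:
  assumes a: "\<And>z. z \<in> ball c r \<Longrightarrow> has_cderiv a (a' z) z"
    and M: "\<And>z. z \<in> ball c r \<Longrightarrow> norm (a z) \<le> M" and s: "cmod s < r / 4"
  shows "norm (a (c + s) - a c - s *\<^sub>C a' c) \<le> 8 * M / r\<^sup>2 * (cmod s)\<^sup>2"
proof (rule norm_le_if_cinner_le)
  have r: "r > 0"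
    using s norm_ge_zero[of s] by linarith
  have "M \<ge> 0"
    using M[of c] r norm_ge_zero[of "a c"] by (metis centre_in_ball order_trans)
  then show "8 * M / r\<^sup>2 * (cmod s)\<^sup>2 \<ge> 0"
    by simp
  fix x
  define g where "g z = cinner (a z) x" for z
  have g: "(g has_field_derivative cinner (a' z) x) (at z)" if "z \<in> ball c r" for z
    unfolding g_def by (rule has_cderiv_cinner_left[OF a[OF that]])
  have hol: "g holomorphic_on ball c r"
    unfolding holomorphic_on_open[OF open_ball] using g by blast
  have hol': "deriv g holomorphic_on ball c r"
    by (rule holomorphic_deriv[OF hol]) simp
  have sub: "cball z (r / 2) \<subseteq> ball c r" if "z \<in> ball c (r / 4)" for z
  proof
    fix y assume "y \<in> cball z (r / 2)"
    then show "y \<in> ball c r"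
      using that r dist_triangle[of c y z] by simp
  qed
  have "cmod (g (c + s) - (\<Sum>i\<le>1. (deriv ^^ i) g c * ((c + s) - c) ^ i / fact i))
    \<le> (8 * M * norm x / r\<^sup>2) * cmod ((c + s) - c) ^ Suc 1 / fact 1"
  proof (rule complex_Taylor[where S = "ball c (r / 4)" and f = "\<lambda>i. (deriv ^^ i) g", simplified funpow_0, simplified id_apply])
    fix i z assume z: "z \<in> ball c (r / 4)" and "i \<le> (1::nat)"
    then have "z \<in> ball c r"
      using r by simp
    then have "((deriv ^^ i) g has_field_derivative deriv ((deriv ^^ i) g) z) (at z)"
      using hol hol' \<open>i \<le> 1\<close>
      by (intro holomorphic_derivI[of _ "ball c r"]) (auto simp: le_Suc_eq)
    then show "((deriv ^^ i) g has_field_derivative (deriv ^^ Suc i) g z) (at z within ball c (r / 4))"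
      by (simp add: has_field_derivative_at_within)
  next
    fix z assume z: "z \<in> ball c (r / 4)"
    have "norm ((deriv ^^ 2) g z) \<le> fact 2 * (M * norm x) / (r / 2) ^ 2"
    proof (rule Cauchy_inequality)
      show "g holomorphic_on ball z (r / 2)"
        using sub[OF z] by (intro holomorphic_on_subset[OF hol]) auto
      show "continuous_on (cball z (r / 2)) g"
        using sub[OF z] by (intro continuous_on_subset[OF holomorphic_on_imp_continuous_on[OF hol]])
      fix y assume "norm (z - y) = r / 2"
      then have "y \<in> ball c r"
        using sub[OF z] by (auto simp: dist_norm)
      then show "norm (g y) \<le> M * norm x"
        unfolding g_def using M by (intro order_trans[OF cinner_Cauchy_Schwarz] mult_right_mono) auto
    qed (use r in simp)
    also have "\<dots> = 8 * M * norm x / r\<^sup>2"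
      by (simp add: power2_eq_square field_simps)
    finally show "cmod ((deriv ^^ Suc 1) g z) \<le> 8 * M * norm x / r\<^sup>2"
      by (simp add: numeral_2_eq_2)
  qed (use r s in \<open>auto simp: dist_norm\<close>)
  moreover have "deriv g c = cinner (a' c) x"
    using g r by (intro DERIV_imp_deriv) simp
  ultimately show "cmod (cinner (a (c + s) - a c - s *\<^sub>C a' c) x) \<le> 8 * M / r\<^sup>2 * (cmod s)\<^sup>2 * norm x"
    by (simp add: g_def cinner_diff_left cinner_scaleC_left power2_eq_square mult_ac diff_diff_eq cinner_add_left)
qed

definition dirder :: "(complex^'m::finite \<Rightarrow> 'a::complex_hilbert_space) \<Rightarrow> complex^'m \<Rightarrow> complex^'m \<Rightarrow> 'a"
  where "dirder f v w = frechet_derivative f (at w) v"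

lemma
  assumes "holomorphic_Cm f U" "w \<in> U"
  shows has_derivative_dirder: "(f has_derivative (\<lambda>v. dirder f v w)) (at w)"
    and dirder_smult: "dirder f (c *s v) w = c *\<^sub>C dirder f v w"
    and dirder_expand: "dirder f v w = (\<Sum>i\<in>UNIV. (v $ i) *\<^sub>C dirder f (axis i 1) w)"
proof -
  obtain D where D: "(f has_derivative D) (at w)" "\<And>c v. D (c *s v) = c *\<^sub>C D v"
    using assms by (auto simp: holomorphic_Cm_def)
  have eq: "dirder f v w = D v" for v
    using frechet_derivative_at[OF D(1)] by (simp add: dirder_def)
  show "(f has_derivative (\<lambda>v. dirder f v w)) (at w)"
    using D(1) by (simp add: eq)
  show sm: "dirder f (c *s v) w = c *\<^sub>C dirder f v w" for c v
    by (simp add: eq D(2))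
  interpret D: linear D
    using D(1) has_derivative_linear by blast
  have "v = (\<Sum>i\<in>UNIV. (v $ i) *s axis i 1)"
    using basis_expansion[of v] by simp
  then have "D v = (\<Sum>i\<in>UNIV. D ((v $ i) *s axis i 1))"
    by (metis D.sum)
  then show "dirder f v w = (\<Sum>i\<in>UNIV. (v $ i) *\<^sub>C dirder f (axis i 1) w)"
    by (simp add: eq D(2))
qed

lemma has_derivative_line:
  fixes v :: "complex^'m::finite"
  shows "((\<lambda>z. w + z *s v) has_derivative (\<lambda>h. h *s v)) (at z)"
  using bounded_linear.has_derivative[OF bounded_linear_smult_left[of v] has_derivative_ident]
    has_derivative_add[OF has_derivative_const[of w]] by fastforce

lemma has_cderiv_line:
  assumes "holomorphic_Cm f U" "w + z *s v \<in> U"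
  shows "has_cderiv (\<lambda>z. f (w + z *s v)) (dirder f v (w + z *s v)) z"
  using has_derivative_compose[OF has_derivative_line[of w v z]
      has_derivative_dirder[OF assms]]
  by (simp add: has_cderiv_def dirder_smult[OF assms])

text \<open>A directional derivative of a holomorphic map is again holomorphic along complex lines. With
  \<open>F(s, t) = f(w + s u + t v)\<close>, the difference quotient \<open>Q\<^sub>s(t) = (F(s, t) - F(0, t)) / s\<close> is within
  \<open>O(|s|)\<close> of \<open>\<partial>\<^sub>u f(w + t v)\<close>, uniformly in \<open>t\<close>. So \<open>Q\<^sub>s - Q\<^sub>s\<^sub>'\<close>
  is \<open>O(|s| + |s'|)\<close>, and a Cauchy estimate in \<open>t\<close> gives the same bound for the difference of two
  difference quotients of \<open>\<partial>\<^sub>v f\<close>. Those quotients converge by completeness.\<close>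

lemma dirder_has_cderiv_at_0:
  fixes f :: "complex^'m::finite \<Rightarrow> 'a::complex_hilbert_space"
  assumes hol: "holomorphic_Cm f U" and U: "open U" and w: "w \<in> U"
  shows "\<exists>d. has_cderiv (\<lambda>z. dirder f v (w + z *s u)) d 0"
proof -
  define M where "M = norm (f w) + 1"
  have "continuous (at w) f"
    using has_derivative_continuous[OF has_derivative_dirder[OF hol w]] .
  then have "\<forall>\<^sub>F z in nhds w. norm (f z) < M"
    by (intro order_tendstoD(2)[of _ "norm (f w)"])
      (auto simp: M_def isCont_def tendsto_at_iff_tendsto_nhds intro!: tendsto_norm)
  then obtain e1 where e1: "e1 > 0" "\<And>z. dist z w < e1 \<Longrightarrow> norm (f z) < M"
    by (auto simp: eventually_nhds_metric)
  obtain e2 where e2: "e2 > 0" "ball w e2 \<subseteq> U"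
    using U w by (auto simp: open_contains_ball)
  define e where "e = min e1 e2"
  have e: "e > 0" "\<And>z. dist z w < e \<Longrightarrow> norm (f z) \<le> M" "\<And>z. dist z w < e \<Longrightarrow> z \<in> U"
    using e1 e2 by (auto simp: e_def dist_commute intro!: less_imp_le)
  \<comment> \<open>The summand \<open>1\<close> makes the estimate below strict and covers \<open>u = v = 0\<close>.\<close>
  define r where "r = e / (norm u + norm v + 1)"
  have r: "r > 0"
    using e by (simp add: r_def add_nonneg_pos)
  have near: "dist (w + s *s u + t *s v) w < e" if "cmod s < r" "cmod t < r" for s t
  proof -
    have "norm (s *s u + t *s v) \<le> cmod s * norm u + cmod t * norm v"
      using norm_triangle_ineq[of "s *s u" "t *s v"] by (simp add: norm_vector_smult)
    also have "\<dots> \<le> r * norm u + r * norm v"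
      using that by (intro add_mono mult_right_mono) auto
    also have "\<dots> < r * (norm u + norm v + 1)"
      using r by (simp add: algebra_simps)
    also have "\<dots> = e"
      by (simp add: r_def add_nonneg_pos[THEN less_imp_neq, THEN not_sym])
    finally show ?thesis
      by (simp add: dist_norm add.assoc)
  qed
  define F where "F s t = f (w + s *s u + t *s v)" for s t
  define D where "D s = dirder f v (w + s *s u)" for s
  have F_s: "has_cderiv (\<lambda>s. F s t) (dirder f u (w + s *s u + t *s v)) s"
    if "cmod s < r" "cmod t < r" for s t
    using has_cderiv_line[OF hol, of "w + t *s v" s u] e(3)[OF near[OF that]]
    by (simp add: F_def add_ac)
  have F_t: "has_cderiv (\<lambda>t. F s t) (dirder f v (w + s *s u + t *s v)) t"
    if "cmod s < r" "cmod t < r" for s t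
    using has_cderiv_line[OF hol, of "w + s *s u" t v] e(3)[OF near[OF that]]
    by (simp add: F_def add_ac)
  have M0: "M \<ge> 0"
    by (simp add: M_def)
  define B where "B = 8 * M / r\<^sup>2"
  have B0: "B \<ge> 0"
    using M0 by (simp add: B_def)
  define Q where "Q s t = inverse s *\<^sub>C (F s t - F 0 t)" for s t
  have Q_bd: "norm (Q s t - dirder f u (w + t *s v)) \<le> B * cmod s"
    if s: "s \<noteq> 0" "cmod s < r / 4" and t: "cmod t < r" for s t
  proof -
    have "norm (F (0 + s) t - F 0 t - s *\<^sub>C dirder f u (w + 0 *s u + t *s v)) \<le> 8 * M / r\<^sup>2 * (cmod s)\<^sup>2"
      by (rule Cauchy_estimate_Taylor[where r = r and a = "\<lambda>s. F s t" and a' = "\<lambda>s. dirder f u (w + s *s u + t *s v)"])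
        (use F_s t s e(2)[OF near] in \<open>auto simp: F_def dist_norm\<close>)
    then have "norm (F s t - F 0 t - s *\<^sub>C dirder f u (w + t *s v)) \<le> B * (cmod s)\<^sup>2"
      by (simp add: B_def)
    moreover have "Q s t - dirder f u (w + t *s v)
        = inverse s *\<^sub>C (F s t - F 0 t - s *\<^sub>C dirder f u (w + t *s v))"
      using s by (simp add: Q_def scaleC_diff_right scaleC_scaleC)
    ultimately have "norm (Q s t - dirder f u (w + t *s v)) \<le> inverse (cmod s) * (B * (cmod s)\<^sup>2)"
      by (simp only: norm_scaleC norm_inverse) (simp add: mult_left_mono)
    also have "\<dots> = B * cmod s"
      using s by (simp add: power2_eq_square field_simps)
    finally show ?thesis .
  qed
  define q where "q s = inverse s *\<^sub>C (D s - D 0)" for s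
  define C where "C = 2 * B / r"
  have C0: "C \<ge> 0"
    using B0 r by (simp add: C_def)
  have q_bd: "norm (q s - q s') \<le> C * (cmod s + cmod s')"
    if s: "s \<noteq> 0" "cmod s < r / 4" and s': "s' \<noteq> 0" "cmod s' < r / 4" for s s'
  proof -
    have "norm (inverse s *\<^sub>C (dirder f v (w + s *s u + 0 *s v) - dirder f v (w + 0 *s u + 0 *s v))
        - inverse s' *\<^sub>C (dirder f v (w + s' *s u + 0 *s v) - dirder f v (w + 0 *s u + 0 *s v)))
      \<le> 2 * (B * (cmod s + cmod s')) / r"
    proof (rule Cauchy_estimate_first[where a = "\<lambda>t. Q s t - Q s' t" and c = 0 and
          a' = "\<lambda>t. inverse s *\<^sub>C (dirder f v (w + s *s u + t *s v) - dirder f v (w + 0 *s u + t *s v))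
        - inverse s' *\<^sub>C (dirder f v (w + s' *s u + t *s v) - dirder f v (w + 0 *s u + t *s v))"])
      fix t :: complex assume "t \<in> ball 0 r"
      then have t: "cmod t < r"
        by simp
      show "has_cderiv (\<lambda>t. Q s t - Q s' t)
          (inverse s *\<^sub>C (dirder f v (w + s *s u + t *s v) - dirder f v (w + 0 *s u + t *s v))
        - inverse s' *\<^sub>C (dirder f v (w + s' *s u + t *s v) - dirder f v (w + 0 *s u + t *s v))) t"
        unfolding Q_def
        by (intro has_cderiv_diff has_cderiv_scaleC F_t) (use s s' t r in auto)
      have "norm (Q s t - Q s' t) \<le> norm (Q s t - dirder f u (w + t *s v))
          + norm (Q s' t - dirder f u (w + t *s v))"
        using norm_triangle_ineq4[of "Q s t - dirder f u (w + t *s v)" "Q s' t - dirder f u (w + t *s v)"]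
        by simp
      then show "norm (Q s t - Q s' t) \<le> B * (cmod s + cmod s')"
        using Q_bd[OF s t] Q_bd[OF s' t] by (simp add: algebra_simps)
    qed (rule r)
    then show ?thesis
      by (simp add: q_def D_def C_def)
  qed
  define sq where "sq n = complex_of_real (r / 8 * inverse (real (Suc n)))" for n
  have sq_norm: "cmod (sq n) = r / 8 * inverse (real (Suc n))" for n
    using r by (simp add: sq_def norm_mult norm_inverse norm_divide del: of_real_mult of_real_inverse of_nat_Suc)
  have sq: "sq n \<noteq> 0" "cmod (sq n) < r / 4" for n
  proof -
    show "sq n \<noteq> 0"
      using r unfolding sq_def of_real_eq_0_iff by simp
    have "inverse (real (Suc n)) \<le> 1"
      by (simp add: inverse_le_1_iff)
    then have "r / 8 * inverse (real (Suc n)) \<le> r / 8 * 1"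
      using r by (intro mult_left_mono) auto
    then show "cmod (sq n) < r / 4"
      using r unfolding sq_norm by linarith
  qed
  have sq0: "(\<lambda>n. cmod (sq n)) \<longlonglongrightarrow> 0"
    unfolding sq_norm by (intro tendsto_mult_right_zero LIMSEQ_inverse_real_of_nat)
  have "Cauchy (\<lambda>n. q (sq n))"
  proof (rule metric_CauchyI)
    fix \<epsilon> :: real assume "\<epsilon> > 0"
    then have "\<forall>\<^sub>F n in sequentially. cmod (sq n) < \<epsilon> / (2 * (C + 1))"
      using sq0 C0 by (intro order_tendstoD(2)[OF sq0]) auto
    then obtain N where N: "\<And>n. n \<ge> N \<Longrightarrow> cmod (sq n) < \<epsilon> / (2 * (C + 1))"
      by (auto simp: eventually_sequentially)
    have "dist (q (sq m)) (q (sq n)) < \<epsilon>" if "m \<ge> N" "n \<ge> N" for m n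
    proof -
      have "dist (q (sq m)) (q (sq n)) \<le> C * (cmod (sq m) + cmod (sq n))"
        using q_bd[OF sq sq] by (simp add: dist_norm)
      also have "\<dots> \<le> (C + 1) * (cmod (sq m) + cmod (sq n))"
        by (intro mult_right_mono) auto
      also have "\<dots> < (C + 1) * (\<epsilon> / (2 * (C + 1)) + \<epsilon> / (2 * (C + 1)))"
        using C0 N that by (intro mult_strict_left_mono add_strict_mono) auto
      also have "\<dots> = \<epsilon>"
      proof -
        have "x * (\<epsilon> / (2 * x) + \<epsilon> / (2 * x)) = \<epsilon>" if "x \<noteq> 0" for x
          using that by (simp add: field_simps)
        from this[of "C + 1"] C0 show ?thesis
          by linarith
      qed
      finally show ?thesis .
    qed
    then show "\<exists>N. \<forall>m\<ge>N. \<forall>n\<ge>N. dist (q (sq m)) (q (sq n)) < \<epsilon>"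
      by blast
  qed
  then obtain d where d: "(\<lambda>n. q (sq n)) \<longlonglongrightarrow> d"
    using Cauchy_convergent convergent_def by blast
  have qd: "norm (q s - d) \<le> C * cmod s" if s: "s \<noteq> 0" "cmod s < r / 4" for s
  proof (rule LIMSEQ_le)
    show "(\<lambda>n. norm (q s - q (sq n))) \<longlonglongrightarrow> norm (q s - d)"
      by (intro tendsto_intros d)
    show "(\<lambda>n. C * (cmod s + cmod (sq n))) \<longlonglongrightarrow> C * cmod s"
      using tendsto_mult[OF tendsto_const tendsto_add[OF tendsto_const sq0], of C "cmod s"] by simp
  qed (use q_bd[OF s sq] in blast)
  have "has_cderiv D d 0"
    unfolding has_cderiv_def
  proof (rule has_derivative_quadratic_error[OF bounded_linear_scaleC_left, of "r / 4" _ _ _ C])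
    fix s :: complex assume "dist s 0 < r / 4"
    then have s: "cmod s < r / 4" by simp
    show "norm (D s - D 0 - (s - 0) *\<^sub>C d) \<le> C * (norm (s - 0))\<^sup>2"
    proof (cases "s = 0")
      case False
      then have "D s - D 0 - s *\<^sub>C d = s *\<^sub>C (q s - d)"
        by (simp add: q_def scaleC_diff_right scaleC_scaleC)
      then show ?thesis
        using qd[OF False s] mult_left_mono[OF qd[OF False s], of "cmod s"]
        by (simp add: norm_scaleC power2_eq_square mult_ac)
    qed simp
  qed (use r in simp)
  then show ?thesis
    unfolding D_def by blast
qed

lemma dirder_has_cderiv:
  assumes hol: "holomorphic_Cm f U" and U: "open U" and w: "w + z *s u \<in> U"
  shows "\<exists>d. has_cderiv (\<lambda>z. dirder f v (w + z *s u)) d z"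
proof -
  obtain d where "has_cderiv (\<lambda>h. dirder f v ((w + z *s u) + h *s u)) d 0"
    using dirder_has_cderiv_at_0[OF assms] by blast
  then have "((\<lambda>h. dirder f v ((w + z *s u) + h *s u)) has_derivative (\<lambda>h. h *\<^sub>C d)) (at (z - z))"
    by (simp add: has_cderiv_def)
  then have "((\<lambda>y. dirder f v ((w + z *s u) + (y - z) *s u)) has_derivative (\<lambda>h. h *\<^sub>C d)) (at z)"
    by (rule has_derivative_compose[rotated, where f = "\<lambda>y. y - z" and f' = "\<lambda>h. h"])
      (auto intro!: derivative_eq_intros)
  moreover have "(w + z *s u) + (y - z) *s u = w + y *s u" for y
    by (simp add: vec_eq_iff algebra_simps)
  ultimately show ?thesis
    unfolding has_cderiv_def by auto
qed

section \<open>Sesquiholomorphic kernels in one variable\<close>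

text \<open>Real differentiability of \<open>f\<close> as a function of two variables, holomorphic in the first and
  antiholomorphic in the second, with \<open>f1 = \<partial>f/\<partial>z\<close> and \<open>f2 = \<partial>f/\<partial>(cnj y)\<close>. 
  Joint differentiability is demanded so that \<open>f\<close> can be composed with curves in both variables at
  once.\<close>

definition sesqui ::
    "(complex \<Rightarrow> complex \<Rightarrow> complex) \<Rightarrow> complex \<Rightarrow> complex \<Rightarrow> complex \<Rightarrow> complex \<Rightarrow> bool"
  where "sesqui f f1 f2 z y \<longleftrightarrow>
    ((\<lambda>p. f (fst p) (snd p)) has_derivative (\<lambda>q. fst q * f1 + cnj (snd q) * f2)) (at (z, y))"

lemma sesqui_cinner:
  assumes "has_cderiv a a' z" "has_cderiv b b' y"
  shows "sesqui (\<lambda>z y. cinner (a z) (b y)) (cinner a' (b y)) (cinner (a z) b') z y"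
proof -
  have "((\<lambda>p. a (fst p)) has_derivative (\<lambda>q. fst q *\<^sub>C a')) (at (z, y))"
    using assms(1) unfolding has_cderiv_def
    by (intro has_derivative_compose[of fst fst, where g = a]) (auto intro!: derivative_eq_intros)
  moreover have "((\<lambda>p. b (snd p)) has_derivative (\<lambda>q. snd q *\<^sub>C b')) (at (z, y))"
    using assms(2) unfolding has_cderiv_def
    by (intro has_derivative_compose[of snd snd, where g = b]) (auto intro!: derivative_eq_intros)
  ultimately show ?thesis
    unfolding sesqui_def using has_derivative_cinner
    by (fastforce simp: cinner_scaleC_left cinner_scaleC_right add.commute)
qed

lemma sesqui_mult:
  assumes "sesqui f f1 f2 z y" "sesqui g g1 g2 z y"
  shows "sesqui (\<lambda>z y. f z y * g z y) (f z y * g1 + f1 * g z y) (f z y * g2 + f2 * g z y) z y"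
  using has_derivative_mult[OF assms[unfolded sesqui_def]]
  by (simp add: sesqui_def algebra_simps)

lemma sesqui_diff:
  assumes "sesqui f f1 f2 z y" "sesqui g g1 g2 z y"
  shows "sesqui (\<lambda>z y. f z y - g z y) (f1 - g1) (f2 - g2) z y"
  using has_derivative_diff[OF assms[unfolded sesqui_def]]
  by (simp add: sesqui_def algebra_simps)

lemma sesqui_sum:
  assumes "\<And>k. k \<in> I \<Longrightarrow> sesqui (f k) (f1 k) (f2 k) z y"
  shows "sesqui (\<lambda>z y. \<Sum>k\<in>I. f k z y) (\<Sum>k\<in>I. f1 k) (\<Sum>k\<in>I. f2 k) z y"
  using has_derivative_sum[of I "\<lambda>k p. f k (fst p) (snd p)", OF assms[unfolded sesqui_def]]
  by (simp add: sesqui_def sum.distrib sum_distrib_left)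

lemma sesqui_left:
  assumes "sesqui f f1 f2 z y"
  shows "((\<lambda>z. f z y) has_field_derivative f1) (at z)"
proof -
  have "((\<lambda>x. (x, y)) has_derivative (\<lambda>h. (h, 0))) (at z)"
    by (auto intro!: derivative_eq_intros)
  from has_derivative_compose[OF this assms[unfolded sesqui_def]]
  show ?thesis
    by (simp add: has_field_derivative_def mult.commute[of _ f1])
qed

lemma sesqui_right:
  assumes "sesqui f f1 f2 z y"
  shows "((\<lambda>y. cnj (f z y)) has_field_derivative cnj f2) (at y)"
proof -
  have "((\<lambda>x. (z, x)) has_derivative (\<lambda>h. (0, h))) (at y)"
    by (auto intro!: derivative_eq_intros)
  from bounded_linear.has_derivative[OF bounded_linear_cnj has_derivative_compose[OF this assms[unfolded sesqui_def]]]
  show ?thesis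
    by (simp add: has_field_derivative_def mult.commute[of _ "cnj f2"])
qed

lemma holomorphic_zero_on_reals:
  assumes g: "g holomorphic_on ball 0 r" and zero: "\<And>t. \<bar>t\<bar> < r \<Longrightarrow> g (complex_of_real t) = 0"
    and z: "cmod z < r"
  shows "g z = 0"
proof (rule analytic_continuation[OF g open_ball connected_ball])
  have r: "r > 0"
    using z norm_ge_zero[of z] by linarith
  show "complex_of_real ` {-r<..<r} \<subseteq> ball 0 r"
    by auto
  show "0 islimpt complex_of_real ` {-r<..<r}"
    unfolding islimpt_approachable
  proof (intro allI impI)
    fix e :: real assume "e > 0"
    define t where "t = min e r / 2"
    have "0 < t" "t < e" "t < r"
      using r \<open>e > 0\<close> by (auto simp: t_def min_def)
    then show "\<exists>x\<in>complex_of_real ` {-r<..<r}. x \<noteq> 0 \<and> dist x 0 < e"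
      by (intro bexI[of _ "complex_of_real t"]) auto
  qed
  show "g y = 0" if "y \<in> complex_of_real ` {-r<..<r}" for y
    using that zero by (auto simp: abs_less_iff)
qed (use z norm_ge_zero[of z] in \<open>auto intro: le_less_trans[OF norm_ge_zero]\<close>)

text \<open>In the coordinates \<open>z = c + x + \<i> y\<close>, \<open>y' = c + cnj x + \<i> cnj y\<close> the kernel \<open>f(z, y')\<close>
  is holomorphic in \<open>x\<close> and in \<open>y\<close>, and real \<open>x\<close>, \<open>y\<close> correspond to the diagonal. So it vanishes for
  all small complex \<open>x\<close>, \<open>y\<close>, in particular for those with \<open>y' = c\<close>.\<close>

lemma polarization_at_center:
  assumes f: "\<And>z y. z \<in> ball c r \<Longrightarrow> y \<in> ball c r \<Longrightarrow> \<exists>f1 f2. sesqui f f1 f2 z y"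
    and diag: "\<And>z. z \<in> ball c r \<Longrightarrow> f z z = 0" and z: "z \<in> ball c r"
  shows "f z c = 0"
proof -
  define G where "G x y = f (c + x + \<i> * y) (c + cnj x + \<i> * cnj y)" for x y
  have mem: "c + x + \<i> * y \<in> ball c r \<and> c + cnj x + \<i> * cnj y \<in> ball c r"
    if "cmod x < r / 2" "cmod y < r / 2" for x y :: complex
  proof -
    have "cmod (x + \<i> * y) < r" "cmod (cnj x + \<i> * cnj y) < r"
      using that norm_triangle_ineq[of x "\<i> * y"] norm_triangle_ineq[of "cnj x" "\<i> * cnj y"]
      by (auto simp: norm_mult)
    moreover have "dist c (c + v) = cmod v" for v
      by (simp add: dist_norm)
    ultimately show ?thesis
      by (simp only: mem_ball add.assoc)
  qed
  have Gx: "(\<lambda>x. G x y) holomorphic_on ball 0 (r / 2)" if y: "cmod y < r / 2" for y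
    unfolding holomorphic_on_open[OF open_ball]
  proof
    fix x :: complex assume "x \<in> ball 0 (r / 2)"
    then have x: "cmod x < r / 2" by simp
    then obtain f1 f2 where s: "sesqui f f1 f2 (c + x + \<i> * y) (c + cnj x + \<i> * cnj y)"
      using f mem[OF x y] by blast
    have "((\<lambda>x. (c + x + \<i> * y, c + cnj x + \<i> * cnj y)) has_derivative (\<lambda>h. (h, cnj h))) (at x)"
      by (auto intro!: derivative_eq_intros)
    from has_derivative_compose[OF this s[unfolded sesqui_def]]
    have "((\<lambda>x. G x y) has_field_derivative f1 + f2) (at x)"
      unfolding G_def has_field_derivative_def fst_conv snd_conv
      by (elim has_derivative_eq_rhs) (simp add: fun_eq_iff algebra_simps)
    then show "\<exists>f'. ((\<lambda>x. G x y) has_field_derivative f') (at x)" ..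
  qed
  have Gy: "(\<lambda>y. G x y) holomorphic_on ball 0 (r / 2)" if x: "cmod x < r / 2" for x
    unfolding holomorphic_on_open[OF open_ball]
  proof
    fix y :: complex assume "y \<in> ball 0 (r / 2)"
    then have y: "cmod y < r / 2" by simp
    then obtain f1 f2 where s: "sesqui f f1 f2 (c + x + \<i> * y) (c + cnj x + \<i> * cnj y)"
      using f mem[OF x y] by blast
    have "((\<lambda>y. (c + x + \<i> * y, c + cnj x + \<i> * cnj y)) has_derivative (\<lambda>h. (\<i> * h, \<i> * cnj h))) (at y)"
      by (auto intro!: derivative_eq_intros)
    from has_derivative_compose[OF this s[unfolded sesqui_def]]
    have "((\<lambda>y. G x y) has_field_derivative \<i> * f1 - \<i> * f2) (at y)"
      unfolding G_def has_field_derivative_def fst_conv snd_conv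
      by (elim has_derivative_eq_rhs) (simp add: fun_eq_iff algebra_simps)
    then show "\<exists>f'. ((\<lambda>y. G x y) has_field_derivative f') (at y)" ..
  qed
  have G_real: "G (complex_of_real s) (complex_of_real t) = 0" if "\<bar>s\<bar> < r / 2" "\<bar>t\<bar> < r / 2" for s t
    using mem[of "complex_of_real s" "complex_of_real t"] that by (simp add: G_def diag)
  have G_real': "G x (complex_of_real t) = 0" if "cmod x < r / 2" "\<bar>t\<bar> < r / 2" for x t
    by (rule holomorphic_zero_on_reals[OF Gx]) (use that G_real in auto)
  have G_zero: "G x y = 0" if "cmod x < r / 2" "cmod y < r / 2" for x y
    by (rule holomorphic_zero_on_reals[OF Gy]) (use that G_real' in auto)
  have "G ((z - c) / 2) ((z - c) / (2 * \<i>)) = 0"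
    using z by (intro G_zero) (auto simp: norm_divide norm_mult dist_norm norm_minus_commute)
  moreover have "c + (z - c) / 2 + \<i> * ((z - c) / (2 * \<i>)) = z"
    by (simp add: field_simps)
  moreover have "c + cnj ((z - c) / 2) + \<i> * cnj ((z - c) / (2 * \<i>)) = c"
    by (simp add: field_simps)
  ultimately show ?thesis
    by (simp only: G_def)
qed

lemma polarization:
  assumes D: "open D" "connected D"
    and f: "\<And>z y. z \<in> D \<Longrightarrow> y \<in> D \<Longrightarrow> \<exists>f1 f2. sesqui f f1 f2 z y"
    and diag: "\<And>z. z \<in> D \<Longrightarrow> f z z = 0" and z: "z \<in> D" and y: "y \<in> D"
  shows "f z y = 0"
proof -
  obtain r where r: "r > 0" "ball y r \<subseteq> D"
    using D y open_contains_ball by blast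
  have hol: "(\<lambda>z. f z y) holomorphic_on D"
    unfolding holomorphic_on_open[OF D(1)] using f[OF _ y] sesqui_left by blast
  show ?thesis
  proof (rule analytic_continuation_open[of "ball y r" D "\<lambda>z. f z y" "\<lambda>z. 0"])
    fix x assume "x \<in> ball y r"
    then show "f x y = 0"
      using r by (intro polarization_at_center[of y r f]) (auto intro!: f diag)
  qed (use D r z hol in auto)
qed

text \<open>The quotient \<open>(K K12 - K1 K2) / K\<^sup>2\<close> is \<open>\<partial>\<^sup>2 log K / \<partial>z \<partial>(cnj y)\<close>. Polarization carries the
  equality of these quotients from the diagonal to \<open>D \<times> D\<close>. The normalization at \<open>0\<close> provides the
  constants for integrating twice, first in \<open>z\<close> and then in the conjugate variable.\<close>

lemma kernel_rigidity:
  fixes K L :: "complex \<Rightarrow> complex \<Rightarrow> complex"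
  assumes D: "open D" "convex D" "0 \<in> D"
    and K: "\<And>z y. z \<in> D \<Longrightarrow> y \<in> D \<Longrightarrow> sesqui K (K1 z y) (K2 z y) z y"
    and K1: "\<And>z y. z \<in> D \<Longrightarrow> y \<in> D \<Longrightarrow> \<exists>a b. sesqui K1 a b z y"
    and K2: "\<And>z y. z \<in> D \<Longrightarrow> y \<in> D \<Longrightarrow> \<exists>b. sesqui K2 (K12 z y) b z y"
    and K12: "\<And>z y. z \<in> D \<Longrightarrow> y \<in> D \<Longrightarrow> \<exists>a b. sesqui K12 a b z y"
    and L: "\<And>z y. z \<in> D \<Longrightarrow> y \<in> D \<Longrightarrow> sesqui L (L1 z y) (L2 z y) z y"
    and L1: "\<And>z y. z \<in> D \<Longrightarrow> y \<in> D \<Longrightarrow> \<exists>a b. sesqui L1 a b z y"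
    and L2: "\<And>z y. z \<in> D \<Longrightarrow> y \<in> D \<Longrightarrow> \<exists>b. sesqui L2 (L12 z y) b z y"
    and L12: "\<And>z y. z \<in> D \<Longrightarrow> y \<in> D \<Longrightarrow> \<exists>a b. sesqui L12 a b z y"
    and nz: "\<And>z y. z \<in> D \<Longrightarrow> y \<in> D \<Longrightarrow> K z y \<noteq> 0 \<and> L z y \<noteq> 0"
    and K_norm: "\<And>z. z \<in> D \<Longrightarrow> K z 0 = 1" "\<And>z. z \<in> D \<Longrightarrow> K 0 z = 1"
    and L_norm: "\<And>z. z \<in> D \<Longrightarrow> L z 0 = 1" "\<And>z. z \<in> D \<Longrightarrow> L 0 z = 1"
    and diag: "\<And>z. z \<in> D \<Longrightarrow> (K z z * K12 z z - K1 z z * K2 z z) / (K z z)\<^sup>2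
        = (L z z * L12 z z - L1 z z * L2 z z) / (L z z)\<^sup>2"
    and z: "z \<in> D" and y: "y \<in> D"
  shows "K z y = L z y"
proof -
  \<comment> \<open>The hypothesis on the diagonal with denominators cleared, since polarization needs a
    differentiable kernel.\<close>
  define E where "E z y = (K z y * K12 z y - K1 z y * K2 z y) * (L z y * L z y)
      - (L z y * L12 z y - L1 z y * L2 z y) * (K z y * K z y)" for z y
  have "E z y = 0" if "z \<in> D" "y \<in> D" for z y
  proof (rule polarization[OF D(1) convex_connected[OF D(2)] _ _ that])
    fix z y assume *: "z \<in> D" "y \<in> D"
    obtain a1 b1 a2 b2 a3 b3 a4 b4 b5 b6 where s: "sesqui K1 a1 b1 z y" "sesqui K12 a2 b2 z y"
        "sesqui L1 a3 b3 z y" "sesqui L12 a4 b4 z y"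
        "sesqui K2 (K12 z y) b5 z y" "sesqui L2 (L12 z y) b6 z y"
      using K1[OF *] K12[OF *] L1[OF *] L12[OF *] K2[OF *] L2[OF *] by blast
    show "\<exists>f1 f2. sesqui E f1 f2 z y"
      unfolding E_def[abs_def]
      by (rule exI, rule exI,
          rule sesqui_diff[OF
            sesqui_mult[OF sesqui_diff[OF sesqui_mult[OF K[OF *] s(2)] sesqui_mult[OF s(1,5)]]
              sesqui_mult[OF L[OF *] L[OF *]]]
            sesqui_mult[OF sesqui_diff[OF sesqui_mult[OF L[OF *] s(4)] sesqui_mult[OF s(3,6)]]
              sesqui_mult[OF K[OF *] K[OF *]]]])
  next
    fix z assume "z \<in> D"
    then show "E z z = 0"
      using diag[of z] nz[of z z] by (simp add: E_def frac_eq_eq power2_eq_square)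
  qed
  then have E: "(K z y * K12 z y - K1 z y * K2 z y) / (K z y)\<^sup>2
      = (L z y * L12 z y - L1 z y * L2 z y) / (L z y)\<^sup>2" if "z \<in> D" "y \<in> D" for z y
    using that nz[OF that] by (simp add: E_def frac_eq_eq power2_eq_square)
  have zero: "K2 0 y = 0" "L2 0 y = 0" if "y \<in> D" for y
  proof -
    have const: "f2 = 0" if "sesqui f f1 f2 0 y" "\<And>y. y \<in> D \<Longrightarrow> f 0 y = 1" for f f1 f2
    proof -
      have "((\<lambda>y. cnj (f 0 y)) has_field_derivative 0) (at y)"
        by (rule has_field_derivative_transform_within_open[OF DERIV_const D(1) \<open>y \<in> D\<close>, of 1])
          (simp add: that)
      then show ?thesis
        using DERIV_unique[OF sesqui_right[OF that(1)]] by (metis complex_cnj_zero_iff)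
    qed
    show "K2 0 y = 0" "L2 0 y = 0"
      using const[OF K[OF D(3) that]] const[OF L[OF D(3) that]] K_norm L_norm by blast+
  qed
  have log_deriv: "K2 z y / K z y = L2 z y / L z y" if z: "z \<in> D" and y: "y \<in> D" for z y
  proof -
    have "\<exists>c. \<forall>z\<in>D. K2 z y / K z y - L2 z y / L z y = c"
    proof (rule has_field_derivative_zero_constant[OF D(2)])
      fix z assume z: "z \<in> D"
      obtain b5 b6 where s: "sesqui K2 (K12 z y) b5 z y" "sesqui L2 (L12 z y) b6 z y"
        using K2[OF z y] L2[OF z y] by blast
      have "((\<lambda>z. K2 z y / K z y - L2 z y / L z y) has_field_derivative
          (K12 z y * K z y - K2 z y * K1 z y) / (K z y * K z y) - (L12 z y * L z y - L2 z y * L1 z y) / (L z y * L z y)) (at z)"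
        using nz[OF z y]
        by (intro DERIV_diff DERIV_divide sesqui_left[OF s(1)] sesqui_left[OF s(2)]
            sesqui_left[OF K[OF z y]] sesqui_left[OF L[OF z y]]) auto
      then have "((\<lambda>z. K2 z y / K z y - L2 z y / L z y) has_field_derivative 0) (at z)"
        using E[OF z y] by (simp add: power2_eq_square mult.commute)
      then show "((\<lambda>z. K2 z y / K z y - L2 z y / L z y) has_field_derivative 0) (at z within D)"
        by (rule has_field_derivative_at_within)
    qed
    then have "K2 z y / K z y - L2 z y / L z y = K2 0 y / K 0 y - L2 0 y / L 0 y"
      using z D(3) by metis
    then show ?thesis
      using zero[OF y] by simp
  qed
  have "\<exists>c. \<forall>y\<in>D. cnj (K z y) / cnj (L z y) = c"
  proof (rule has_field_derivative_zero_constant[OF D(2)])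
    fix y assume y: "y \<in> D"
    have "((\<lambda>y. cnj (K z y) / cnj (L z y)) has_field_derivative
        (cnj (K2 z y) * cnj (L z y) - cnj (K z y) * cnj (L2 z y)) / (cnj (L z y) * cnj (L z y))) (at y)"
      using nz[OF z y]
      by (intro DERIV_divide sesqui_right[OF K[OF z y]] sesqui_right[OF L[OF z y]]) auto
    moreover have "K2 z y * L z y - K z y * L2 z y = 0"
      using log_deriv[OF z y] nz[OF z y] by (simp add: field_simps)
    then have "cnj (K2 z y) * cnj (L z y) - cnj (K z y) * cnj (L2 z y) = 0"
      by (metis complex_cnj_diff complex_cnj_mult complex_cnj_zero)
    ultimately show "((\<lambda>y. cnj (K z y) / cnj (L z y)) has_field_derivative 0) (at y within D)"
      by (simp add: has_field_derivative_at_within)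
  qed
  then have "cnj (K z y) / cnj (L z y) = cnj (K z 0) / cnj (L z 0)"
    using y D(3) by metis
  then have "cnj (K z y) = cnj (L z y)"
    using nz[OF z y] K_norm L_norm z by simp
  then show ?thesis
    by simp
qed

section \<open>Mixed partial derivatives of logarithms of norms\<close>

text \<open>The numbers \<open>a\<close> and \<open>b\<close> are the Wirtinger derivatives \<open>\<partial>f/\<partial>z\<close> and \<open>\<partial>f/\<partial>(cnj z)\<close> of a real
  differentiable function.\<close>

definition has_wirtinger :: "(complex \<Rightarrow> complex) \<Rightarrow> complex \<Rightarrow> complex \<Rightarrow> complex \<Rightarrow> bool"
  where "has_wirtinger f a b z \<longleftrightarrow> (f has_derivative (\<lambda>h. h * a + cnj h * b)) (at z)"

lemma partial_w_wbar_eq: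
  assumes "has_wirtinger (\<lambda>z. f (w + axis i z)) a b 0"
  shows "partial_w i f w = a" and "partial_wbar i f w = b"
proof -
  have f: "((\<lambda>z. f (w + axis i z)) has_derivative (\<lambda>h. h * a + cnj h * b)) (at 0)"
    using assms by (simp add: has_wirtinger_def)
  have "((\<lambda>t. complex_of_real t) has_derivative complex_of_real) (at 0)"
    by (auto intro!: derivative_eq_intros)
  moreover have "((\<lambda>z. f (w + axis i z)) has_derivative (\<lambda>h. h * a + cnj h * b)) (at (of_real 0))"
    using f by simp
  ultimately have "((\<lambda>t. f (w + axis i (of_real t))) has_derivative
      (\<lambda>h. of_real h * a + cnj (of_real h) * b)) (at 0)"
    by (rule has_derivative_compose)
  then have "((\<lambda>t. f (w + axis i (of_real t))) has_vector_derivative (a + b)) (at 0)"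
    by (simp add: has_vector_derivative_def scaleR_conv_of_real algebra_simps)
  then have 1: "vector_derivative (\<lambda>t::real. f (w + axis i (of_real t))) (at 0) = a + b"
    by (rule vector_derivative_at)
  have "((\<lambda>t. \<i> * complex_of_real t) has_derivative (\<lambda>t. \<i> * complex_of_real t)) (at 0)"
    by (auto intro!: derivative_eq_intros)
  moreover have "((\<lambda>z. f (w + axis i z)) has_derivative (\<lambda>h. h * a + cnj h * b)) (at (\<i> * of_real 0))"
    using f by simp
  ultimately have "((\<lambda>t. f (w + axis i (\<i> * of_real t))) has_derivative
      (\<lambda>h. \<i> * of_real h * a + cnj (\<i> * of_real h) * b)) (at 0)"
    by (rule has_derivative_compose)
  then have "((\<lambda>t. f (w + axis i (\<i> * of_real t))) has_vector_derivative (\<i> * a - \<i> * b)) (at 0)"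
    by (simp add: has_vector_derivative_def scaleR_conv_of_real algebra_simps)
  then have 2: "vector_derivative (\<lambda>t::real. f (w + axis i (\<i> * of_real t))) (at 0) = \<i> * a - \<i> * b"
    by (rule vector_derivative_at)
  show "partial_w i f w = a" "partial_wbar i f w = b"
    unfolding partial_w_def partial_wbar_def 1 2 by (simp_all add: algebra_simps)
qed

lemma has_wirtinger_add:
  "has_wirtinger f a b z \<Longrightarrow> has_wirtinger g a' b' z \<Longrightarrow>
    has_wirtinger (\<lambda>z. f z + g z) (a + a') (b + b') z"
  unfolding has_wirtinger_def by (drule (1) has_derivative_add) (simp add: algebra_simps)

lemma axis_zero: "axis i (0::complex) = 0"
  by (simp add: vec_eq_iff axis_def)

lemma tendsto_axis: "((\<lambda>z. w + axis i z) \<longlongrightarrow> w) (nhds (0::complex))"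
proof -
  have "isCont (\<lambda>z. w + z *s axis i (1::complex)) 0"
    using has_derivative_continuous[OF has_derivative_line] by blast
  then show ?thesis
    using tendsto_at_iff_tendsto_nhds[of "\<lambda>z. w + axis i z" "0::complex"]
    by (simp add: isCont_def axis_zero axis_eq_smult[symmetric])
qed

lemma has_wirtinger_cong:
  assumes "has_wirtinger (\<lambda>z. f (w + axis i z)) a b 0" and "open U" "w \<in> U"
    and eq: "\<And>z. z \<in> U \<Longrightarrow> f z = g z"
  shows "has_wirtinger (\<lambda>z. g (w + axis i z)) a b 0"
proof -
  have ev: "\<forall>\<^sub>F z in nhds (0::complex). w + axis i z \<in> U"
    using tendsto_axis assms(2,3) by (rule topological_tendstoD)
  show ?thesis
    using assms(1) unfolding has_wirtinger_def
    by (rule has_derivative_transform_eventually)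
      (use ev eq assms(3) in \<open>auto simp: axis_zero eventually_at_filter elim!: eventually_mono\<close>)
qed

text \<open>The function \<open>p\<close> is \<open>\<partial>u/\<partial>(cnj w\<^sub>j)\<close> near \<open>w\<close>. A relation is used because \<open>mixed_partial\<close> is
  built from derivatives that have arbitrary values where they do not exist; additivity needs the
  existence as well as the value.\<close>

definition has_mixed_partial ::
    "(complex^'m::finite \<Rightarrow> real) \<Rightarrow> 'm \<Rightarrow> 'm \<Rightarrow> complex^'m \<Rightarrow> complex \<Rightarrow> bool"
  where "has_mixed_partial u i j w c \<longleftrightarrow> (\<exists>U p b. open U \<and> w \<in> U \<and>
    (\<forall>z\<in>U. \<exists>a. has_wirtinger (\<lambda>t. complex_of_real (u (z + axis j t))) a (p z) 0) \<and>
    has_wirtinger (\<lambda>t. p (w + axis i t)) c b 0)"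

lemma has_mixed_partialE:
  assumes "has_mixed_partial u i j w c"
  obtains U p b where "open U" "w \<in> U"
    and "\<And>z. z \<in> U \<Longrightarrow> \<exists>a. has_wirtinger (\<lambda>t. complex_of_real (u (z + axis j t))) a (p z) 0"
    and "has_wirtinger (\<lambda>t. p (w + axis i t)) c b 0"
  using assms unfolding has_mixed_partial_def by blast

lemma mixed_partial_eq:
  assumes "has_mixed_partial u i j w c"
  shows "mixed_partial i j u w = c"
proof -
  obtain U p b where U: "open U" "w \<in> U"
    and p: "\<And>z. z \<in> U \<Longrightarrow> \<exists>a. has_wirtinger (\<lambda>t. complex_of_real (u (z + axis j t))) a (p z) 0"
    and c: "has_wirtinger (\<lambda>t. p (w + axis i t)) c b 0"
    using assms by (rule has_mixed_partialE) (rule that)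
  have "p z = partial_wbar j (\<lambda>z. complex_of_real (u z)) z" if "z \<in> U" for z
  proof -
    obtain a where "has_wirtinger (\<lambda>t. complex_of_real (u (z + axis j t))) a (p z) 0"
      using p[OF \<open>z \<in> U\<close>] by blast
    then show ?thesis
      by (rule partial_w_wbar_eq(2)[where f = "\<lambda>z. complex_of_real (u z)", symmetric])
  qed
  then have "has_wirtinger (\<lambda>t. partial_wbar j (\<lambda>z. complex_of_real (u z)) (w + axis i t)) c b 0"
    by (rule has_wirtinger_cong[of p, OF c U])
  then show ?thesis
    unfolding mixed_partial_def
    by (rule partial_w_wbar_eq(1)[where f = "partial_wbar j (\<lambda>z. complex_of_real (u z))"])
qed

lemma has_mixed_partial_add:
  assumes "has_mixed_partial u i j w c" "has_mixed_partial v i j w d"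
  shows "has_mixed_partial (\<lambda>z. u z + v z) i j w (c + d)"
proof -
  obtain U p b where U: "open U" "w \<in> U"
    and p: "\<And>z. z \<in> U \<Longrightarrow> \<exists>a. has_wirtinger (\<lambda>t. complex_of_real (u (z + axis j t))) a (p z) 0"
    and c: "has_wirtinger (\<lambda>t. p (w + axis i t)) c b 0"
    using assms(1) by (rule has_mixed_partialE) (rule that)
  obtain V q b' where V: "open V" "w \<in> V"
    and q: "\<And>z. z \<in> V \<Longrightarrow> \<exists>a. has_wirtinger (\<lambda>t. complex_of_real (v (z + axis j t))) a (q z) 0"
    and d: "has_wirtinger (\<lambda>t. q (w + axis i t)) d b' 0"
    using assms(2) by (rule has_mixed_partialE) (rule that)
  have "\<exists>a. has_wirtinger (\<lambda>t. complex_of_real (u (z + axis j t) + v (z + axis j t))) a (p z + q z) 0"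
    if "z \<in> U \<inter> V" for z
    using that p[of z] q[of z] has_wirtinger_add by (fastforce simp: of_real_add)
  then show ?thesis
    unfolding has_mixed_partial_def using U V has_wirtinger_add[OF c d]
    by (intro exI[of _ "U \<inter> V"] exI[of _ "\<lambda>z. p z + q z"] exI[of _ "b + b'"]) auto
qed

lemma has_mixed_partial_cong:
  assumes "has_mixed_partial u i j w c" and V: "open V" "w \<in> V"
    and eq: "\<And>z. z \<in> V \<Longrightarrow> u z = v z"
  shows "has_mixed_partial v i j w c"
proof -
  obtain U p b where U: "open U" "w \<in> U"
    and p: "\<And>z. z \<in> U \<Longrightarrow> \<exists>a. has_wirtinger (\<lambda>t. complex_of_real (u (z + axis j t))) a (p z) 0"
    and c: "has_wirtinger (\<lambda>t. p (w + axis i t)) c b 0"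
    using assms(1) by (rule has_mixed_partialE) (rule that)
  have "\<exists>a. has_wirtinger (\<lambda>t. complex_of_real (v (z + axis j t))) a (p z) 0" if "z \<in> U \<inter> V" for z
    using that p[of z] has_wirtinger_cong[of "\<lambda>z. complex_of_real (u z)" z j _ "p z" V "\<lambda>z. complex_of_real (v z)"] V eq
    by auto
  then show ?thesis
    unfolding has_mixed_partial_def using U V c
    by (intro exI[of _ "U \<inter> V"] exI[of _ p] exI[of _ b]) auto
qed

text \<open>The inner product of the Hilbert sum of copies of \<open>'a\<close> indexed by \<open>I\<close>. Working with families of
  vectors avoids a type for that sum, whose number of summands is a variable.\<close>

definition gram :: "'k set \<Rightarrow> ('k \<Rightarrow> 'a::complex_hilbert_space) \<Rightarrow> ('k \<Rightarrow> 'a) \<Rightarrow> complex"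
  where "gram I x y = (\<Sum>k\<in>I. cinner (x k) (y k))"

lemma gram_self: "gram I x x = complex_of_real (\<Sum>k\<in>I. (norm (x k))\<^sup>2)"
  by (simp add: gram_def cinner_self)

lemma gram_commute: "gram I x y = cnj (gram I y x)"
  unfolding gram_def cnj_sum by (intro sum.cong refl cinner_commute)

lemma gram_expand_left: "gram I (\<lambda>k. \<Sum>i\<in>A. c i *\<^sub>C x i k) y = (\<Sum>i\<in>A. c i * gram I (x i) y)"
  unfolding gram_def cinner_sum_left cinner_scaleC_left sum_distrib_left by (rule sum.swap)

lemma gram_Cauchy_Schwarz:
  "(cmod (gram I x y))\<^sup>2 \<le> (\<Sum>k\<in>I. (norm (x k))\<^sup>2) * (\<Sum>k\<in>I. (norm (y k))\<^sup>2)"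
proof -
  have "cmod (gram I x y) \<le> (\<Sum>k\<in>I. norm (x k) * norm (y k))"
    unfolding gram_def by (intro order_trans[OF norm_sum] sum_mono cinner_Cauchy_Schwarz)
  then have "(cmod (gram I x y))\<^sup>2 \<le> (\<Sum>k\<in>I. norm (x k) * norm (y k))\<^sup>2"
    by (intro power_mono) auto
  also have "\<dots> \<le> (\<Sum>k\<in>I. (norm (x k))\<^sup>2) * (\<Sum>k\<in>I. (norm (y k))\<^sup>2)"
    by (rule Cauchy_Schwarz_ineq_sum)
  finally show ?thesis .
qed

text \<open>The value at \<open>(u, v)\<close> of the complex Hessian (Levi form) of \<open>log \<Sum>\<^sub>k \<parallel>F\<^sub>k\<parallel>\<^sup>2\<close> at \<open>w\<close>, for
  holomorphic \<open>F\<^sub>k\<close> that do not all vanish there, written through their first derivatives.\<close>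

definition levi ::
    "'k set \<Rightarrow> ('k \<Rightarrow> complex^'m::finite \<Rightarrow> 'a::complex_hilbert_space) \<Rightarrow>
      complex^'m \<Rightarrow> complex^'m \<Rightarrow> complex^'m \<Rightarrow> complex"
  where "levi I F u v w =
    (gram I (\<lambda>k. F k w) (\<lambda>k. F k w) * gram I (\<lambda>k. dirder (F k) u w) (\<lambda>k. dirder (F k) v w)
      - gram I (\<lambda>k. dirder (F k) u w) (\<lambda>k. F k w) * gram I (\<lambda>k. F k w) (\<lambda>k. dirder (F k) v w))
    / (gram I (\<lambda>k. F k w) (\<lambda>k. F k w))\<^sup>2"

lemma levi_expand:
  assumes "\<And>k. k \<in> I \<Longrightarrow> holomorphic_Cm (F k) U" "w \<in> U"
  shows "levi I F u v w =
    (\<Sum>i\<in>UNIV. \<Sum>j\<in>UNIV. u $ i * cnj (v $ j) * levi I F (axis i 1) (axis j 1) w)"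
proof -
  have left: "gram I (\<lambda>k. dirder (F k) u w) y = (\<Sum>i\<in>UNIV. u $ i * gram I (\<lambda>k. dirder (F k) (axis i 1) w) y)" for u y
  proof -
    have "gram I (\<lambda>k. dirder (F k) u w) y = gram I (\<lambda>k. \<Sum>i\<in>UNIV. (u $ i) *\<^sub>C dirder (F k) (axis i 1) w) y"
      unfolding gram_def by (intro sum.cong refl) (simp add: dirder_expand[OF assms(1) assms(2), of _ u])
    then show ?thesis
      by (simp add: gram_expand_left)
  qed
  have right: "gram I y (\<lambda>k. dirder (F k) v w) = (\<Sum>i\<in>UNIV. cnj (v $ i) * gram I y (\<lambda>k. dirder (F k) (axis i 1) w))" for v y
    unfolding gram_commute[of I y "\<lambda>k. dirder (F k) v w"] left[of v] cnj_sum complex_cnj_mult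
    by (intro sum.cong refl arg_cong2[of _ _ _ _ "(*)"] gram_commute[symmetric])
  define N where "N = gram I (\<lambda>k. F k w) (\<lambda>k. F k w)"
  define P where "P i j = gram I (\<lambda>k. dirder (F k) (axis i 1) w) (\<lambda>k. dirder (F k) (axis j 1) w)" for i j
  define A where "A i = gram I (\<lambda>k. dirder (F k) (axis i 1) w) (\<lambda>k. F k w)" for i
  define B where "B j = gram I (\<lambda>k. F k w) (\<lambda>k. dirder (F k) (axis j 1) w)" for j
  have P: "gram I (\<lambda>k. dirder (F k) u w) (\<lambda>k. dirder (F k) v w)
      = (\<Sum>i\<in>UNIV. \<Sum>j\<in>UNIV. u $ i * (cnj (v $ j) * P i j))"
    unfolding left[of u] right[of _ v] P_def by (simp add: sum_distrib_left)
  have A: "gram I (\<lambda>k. dirder (F k) u w) (\<lambda>k. F k w) = (\<Sum>i\<in>UNIV. u $ i * A i)"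
    unfolding left[of u] A_def ..
  have B: "gram I (\<lambda>k. F k w) (\<lambda>k. dirder (F k) v w) = (\<Sum>j\<in>UNIV. cnj (v $ j) * B j)"
    unfolding right[of _ v] B_def ..
  have "levi I F u v w = (\<Sum>i\<in>UNIV. \<Sum>j\<in>UNIV.
      (N * (u $ i * (cnj (v $ j) * P i j)) - u $ i * A i * (cnj (v $ j) * B j)) / N\<^sup>2)"
    unfolding levi_def P A B N_def[symmetric] sum_product
    by (simp only: sum_distrib_left sum_subtractf sum_divide_distrib diff_divide_distrib)
  also have "\<dots> = (\<Sum>i\<in>UNIV. \<Sum>j\<in>UNIV. u $ i * cnj (v $ j) * ((N * P i j - A i * B j) / N\<^sup>2))"
    by (intro sum.cong refl) (simp add: algebra_simps)
  finally show ?thesis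
    by (simp only: levi_def N_def P_def A_def B_def)
qed

lemma has_wirtinger_gram:
  fixes F G :: "'k \<Rightarrow> complex \<Rightarrow> 'a::complex_hilbert_space"
  assumes "\<And>k. k \<in> I \<Longrightarrow> has_cderiv (F k) (F' k) z" "\<And>k. k \<in> I \<Longrightarrow> has_cderiv (G k) (G' k) z"
  shows "has_wirtinger (\<lambda>z. gram I (\<lambda>k. F k z) (\<lambda>k. G k z))
    (gram I F' (\<lambda>k. G k z)) (gram I (\<lambda>k. F k z) G') z"
proof -
  have "sesqui (\<lambda>z y. gram I (\<lambda>k. F k z) (\<lambda>k. G k y)) (gram I F' (\<lambda>k. G k z)) (gram I (\<lambda>k. F k z) G') z z"
    unfolding gram_def by (intro sesqui_sum sesqui_cinner assms)
  moreover have "((\<lambda>z. (z, z)) has_derivative (\<lambda>h. (h, h))) (at z)"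
    by (auto intro!: derivative_eq_intros)
  ultimately show ?thesis
    using has_derivative_compose unfolding sesqui_def has_wirtinger_def by fastforce
qed

lemma has_wirtinger_divide:
  assumes "has_wirtinger f a b z" "has_wirtinger g a' b' z" "g z \<noteq> 0"
  shows "has_wirtinger (\<lambda>z. f z / g z) ((a * g z - f z * a') / (g z)\<^sup>2) ((b * g z - f z * b') / (g z)\<^sup>2) z"
  using has_derivative_divide'[OF assms[unfolded has_wirtinger_def]] assms(3)
  unfolding has_wirtinger_def
  by (elim has_derivative_eq_rhs) (auto simp: fun_eq_iff field_simps power2_eq_square)

text \<open>Writing \<open>N = \<Sum>\<^sub>k \<langle>F\<^sub>k, F\<^sub>k\<rangle>\<close>, holomorphy gives \<open>\<partial> log N / \<partial>(cnj w\<^sub>j) = (\<Sum>\<^sub>k \<langle>F\<^sub>k, \<partial>\<^sub>j F\<^sub>k\<rangle>) / N\<close>.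
  The derivatives \<open>\<partial>\<^sub>j F\<^sub>k\<close> are holomorphic in the \<open>i\<close>-th variable, and the quotient rule yields the Levi form.
  The second derivatives of the \<open>F\<^sub>k\<close> only contribute to the conjugate derivative.\<close>

lemma has_mixed_partial_ln_norm:
  assumes hol: "\<And>k. k \<in> I \<Longrightarrow> holomorphic_Cm (F k) U" and U: "open U" "w \<in> U"
    and nz: "\<And>z. z \<in> U \<Longrightarrow> (\<Sum>k\<in>I. (norm (F k z))\<^sup>2) \<noteq> 0"
  shows "has_mixed_partial (\<lambda>z. ln (\<Sum>k\<in>I. (norm (F k z))\<^sup>2)) i j w (levi I F (axis i 1) (axis j 1) w)"
proof -
  define N where "N z = (\<Sum>k\<in>I. (norm (F k z))\<^sup>2)" for z
  define p where "p z = gram I (\<lambda>k. F k z) (\<lambda>k. dirder (F k) (axis j 1) z) / gram I (\<lambda>k. F k z) (\<lambda>k. F k z)" for z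
  have N: "gram I (\<lambda>k. F k z) (\<lambda>k. F k z) = complex_of_real (N z)" for z
    by (simp add: gram_self N_def)
  have line: "has_cderiv (\<lambda>t. F k (z + axis l t)) (dirder (F k) (axis l 1) z) 0"
    if "k \<in> I" "z \<in> U" for k z l
    using has_cderiv_line[OF hol[OF that(1)], of z 0 "axis l 1"] that(2)
    by (simp add: axis_eq_smult[symmetric] axis_zero)
  have NW: "has_wirtinger (\<lambda>t. complex_of_real (N (z + axis l t)))
      (gram I (\<lambda>k. dirder (F k) (axis l 1) z) (\<lambda>k. F k z))
      (gram I (\<lambda>k. F k z) (\<lambda>k. dirder (F k) (axis l 1) z)) 0" if "z \<in> U" for z l
    using has_wirtinger_gram[of I "\<lambda>k t. F k (z + axis l t)" _ 0 "\<lambda>k t. F k (z + axis l t)", OF line line]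
      that by (simp add: N axis_zero)
  have "has_wirtinger (\<lambda>t. complex_of_real (ln (N (z + axis j t))))
      (gram I (\<lambda>k. dirder (F k) (axis j 1) z) (\<lambda>k. F k z) / N z) (p z) 0" if z: "z \<in> U" for z
  proof -
    let ?A = "gram I (\<lambda>k. dirder (F k) (axis j 1) z) (\<lambda>k. F k z)"
    let ?B = "gram I (\<lambda>k. F k z) (\<lambda>k. dirder (F k) (axis j 1) z)"
    have N0: "N z > 0"
      using nz[OF z] sum_nonneg[of I "\<lambda>k. (norm (F k z))\<^sup>2"] by (simp add: N_def less_le)
    have "((\<lambda>t. complex_of_real (N (z + axis j t))) has_derivative (\<lambda>h. h * ?A + cnj h * ?B)) (at 0)"
      using NW[OF z] by (simp add: has_wirtinger_def)
    from bounded_linear.has_derivative[OF bounded_linear_Re this]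
    have "((\<lambda>t. N (z + axis j t)) has_derivative (\<lambda>h. Re (h * ?A + cnj h * ?B))) (at 0)"
      by simp
    from has_derivative_ln[OF _ this]
    have "((\<lambda>t. ln (N (z + axis j t))) has_derivative (\<lambda>h. Re (h * ?A + cnj h * ?B) * inverse (N z))) (at 0)"
      using N0 by (simp add: axis_zero)
    from bounded_linear.has_derivative[OF bounded_linear_of_real this]
    have "((\<lambda>t. complex_of_real (ln (N (z + axis j t)))) has_derivative
        (\<lambda>h. complex_of_real (Re (h * ?A + cnj h * ?B) * inverse (N z)))) (at 0)" .
    moreover have "complex_of_real (Re (h * ?A + cnj h * ?B) * inverse (N z))
        = h * (?A / N z) + cnj h * (?B / N z)" for h
    proof -
      have "?B = cnj ?A"
        by (rule gram_commute)
      then have "complex_of_real (Re (h * ?A + cnj h * ?B)) = h * ?A + cnj h * ?B"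
        by (simp add: complex_eq_iff)
      then show ?thesis
        using N0 by (simp only: of_real_mult of_real_inverse) (simp add: field_simps)
    qed
    ultimately show ?thesis
      by (simp add: has_wirtinger_def p_def N)
  qed
  moreover have "\<exists>b. has_wirtinger (\<lambda>t. p (w + axis i t)) (levi I F (axis i 1) (axis j 1) w) b 0"
  proof -
    have "\<exists>d. has_cderiv (\<lambda>t. dirder (F k) (axis j 1) (w + axis i t)) d 0" if "k \<in> I" for k
      using dirder_has_cderiv_at_0[OF hol[OF that] U, of "axis j 1" "axis i 1"]
      by (simp add: axis_eq_smult[symmetric])
    then obtain d where d: "\<And>k. k \<in> I \<Longrightarrow> has_cderiv (\<lambda>t. dirder (F k) (axis j 1) (w + axis i t)) (d k) 0"
      by metis
    have num: "has_wirtinger (\<lambda>t. gram I (\<lambda>k. F k (w + axis i t)) (\<lambda>k. dirder (F k) (axis j 1) (w + axis i t)))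
        (gram I (\<lambda>k. dirder (F k) (axis i 1) w) (\<lambda>k. dirder (F k) (axis j 1) w))
        (gram I (\<lambda>k. F k w) d) 0"
      using has_wirtinger_gram[of I "\<lambda>k t. F k (w + axis i t)" _ 0 "\<lambda>k t. dirder (F k) (axis j 1) (w + axis i t)", OF line d]
        U(2) by (simp add: axis_zero)
    show ?thesis
      using has_wirtinger_divide[OF num NW[OF U(2), of i]] nz[OF U(2)]
      unfolding p_def N levi_def by (auto simp: axis_zero N_def[symmetric] mult_ac)
  qed
  ultimately show ?thesis
    unfolding has_mixed_partial_def N_def[symmetric] using U by blast
qed

text \<open>The logarithm of the modulus of a holomorphic function is pluriharmonic.\<close>

lemma levi_scalar: "levi {k} (F :: 'k \<Rightarrow> complex^'m::finite \<Rightarrow> complex) u v w = 0"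
  by (simp add: levi_def gram_def cinner_complex_def)

text \<open>The Cauchy-Schwarz inequality for the families of derivatives and of values.\<close>

lemma levi_nonneg: "levi I F u u w \<in> \<real>\<^sub>\<ge>\<^sub>0"
proof -
  let ?N = "\<Sum>k\<in>I. (norm (F k w))\<^sup>2" and ?D = "\<Sum>k\<in>I. (norm (dirder (F k) u w))\<^sup>2"
  let ?g = "gram I (\<lambda>k. dirder (F k) u w) (\<lambda>k. F k w)"
  have "?g * gram I (\<lambda>k. F k w) (\<lambda>k. dirder (F k) u w) = complex_of_real ((cmod ?g)\<^sup>2)"
    unfolding gram_commute[of I "\<lambda>k. F k w" "\<lambda>k. dirder (F k) u w"]
    by (simp add: complex_norm_square del: of_real_power)
  then have "levi I F u u w = complex_of_real ((?N * ?D - (cmod ?g)\<^sup>2) / ?N\<^sup>2)"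
    unfolding levi_def gram_self by simp
  moreover have "(cmod ?g)\<^sup>2 \<le> ?N * ?D"
    using gram_Cauchy_Schwarz[of I "\<lambda>k. dirder (F k) u w" "\<lambda>k. F k w"] by (simp add: mult.commute)
  ultimately show ?thesis
    by (simp del: of_real_divide)
qed

lemma pos_semidef_levi:
  fixes F :: "'k \<Rightarrow> complex^'m::finite \<Rightarrow> 'a::complex_hilbert_space"
  assumes "\<And>k. k \<in> I \<Longrightarrow> holomorphic_Cm (F k) U" "w \<in> U"
  shows "pos_semidef (\<chi> i j. levi I F (axis i 1) (axis j 1) w)"
  unfolding pos_semidef_def
proof
  fix x :: "complex^'m"
  have "(\<Sum>i\<in>UNIV. \<Sum>j\<in>UNIV. cnj (x $ i) * (\<chi> i j. levi I F (axis i 1) (axis j 1) w) $ i $ j * x $ j)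
      = levi I F (\<chi> i. cnj (x $ i)) (\<chi> i. cnj (x $ i)) w"
    by (simp add: levi_expand[OF assms, where u = "\<chi> i. cnj (x $ i)" and v = "\<chi> i. cnj (x $ i)"] mult_ac)
  then show "(\<Sum>i\<in>UNIV. \<Sum>j\<in>UNIV. cnj (x $ i) * (\<chi> i j. levi I F (axis i 1) (axis j 1) w) $ i $ j * x $ j) \<in> \<real>\<^sub>\<ge>\<^sub>0"
    using levi_nonneg by metis
qed

lemma form11_diff: "form11 (A - B) u v = form11 A u v - form11 B u v"
  by (simp add: form11_def algebra_simps sum_subtractf)

text \<open>Evaluating at \<open>(e\<^sub>p, b e\<^sub>q)\<close> for \<open>b = 1\<close> and \<open>b = \<i>\<close> separates the coefficient with index
  \<open>(p, q)\<close> from the one with index \<open>(q, p)\<close>.\<close>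

lemma form11_zero_imp:
  assumes "\<And>u v. form11 A u v = 0"
  shows "A = 0"
proof -
  have double: "(\<Sum>i\<in>UNIV. \<Sum>j\<in>UNIV. A $ i $ j * (axis p a $ i * cnj (axis q b $ j))) = A $ p $ q * (a * cnj b)"
    for p q a b
  proof -
    have inner: "(\<Sum>j\<in>UNIV. A $ i $ j * (x * cnj (axis q b $ j))) = A $ i $ q * (x * cnj b)" for i x
    proof -
      have "(\<Sum>j\<in>UNIV. A $ i $ j * (x * cnj (axis q b $ j)))
          = (\<Sum>j\<in>UNIV. if j = q then A $ i $ j * (x * cnj b) else 0)"
        by (intro sum.cong refl) (simp add: axis_def)
      then show ?thesis
        by simp
    qed
    have "(\<Sum>i\<in>UNIV. A $ i $ q * (axis p a $ i * cnj b))
        = (\<Sum>i\<in>UNIV. if i = p then A $ i $ q * (a * cnj b) else 0)"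
      by (intro sum.cong refl) (simp add: axis_def)
    then show ?thesis
      unfolding inner by simp
  qed
  have "form11 A (axis p 1) (axis q b) = A $ p $ q * cnj b - A $ q $ p * b" for p q b
    using double[of p 1 q b] double[of q b p 1]
    by (simp add: form11_def dw_wedge_dwbar_def right_diff_distrib sum_subtractf)
  then have eq: "A $ p $ q * cnj b - A $ q $ p * b = 0" for p q b
    using assms by metis
  have "A $ p $ q = 0" for p q
    using eq[of p q 1] eq[of p q \<i>] by (simp add: algebra_simps complex_eq_iff)
  then show ?thesis
    by (simp add: vec_eq_iff)
qed

section \<open>Closure properties of holomorphic maps\<close>

lemma holomorphic_Cm_subset: "holomorphic_Cm f U \<Longrightarrow> V \<subseteq> U \<Longrightarrow> holomorphic_Cm f V"
  by (auto simp: holomorphic_Cm_def)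

lemma holomorphic_Cm_tendsto: "holomorphic_Cm f U \<Longrightarrow> w \<in> U \<Longrightarrow> (f \<longlongrightarrow> f w) (nhds w)"
  using has_derivative_continuous[OF has_derivative_dirder]
  by (simp add: isCont_def tendsto_at_iff_tendsto_nhds)

lemma holomorphic_Cm_scaleC:
  assumes "holomorphic_Cm g U" "holomorphic_Cm f U"
  shows "holomorphic_Cm (\<lambda>w. g w *\<^sub>C f w) U"
  unfolding holomorphic_Cm_def
proof
  fix w assume w: "w \<in> U"
  note g = has_derivative_dirder[OF assms(1) w] and f = has_derivative_dirder[OF assms(2) w]
  show "\<exists>D. ((\<lambda>w. g w *\<^sub>C f w) has_derivative D) (at w) \<and> (\<forall>c v. D (c *s v) = c *\<^sub>C D v)"
    using has_derivative_scaleC[OF g f] dirder_smult[OF assms(1) w] dirder_smult[OF assms(2) w]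
    by (intro exI conjI) (auto simp: scaleC_add_right scaleC_scaleC scaleC_complex_def mult.commute)
qed

lemma holomorphic_Cm_mult:
  "holomorphic_Cm g U \<Longrightarrow> holomorphic_Cm f U \<Longrightarrow> holomorphic_Cm (\<lambda>w. g w * f w :: complex) U"
  using holomorphic_Cm_scaleC[of g U f] by (simp add: scaleC_complex_def)

lemma holomorphic_Cm_const: "holomorphic_Cm (\<lambda>w. c) U"
  unfolding holomorphic_Cm_def
  by (auto intro!: exI[of _ "\<lambda>v. 0"] derivative_eq_intros complex_vs.scale_zero_right[symmetric])

lemma holomorphic_Cm_add:
  assumes "holomorphic_Cm f U" "holomorphic_Cm g U"
  shows "holomorphic_Cm (\<lambda>w. f w + g w) U"
  unfolding holomorphic_Cm_def
proof
  fix w assume w: "w \<in> U"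
  note f = has_derivative_dirder[OF assms(1) w] and g = has_derivative_dirder[OF assms(2) w]
  show "\<exists>D. ((\<lambda>w. f w + g w) has_derivative D) (at w) \<and> (\<forall>c v. D (c *s v) = c *\<^sub>C D v)"
    using has_derivative_add[OF f g] dirder_smult[OF assms(1) w] dirder_smult[OF assms(2) w]
    by (intro exI conjI) (auto simp: scaleC_add_right)
qed

lemma holomorphic_Cm_sum:
  "(\<And>k. k \<in> I \<Longrightarrow> holomorphic_Cm (f k) U) \<Longrightarrow> holomorphic_Cm (\<lambda>w. \<Sum>k\<in>I. f k w) U"
  by (induction I rule: infinite_finite_induct)
    (auto intro: holomorphic_Cm_const holomorphic_Cm_add)

lemma holomorphic_Cm_cinner:
  assumes "holomorphic_Cm f U"
  shows "holomorphic_Cm (\<lambda>w. cinner (f w) e) U"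
  unfolding holomorphic_Cm_def
proof
  fix w assume w: "w \<in> U"
  note f = has_derivative_dirder[OF assms(1) w]
  show "\<exists>D. ((\<lambda>w. cinner (f w) e) has_derivative D) (at w) \<and> (\<forall>c v. D (c *s v) = c *\<^sub>C D v)"
    using bounded_linear.has_derivative[OF
        bounded_bilinear.bounded_linear_left[OF bounded_bilinear_cinner] f, of e]
      dirder_smult[OF assms(1) w]
    by (intro exI conjI) (auto simp: cinner_scaleC_left scaleC_complex_def)
qed

lemma holomorphic_Cm_inverse:
  fixes f :: "complex^'m::finite \<Rightarrow> complex"
  assumes "holomorphic_Cm f U" "\<And>w. w \<in> U \<Longrightarrow> f w \<noteq> 0"
  shows "holomorphic_Cm (\<lambda>w. inverse (f w)) U"
  unfolding holomorphic_Cm_def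
proof
  fix w assume w: "w \<in> U"
  note f = has_derivative_dirder[OF assms(1) w]
  show "\<exists>D. ((\<lambda>w. inverse (f w)) has_derivative D) (at w) \<and> (\<forall>c v. D (c *s v) = c *\<^sub>C D v)"
    using Deriv.has_derivative_inverse[OF assms(2)[OF w] f] dirder_smult[OF assms(1) w]
    by (intro exI conjI) (auto simp: scaleC_complex_def)
qed

lemma holomorphic_Cm_divide:
  fixes f g :: "complex^'m::finite \<Rightarrow> complex"
  assumes "holomorphic_Cm f U" "holomorphic_Cm g U" "\<And>w. w \<in> U \<Longrightarrow> g w \<noteq> 0"
  shows "holomorphic_Cm (\<lambda>w. f w / g w) U"
  using holomorphic_Cm_mult[OF assms(1) holomorphic_Cm_inverse[OF assms(2,3)]]
  by (simp add: divide_inverse)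

section \<open>Local sections of the eigenvector bundle\<close>

lemma mem_joint_eigenspace: "h \<in> joint_eigenspace T w \<longleftrightarrow> (\<forall>i. T i h = (w $ i) *\<^sub>C h)"
  by (auto simp: joint_eigenspace_def tuple_op_def tuple_shift_def vec_eq_iff)

lemma subspace_joint_eigenspace:
  assumes "\<And>i. bounded_clinear (T i)"
  shows "complex_vs.subspace (joint_eigenspace T w)"
proof -
  have lin: "T i 0 = 0" "T i (x + y) = T i x + T i y" "T i (c *\<^sub>C x) = c *\<^sub>C T i x" for i x y c
    using assms[of i] unfolding bounded_clinear_def bounded_linear_def
    by (auto simp: linear_0 linear_add)
  show ?thesis
    by (rule complex_vs.subspaceI)
      (auto simp: mem_joint_eigenspace lin scaleC_add_right scaleC_scaleC mult.commute)
qed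

lemma joint_eigenspace_unit_vector:
  assumes T: "T \<in> cowen_douglas 1 \<Omega>" and w: "w \<in> \<Omega>"
  obtains e where "norm e = 1" "e \<in> joint_eigenspace T w"
    "\<And>h. h \<in> joint_eigenspace T w \<Longrightarrow> h = cinner h e *\<^sub>C e"
proof -
  have sub: "complex_vs.subspace (joint_eigenspace T w)"
    by (rule subspace_joint_eigenspace) (use T in \<open>simp add: cowen_douglas_def\<close>)
  have dim: "complex_vs.dim (joint_eigenspace T w) = 1"
    using T w by (auto simp: cowen_douglas_def)
  obtain B where B: "B \<subseteq> joint_eigenspace T w" "complex_vs.independent B"
      "joint_eigenspace T w \<subseteq> complex_vs.span B" "card B = 1"
    using complex_vs.basis_exists[of "joint_eigenspace T w"] dim by metis
  then obtain b where b: "B = {b}"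
    by (auto simp: card_1_singleton_iff)
  have b0: "b \<noteq> 0"
    using B(2) complex_vs.dependent_zero[of B] b by auto
  define e where "e = complex_of_real (1 / norm b) *\<^sub>C b"
  have be: "b = complex_of_real (norm b) *\<^sub>C e"
    using b0 by (simp add: e_def scaleC_scaleC del: of_real_divide flip: of_real_mult)
  have e1: "norm e = 1"
    using b0 by (simp add: e_def norm_scaleC norm_divide)
  moreover have "e \<in> joint_eigenspace T w"
    unfolding e_def using B(1) b by (intro complex_vs.subspace_scale[OF sub]) auto
  moreover have "h = cinner h e *\<^sub>C e" if "h \<in> joint_eigenspace T w" for h
  proof -
    have "h \<in> complex_vs.span {b}"
      using that B(3) b by auto
    then obtain c where "h = c *\<^sub>C b"
      by (auto simp: complex_vs.span_singleton)
    then have "h = (c * complex_of_real (norm b)) *\<^sub>C e"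
      using be by (metis scaleC_scaleC)
    then show ?thesis
      using e1 by (simp add: cinner_scaleC_left cinner_self)
  qed
  ultimately show ?thesis
    using that by blast
qed

lemma eigenvector_multiple:
  assumes T: "T \<in> cowen_douglas 1 \<Omega>" and w: "w \<in> \<Omega>"
    and x: "x \<in> joint_eigenspace T w" "x \<noteq> 0" and y: "y \<in> joint_eigenspace T w"
  obtains c where "y = c *\<^sub>C x"
proof -
  obtain e where e: "\<And>h. h \<in> joint_eigenspace T w \<Longrightarrow> h = cinner h e *\<^sub>C e"
    using joint_eigenspace_unit_vector[OF T w] by blast
  have "cinner x e \<noteq> 0"
    using e[OF x(1)] x(2) by (metis complex_vs.scale_zero_left)
  moreover have "(cinner y e / cinner x e) *\<^sub>C (cinner x e *\<^sub>C e) = y"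
    using calculation e[OF y] by (simp add: scaleC_scaleC)
  ultimately show ?thesis
    using that e[OF x(1)] by metis
qed

lemma norm_vec_scaleC: "norm (\<chi> i. (v $ i) *\<^sub>C h) = norm v * norm h"
  for v :: "complex^'m::finite"
  by (simp add: norm_vec_def norm_scaleC L2_set_left_distrib)

lemma bounded_linear_tuple_shift:
  fixes T :: "'m::finite \<Rightarrow> 'a \<Rightarrow> 'a::complex_hilbert_space"
  assumes "\<And>i. bounded_clinear (T i)"
  shows "bounded_linear (tuple_op (tuple_shift T w))"
proof -
  have bl: "bounded_linear (\<lambda>h. tuple_shift T w i h)" for i
    unfolding tuple_shift_def using assms[of i]
    by (intro bounded_linear_sub bounded_linear_scaleC_right) (simp add: bounded_clinear_def)
  have "\<exists>K. \<forall>h. norm (tuple_shift T w i h) \<le> norm h * K" for i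
    by (rule bounded_linear.bounded[OF bl])
  then obtain K where K: "\<And>i h. norm (tuple_shift T w i h) \<le> norm h * K i"
    by metis
  show ?thesis
  proof (rule bounded_linear_intro)
    fix h k :: 'a and r :: real
    show "tuple_op (tuple_shift T w) (h + k) = tuple_op (tuple_shift T w) h + tuple_op (tuple_shift T w) k"
      using bl by (simp add: tuple_op_def vec_eq_iff linear_add[OF bounded_linear.linear])
    show "tuple_op (tuple_shift T w) (r *\<^sub>R h) = r *\<^sub>R tuple_op (tuple_shift T w) h"
      using bl by (simp add: tuple_op_def vec_eq_iff linear_scale[OF bounded_linear.linear])
    have "norm (tuple_op (tuple_shift T w) h) \<le> (\<Sum>i\<in>UNIV. norm (tuple_shift T w i h))"
      unfolding tuple_op_def norm_vec_def by (rule order_trans[OF L2_set_le_sum]) auto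
    also have "\<dots> \<le> (\<Sum>i\<in>UNIV. norm h * K i)"
      by (intro sum_mono K)
    finally show "norm (tuple_op (tuple_shift T w) h) \<le> norm h * (\<Sum>i\<in>UNIV. K i)"
      by (simp add: sum_distrib_left)
  qed
qed

lemma tuple_op_shift:
  "tuple_op (tuple_shift T z) h = tuple_op (tuple_shift T w) h - (\<chi> i. ((z - w) $ i) *\<^sub>C h)"
  by (simp add: tuple_op_def tuple_shift_def vec_eq_iff scaleC_diff_left)

text \<open>Since \<open>e\<close> is in the kernel, vectors orthogonal to \<open>e\<close> already produce the whole range,
  so the range of the restriction to its complement is closed too.\<close>

lemma lower_bound_on_complement:
  assumes T: "T \<in> cowen_douglas 1 \<Omega>" and w: "w \<in> \<Omega>"
    and e: "norm e = 1" "e \<in> joint_eigenspace T w"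
      "\<And>h. h \<in> joint_eigenspace T w \<Longrightarrow> h = cinner h e *\<^sub>C e"
  obtains c where "c > 0"
    "\<And>h. cinner h e = 0 \<Longrightarrow> c * norm h \<le> norm (tuple_op (tuple_shift T w) h)"
proof -
  let ?F = "tuple_op (tuple_shift T w)"
  have bl: "bounded_linear ?F"
    by (rule bounded_linear_tuple_shift) (use T in \<open>simp add: cowen_douglas_def\<close>)
  interpret F: bounded_linear ?F by (rule bl)
  let ?M = "{h. cinner h e = 0}"
  have "\<exists>c>0. \<forall>h\<in>?M. c * norm h \<le> norm (?F h)"
  proof (rule bounded_below_of_closed_range[OF bl])
    show "subspace ?M"
      by (auto simp: subspace_def cinner_add_left cinner_scaleR_left)
    show "closed ?M"
      using continuous_closed_vimage[of "{0}" "\<lambda>x. cinner x e"] continuous_cinner_left[of UNIV e]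
      by (auto simp: continuous_on_eq_continuous_at vimage_def)
    show "h = 0" if "h \<in> ?M" "?F h = 0" for h
      using that e(3)[of h] by (simp add: joint_eigenspace_def)
    have "range ?F \<subseteq> ?F ` ?M"
    proof
      fix y assume "y \<in> range ?F"
      then obtain h where h: "y = ?F h" by blast
      have "cinner h e *\<^sub>C e \<in> joint_eigenspace T w"
        by (rule complex_vs.subspace_scale[OF subspace_joint_eigenspace])
          (use T e in \<open>auto simp: cowen_douglas_def\<close>)
      then have "y = ?F (h - cinner h e *\<^sub>C e)"
        by (simp add: F.diff h joint_eigenspace_def)
      moreover have "h - cinner h e *\<^sub>C e \<in> ?M"
        using e(1) by (simp add: cinner_diff_left cinner_scaleC_left cinner_self)
      ultimately show "y \<in> ?F ` ?M"
        by blast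
    qed
    then have "?F ` ?M = range ?F"
      by blast
    then show "closed (?F ` ?M)"
      using T w by (simp add: cowen_douglas_def)
  qed
  then show ?thesis
    using that by blast
qed

text \<open>Near \<open>w\<^sub>0\<close> the eigenspace is the graph of a map from the eigenspace at \<open>w\<^sub>0\<close>, spanned by the unit vector
  \<open>e\<close>, to its complement: the lower bound on the complement persists, so no eigenvector is orthogonal to
  \<open>e\<close>. The section \<open>\<gamma>\<close> with \<open>\<langle>\<gamma>(w), e\<rangle> = 1\<close> is determined by an equation \<open>F(w) \<gamma>(w) = 0\<close> in which
  \<open>F\<close> is affine in \<open>w\<close>, and \<open>F(z) (\<gamma>(w) - \<gamma>(z)) = (w - z) \<gamma>(w)\<close>. This identity and the lower bound give
  the Lipschitz estimate and then the derivative.\<close>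

lemma local_section_exists:
  fixes T :: "'m::finite \<Rightarrow> 'a \<Rightarrow> 'a::complex_hilbert_space"
  assumes T: "T \<in> cowen_douglas 1 \<Omega>" and \<Omega>: "open \<Omega>" and w0: "w0 \<in> \<Omega>"
  obtains r \<gamma> where "r > 0" "ball w0 r \<subseteq> \<Omega>" "nonvanishing_section T (ball w0 r) \<gamma>"
    "\<And>w. w \<in> ball w0 r \<Longrightarrow> cinner (\<gamma> w) (\<gamma> w0) = 1"
proof -
  obtain e where e: "norm e = 1" "e \<in> joint_eigenspace T w0"
      "\<And>h. h \<in> joint_eigenspace T w0 \<Longrightarrow> h = cinner h e *\<^sub>C e"
    using joint_eigenspace_unit_vector[OF T w0] by blast
  obtain c where c: "c > 0"
      "\<And>h. cinner h e = 0 \<Longrightarrow> c * norm h \<le> norm (tuple_op (tuple_shift T w0) h)"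
    using lower_bound_on_complement[OF T w0 e] by blast
  obtain r0 where r0: "r0 > 0" "ball w0 r0 \<subseteq> \<Omega>"
    using \<Omega> w0 open_contains_ball by blast
  \<comment> \<open>Within distance \<open>c / 4\<close> the perturbation costs at most half of the lower bound, and it
    keeps the section bounded by \<open>2\<close>.\<close>
  define r where "r = min r0 (c / 4)"
  have r: "r > 0" "ball w0 r \<subseteq> \<Omega>" "r \<le> c / 4"
    using r0 c by (auto simp: r_def)
  define F where "F w = tuple_op (tuple_shift T w)" for w
  have Tb: "\<And>i. bounded_clinear (T i)"
    using T by (simp add: cowen_douglas_def)
  have blF: "bounded_linear (F w)" for w
    unfolding F_def by (rule bounded_linear_tuple_shift[OF Tb])
  have F_diff: "F w (x - y) = F w x - F w y" for w x y
    using blF by (simp add: linear_diff[OF bounded_linear.linear])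
  have F_shift: "F z h = F w h - (\<chi> i. ((z - w) $ i) *\<^sub>C h)" for z w h
    unfolding F_def by (rule tuple_op_shift)
  have F_scaleC: "F w (k *\<^sub>C h) = (\<chi> i. k *\<^sub>C (F w h $ i))" for w k h
    using Tb by (simp add: F_def tuple_op_def tuple_shift_def vec_eq_iff bounded_clinear_def
        scaleC_diff_right scaleC_scaleC mult.commute)
  have low: "c / 2 * norm h \<le> norm (F w h)" if w: "w \<in> ball w0 r" and h: "cinner h e = 0" for w h
  proof -
    have "norm (F w0 h) \<le> norm (F w h) + norm (\<chi> i. ((w - w0) $ i) *\<^sub>C h)"
      using norm_triangle_ineq[of "F w h" "\<chi> i. ((w - w0) $ i) *\<^sub>C h"] F_shift[of w h w0] by simp
    also have "norm (\<chi> i. ((w - w0) $ i) *\<^sub>C h) = norm (w - w0) * norm h"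
      by (rule norm_vec_scaleC)
    also have "\<dots> \<le> c / 4 * norm h"
      using w r(3) by (intro mult_right_mono) (auto simp: dist_norm norm_minus_commute)
    finally have "c * norm h \<le> norm (F w h) + c / 4 * norm h"
      using c(2)[OF h] by (simp add: F_def)
    moreover have "c / 4 * norm h \<ge> 0"
      using c(1) by simp
    ultimately show ?thesis
      by linarith
  qed
  have ker: "h \<in> joint_eigenspace T w \<longleftrightarrow> F w h = 0" for h w
    by (simp add: joint_eigenspace_def F_def)
  have "\<exists>g. F w g = 0 \<and> cinner g e = 1" if w: "w \<in> ball w0 r" for w
  proof -
    obtain f where f: "norm f = 1" "f \<in> joint_eigenspace T w"
      using joint_eigenspace_unit_vector[OF T, of w] w r(2) by blast
    have "cinner f e \<noteq> 0"
      using low[OF w, of f] f c(1) ker[of f w] by auto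
    then have "cinner ((1 / cinner f e) *\<^sub>C f) e = 1"
      by (simp add: cinner_scaleC_left)
    moreover have "F w ((1 / cinner f e) *\<^sub>C f) = 0"
      using f(2) by (simp add: F_scaleC ker vec_eq_iff)
    ultimately show ?thesis
      by blast
  qed
  then obtain \<gamma> where \<gamma>: "\<And>w. w \<in> ball w0 r \<Longrightarrow> F w (\<gamma> w) = 0" "\<And>w. w \<in> ball w0 r \<Longrightarrow> cinner (\<gamma> w) e = 1"
    by metis
  have F_difference: "F z (\<gamma> w - \<gamma> z) = (\<chi> i. ((w - z) $ i) *\<^sub>C \<gamma> w)"
    if "w \<in> ball w0 r" "z \<in> ball w0 r" for w z
    using F_shift[of z "\<gamma> w" w] \<gamma>(1) that by (simp add: F_diff vec_eq_iff scaleC_diff_left)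
  have lip0: "c / 2 * norm (\<gamma> w - \<gamma> z) \<le> norm (w - z) * norm (\<gamma> w)"
    if "w \<in> ball w0 r" "z \<in> ball w0 r" for w z
    using low[OF that(2), of "\<gamma> w - \<gamma> z"] \<gamma>(2) that
    unfolding F_difference[OF that] norm_vec_scaleC by (simp add: cinner_diff_left)
  have w0r: "w0 \<in> ball w0 r"
    using r by simp
  have \<gamma>0: "\<gamma> w0 = e"
    using e(3)[of "\<gamma> w0"] \<gamma>[OF w0r] ker by simp
  have bdd: "norm (\<gamma> w) \<le> 2" if w: "w \<in> ball w0 r" for w
  proof -
    have "c / 2 * norm (\<gamma> w - e) \<le> c / 4 * norm (\<gamma> w)"
      using lip0[OF w w0r] w r(3) \<gamma>0
      by (intro order_trans[OF lip0[OF w w0r, unfolded \<gamma>0]] mult_right_mono)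
        (auto simp: dist_norm norm_minus_commute)
    then have "norm (\<gamma> w - e) \<le> norm (\<gamma> w) / 2"
      using c(1) by (simp add: field_simps)
    moreover have "norm (\<gamma> w) \<le> norm (\<gamma> w - e) + norm e"
      using norm_triangle_ineq[of "\<gamma> w - e" e] by simp
    ultimately show ?thesis
      using e(1) by linarith
  qed
  have lip: "norm (\<gamma> w - \<gamma> z) \<le> 4 / c * norm (w - z)"
    if "w \<in> ball w0 r" "z \<in> ball w0 r" for w z
  proof -
    have "c / 2 * norm (\<gamma> w - \<gamma> z) \<le> norm (w - z) * 2"
      by (rule order_trans[OF lip0[OF that] mult_left_mono[OF bdd[OF that(1)]]]) simp
    then show ?thesis
      using c(1) by (simp add: field_simps)
  qed
  \<comment> \<open>The derivative in direction \<open>v\<close> solves \<open>F z d = v \<gamma>(z)\<close>; difference quotients solve this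
    equation approximately, so a solution exists because the range is closed.\<close>
  have solve: "\<exists>d. cinner d e = 0 \<and> F z d = (\<chi> i. (v $ i) *\<^sub>C \<gamma> z)" if z: "z \<in> ball w0 r" for z v
  proof -
    obtain \<delta> where \<delta>: "\<delta> > 0" "ball z \<delta> \<subseteq> ball w0 r"
      using z open_contains_ball[THEN iffD1, OF open_ball] by blast
    define a where "a = \<delta> / (norm v + 1)"
    have a: "a > 0"
      using \<delta> by (simp add: a_def add_nonneg_pos)
    define t where "t n = a * inverse (real (Suc n))" for n
    have t: "t n > 0" "t n \<le> a" for n
    proof -
      show "t n > 0"
        using a by (simp add: t_def)
      have "inverse (real (Suc n)) \<le> 1"
        by (simp add: inverse_le_1_iff)
      then show "t n \<le> a"
        using a mult_left_mono[of "inverse (real (Suc n))" 1 a] by (simp add: t_def)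
    qed
    have t0: "t \<longlonglongrightarrow> 0"
      unfolding t_def by (intro tendsto_mult_right_zero LIMSEQ_inverse_real_of_nat)
    define p where "p n = z + t n *\<^sub>R v" for n
    have p: "p n \<in> ball w0 r" for n
    proof -
      have "norm (t n *\<^sub>R v) \<le> a * norm v"
        using t[of n] by (simp add: mult_right_mono)
      also have "\<dots> < a * (norm v + 1)"
        using a by simp
      also have "\<dots> = \<delta>"
        by (simp add: a_def add_nonneg_pos[THEN less_imp_neq, THEN not_sym])
      finally show ?thesis
        using \<delta>(2) by (intro subsetD[OF \<delta>(2)]) (simp add: p_def dist_norm)
    qed
    have "F z ((1 / t n) *\<^sub>R (\<gamma> (p n) - \<gamma> z)) = (\<chi> i. (v $ i) *\<^sub>C \<gamma> (p n))" for n
    proof -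
      have "F z ((1 / t n) *\<^sub>R (\<gamma> (p n) - \<gamma> z)) = (1 / t n) *\<^sub>R F z (\<gamma> (p n) - \<gamma> z)"
        using blF by (simp add: linear_scale[OF bounded_linear.linear])
      also have "\<dots> = (\<chi> i. (v $ i) *\<^sub>C \<gamma> (p n))"
        unfolding F_difference[OF p z] using t(1)[of n]
        by (simp add: vec_eq_iff p_def scaleR_scaleC[where 'a='a] scaleC_scaleC scaleR_conv_of_real[where 'a=complex])
      finally show ?thesis .
    qed
    then have mem: "(\<chi> i. (v $ i) *\<^sub>C \<gamma> (p n)) \<in> range (F z)" for n
      by (metis rangeI)
    have "(\<lambda>n. \<gamma> (p n)) \<longlonglongrightarrow> \<gamma> z"
    proof (rule LIM_zero_cancel, rule Lim_null_comparison)
      show "\<forall>\<^sub>F n in sequentially. norm (\<gamma> (p n) - \<gamma> z) \<le> 4 / c * (t n * norm v)"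
        using lip[OF p z] t(1) by (intro always_eventually allI) (simp add: p_def less_imp_le)
      show "(\<lambda>n. 4 / c * (t n * norm v)) \<longlonglongrightarrow> 0"
        using t0 by (intro tendsto_mult_right_zero tendsto_mult_left_zero)
    qed
    then have lim: "(\<lambda>n. \<chi> i. (v $ i) *\<^sub>C \<gamma> (p n)) \<longlonglongrightarrow> (\<chi> i. (v $ i) *\<^sub>C \<gamma> z)"
      by (intro vec_tendstoI) (auto intro: bounded_bilinear.tendsto[OF bounded_bilinear_scaleC tendsto_const])
    have cl: "closed (range (F z))"
    proof -
      have "\<forall>w\<in>\<Omega>. closed (range (F w))"
        using T unfolding cowen_douglas_def F_def by blast
      then show ?thesis
        using z r(2) by blast
    qed
    have "(\<chi> i. (v $ i) *\<^sub>C \<gamma> z) \<in> range (F z)"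
      by (rule closed_sequentially[OF cl mem lim])
    then obtain h where h: "F z h = (\<chi> i. (v $ i) *\<^sub>C \<gamma> z)"
      by (metis rangeE)
    have "F z (h - cinner h e *\<^sub>C \<gamma> z) = F z h"
      using \<gamma>(1)[OF z] by (simp add: F_diff F_scaleC vec_eq_iff)
    moreover have "cinner (h - cinner h e *\<^sub>C \<gamma> z) e = 0"
      using \<gamma>(2)[OF z] by (simp add: cinner_diff_left cinner_scaleC_left)
    ultimately show ?thesis
      using h by metis
  qed
  have hol: "holomorphic_Cm \<gamma> (ball w0 r)"
    unfolding holomorphic_Cm_def
  proof
    fix z assume z: "z \<in> ball w0 r"
    obtain D where D: "\<And>v. cinner (D v) e = 0" "\<And>v. F z (D v) = (\<chi> i. (v $ i) *\<^sub>C \<gamma> z)"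
      using solve[OF z] by metis
    have uniq: "x = y" if "cinner x e = 0" "cinner y e = 0" "F z x = F z y" for x y
    proof -
      have "c / 2 * norm (x - y) \<le> 0"
        using low[OF z, of "x - y"] that by (simp add: F_diff cinner_diff_left)
      then show ?thesis
        using c(1) by (simp add: mult_le_0_iff)
    qed
    have F_add: "F z (x + y) = F z x + F z y" for x y
      using blF[of z] by (simp add: linear_add bounded_linear.linear)
    have Dadd: "D (u + v) = D u + D v" for u v
      by (rule uniq) (simp_all add: D F_add cinner_add_left vec_eq_iff scaleC_add_left)
    have DscC: "D (k *s v) = k *\<^sub>C D v" for k v
      by (rule uniq) (simp_all add: D F_scaleC cinner_scaleC_left vec_eq_iff scaleC_scaleC)
    have DscR: "D (k *\<^sub>R v) = k *\<^sub>R D v" for k v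
    proof -
      have "k *\<^sub>R v = complex_of_real k *s v"
        by (simp add: vec_eq_iff scaleR_conv_of_real[where 'a=complex])
      then show ?thesis
        by (simp add: DscC scaleR_scaleC)
    qed
    have Dbd: "norm (D v) \<le> norm v * (4 / c)" for v
    proof -
      have "c / 2 * norm (D v) \<le> norm v * norm (\<gamma> z)"
        using low[OF z D(1)] by (simp add: D norm_vec_scaleC)
      also have "\<dots> \<le> norm v * 2"
        by (intro mult_left_mono bdd[OF z]) simp
      finally show ?thesis
        using c(1) by (simp add: field_simps)
    qed
    have blD: "bounded_linear D"
      by (rule bounded_linear_intro[OF Dadd DscR Dbd])
    obtain \<delta> where \<delta>: "\<delta> > 0" "ball z \<delta> \<subseteq> ball w0 r"
      using z open_contains_ball[THEN iffD1, OF open_ball] by blast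
    have "(\<gamma> has_derivative D) (at z)"
    proof (rule has_derivative_quadratic_error[OF blD \<delta>(1), of _ _ "8 / c\<^sup>2"])
      fix w assume "dist w z < \<delta>"
      then have w: "w \<in> ball w0 r"
        by (intro subsetD[OF \<delta>(2)]) (simp add: dist_commute)
      have rem: "F z (\<gamma> w - \<gamma> z - D (w - z)) = (\<chi> i. ((w - z) $ i) *\<^sub>C (\<gamma> w - \<gamma> z))"
        unfolding F_diff[of z "\<gamma> w - \<gamma> z"] F_difference[OF w z] D by (simp add: vec_eq_iff scaleC_diff_right)
      have "c / 2 * norm (\<gamma> w - \<gamma> z - D (w - z)) \<le> norm (w - z) * norm (\<gamma> w - \<gamma> z)"
        using low[OF z, of "\<gamma> w - \<gamma> z - D (w - z)"] D(1) \<gamma>(2)[OF w] \<gamma>(2)[OF z]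
        unfolding rem norm_vec_scaleC by (simp add: cinner_diff_left)
      also have "\<dots> \<le> norm (w - z) * (4 / c * norm (w - z))"
        by (intro mult_left_mono lip[OF w z]) simp
      finally show "norm (\<gamma> w - \<gamma> z - D (w - z)) \<le> 8 / c\<^sup>2 * (norm (w - z))\<^sup>2"
        using c(1) by (simp add: field_simps power2_eq_square)
    qed
    then show "\<exists>D. (\<gamma> has_derivative D) (at z) \<and> (\<forall>c v. D (c *s v) = c *\<^sub>C D v)"
      using DscC by blast
  qed
  have "nonvanishing_section T (ball w0 r) \<gamma>"
    unfolding nonvanishing_section_def
  proof (intro conjI ballI)
    fix w assume w: "w \<in> ball w0 r"
    show "\<gamma> w \<in> joint_eigenspace T w"
      using \<gamma>(1)[OF w] ker by simp
    show "\<gamma> w \<noteq> 0"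
      using \<gamma>(2)[OF w] by auto
  qed (use hol in auto)
  then show ?thesis
    using that[OF r(1,2)] \<gamma>(2) \<gamma>0 by blast
qed

section \<open>Curvature in terms of an arbitrary section\<close>

text \<open>The section chosen in the definition of the curvature is \<open>g \<gamma>\<close> near \<open>w\<close> with a holomorphic
  function \<open>g\<close>, and \<open>log |g|\<^sup>2\<close> has no mixed derivatives.\<close>

lemma curvature_matrix_section:
  fixes T :: "'m::finite \<Rightarrow> 'a \<Rightarrow> 'a::complex_hilbert_space"
  assumes T: "T \<in> cowen_douglas 1 \<Omega>" and \<Omega>: "open \<Omega>" and w: "w \<in> \<Omega>"
    and sec: "nonvanishing_section T U \<gamma>" and wU: "w \<in> U"
  shows "curvature_matrix T w = (\<chi> i j. - levi {()} (\<lambda>_. \<gamma>) (axis i 1) (axis j 1) w)"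
proof -
  define \<gamma>' where "\<gamma>' = (SOME \<gamma>. \<exists>U. w \<in> U \<and> nonvanishing_section T U \<gamma>)"
  have "\<exists>U. w \<in> U \<and> nonvanishing_section T U \<gamma>'"
    unfolding \<gamma>'_def by (rule someI[of _ \<gamma>]) (use sec wU in blast)
  then obtain U' where U': "w \<in> U'" "nonvanishing_section T U' \<gamma>'"
    by blast
  define e where "e = \<gamma> w"
  have hol: "holomorphic_Cm \<gamma> U" "open U" and hol': "holomorphic_Cm \<gamma>' U'" "open U'"
    using sec U'(2) by (auto simp: nonvanishing_section_def)
  have e0: "e \<noteq> 0"
    using sec wU by (auto simp: e_def nonvanishing_section_def)
  have "((\<lambda>z. cinner (\<gamma> z) e) \<longlongrightarrow> cinner (\<gamma> w) e) (nhds w)"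
    by (rule holomorphic_Cm_tendsto[OF holomorphic_Cm_cinner[OF hol(1)] wU])
  then have "\<forall>\<^sub>F z in nhds w. cinner (\<gamma> z) e \<noteq> 0"
    by (rule tendsto_imp_eventually_ne) (use e0 in \<open>simp add: e_def cinner_self\<close>)
  then obtain W where W: "open W" "w \<in> W" "\<And>z. z \<in> W \<Longrightarrow> cinner (\<gamma> z) e \<noteq> 0"
    by (auto simp: eventually_nhds)
  define V where "V = U \<inter> U' \<inter> \<Omega> \<inter> W"
  have V: "open V" "w \<in> V"
    using hol(2) hol'(2) \<Omega> W w wU U' by (auto simp: V_def)
  define g where "g z = cinner (\<gamma>' z) e / cinner (\<gamma> z) e" for z
  have g: "\<gamma>' z = g z *\<^sub>C \<gamma> z" if z: "z \<in> V" for z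
  proof -
    obtain k where k: "\<gamma>' z = k *\<^sub>C \<gamma> z"
      using eigenvector_multiple[OF T, of z "\<gamma> z" "\<gamma>' z"] z sec U'(2)
      by (auto simp: V_def nonvanishing_section_def)
    then show ?thesis
      using W(3)[of z] z by (simp add: g_def cinner_scaleC_left V_def)
  qed
  have g_hol: "holomorphic_Cm g V"
    unfolding g_def[abs_def] using hol(1) hol'(1) W(3)
    by (intro holomorphic_Cm_divide holomorphic_Cm_cinner)
      (auto simp: V_def elim: holomorphic_Cm_subset)
  have nz: "\<gamma> z \<noteq> 0" "g z \<noteq> 0" if "z \<in> V" for z
  proof -
    show "\<gamma> z \<noteq> 0"
      using that sec by (auto simp: V_def nonvanishing_section_def)
    have "\<gamma>' z \<noteq> 0"
      using that U'(2) by (auto simp: V_def nonvanishing_section_def)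
    then show "g z \<noteq> 0"
      using g[OF that] by auto
  qed
  have "mixed_partial i j (\<lambda>z. ln ((norm (\<gamma>' z))\<^sup>2)) w = levi {()} (\<lambda>_. \<gamma>) (axis i 1) (axis j 1) w" for i j
  proof (rule mixed_partial_eq)
    have 1: "has_mixed_partial (\<lambda>z. ln (\<Sum>k\<in>{()}. (norm (g z))\<^sup>2)) i j w
        (levi {()} (\<lambda>_. g) (axis i 1) (axis j 1) w)"
      by (rule has_mixed_partial_ln_norm) (use g_hol V nz in auto)
    have 2: "has_mixed_partial (\<lambda>z. ln (\<Sum>k\<in>{()}. (norm (\<gamma> z))\<^sup>2)) i j w
        (levi {()} (\<lambda>_. \<gamma>) (axis i 1) (axis j 1) w)"
      by (rule has_mixed_partial_ln_norm[of _ _ V])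
        (use hol(1) V nz in \<open>auto simp: V_def elim: holomorphic_Cm_subset\<close>)
    have "has_mixed_partial (\<lambda>z. ln ((norm (g z))\<^sup>2) + ln ((norm (\<gamma> z))\<^sup>2)) i j w
        (levi {()} (\<lambda>_. \<gamma>) (axis i 1) (axis j 1) w)"
      using has_mixed_partial_add[OF 1 2] by (simp add: levi_scalar)
    then show "has_mixed_partial (\<lambda>z. ln ((norm (\<gamma>' z))\<^sup>2)) i j w
        (levi {()} (\<lambda>_. \<gamma>) (axis i 1) (axis j 1) w)"
    proof (rule has_mixed_partial_cong[OF _ V])
      fix z assume z: "z \<in> V"
      show "ln ((norm (g z))\<^sup>2) + ln ((norm (\<gamma> z))\<^sup>2) = ln ((norm (\<gamma>' z))\<^sup>2)"
        using nz[OF z] by (simp add: g[OF z] norm_scaleC power_mult_distrib ln_mult_pos)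
    qed
  qed
  then show ?thesis
    unfolding curvature_matrix_def Let_def \<gamma>'_def[symmetric] by simp
qed

section \<open>Restriction to complex lines and density\<close>

lemma open_line_preimage:
  fixes a v :: "complex^'m::finite"
  assumes "open U"
  shows "open {z. a + z *s v \<in> U}"
proof -
  have "isCont (\<lambda>z. a + z *s v) z" for z
    using has_derivative_continuous[OF has_derivative_line] .
  then show ?thesis
    using continuous_open_vimage[OF assms, of "\<lambda>z. a + z *s v"]
    by (simp add: vimage_def continuous_on_eq_continuous_at)
qed

lemma convex_line_preimage:
  fixes a v :: "complex^'m::finite"
  assumes "convex U"
  shows "convex {z. a + z *s v \<in> U}"
  unfolding convex_alt
proof (intro ballI allI impI)
  fix x y :: complex and u :: real
  assume x: "x \<in> {z. a + z *s v \<in> U}" "y \<in> {z. a + z *s v \<in> U}" and u: "0 \<le> u \<and> u \<le> 1"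
  have "a + ((1 - u) *\<^sub>R x + u *\<^sub>R y) *s v = (1 - u) *\<^sub>R (a + x *s v) + u *\<^sub>R (a + y *s v)"
    by (simp add: vec_eq_iff scaleR_conv_of_real[where 'a=complex] algebra_simps)
  also have "\<dots> \<in> U"
    using assms x u unfolding convex_alt by auto
  finally show "(1 - u) *\<^sub>R x + u *\<^sub>R y \<in> {z. a + z *s v \<in> U}"
    by simp
qed

text \<open>The identity theorem on the complex line through \<open>a\<close> and \<open>b\<close>.\<close>

lemma holomorphic_Cm_zero_on_convex:
  fixes f :: "complex^'m::finite \<Rightarrow> complex"
  assumes hol: "holomorphic_Cm f U" and U: "open U" "convex U" and a: "a \<in> U" and b: "b \<in> U"
    and e: "e > 0" and zero: "\<And>z. z \<in> ball a e \<Longrightarrow> z \<in> U \<Longrightarrow> f z = 0"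
  shows "f b = 0"
proof -
  define v where "v = b - a"
  define D where "D = {z. a + z *s v \<in> U}"
  define D0 where "D0 = {z. a + z *s v \<in> U \<inter> ball a e}"
  have D: "open D" "convex D" and D0: "open D0"
    unfolding D_def D0_def using U by (auto intro!: open_line_preimage convex_line_preimage simp del: Int_iff)
  have mem: "0 \<in> D0" "1 \<in> D"
    using a b e by (simp_all add: D_def D0_def v_def)
  have hol': "(\<lambda>z. f (a + z *s v)) holomorphic_on D"
    unfolding holomorphic_on_open[OF D(1)]
  proof
    fix z assume "z \<in> D"
    then have "has_cderiv (\<lambda>z. f (a + z *s v)) (dirder f v (a + z *s v)) z"
      by (intro has_cderiv_line[OF hol]) (simp add: D_def)
    from has_cderiv_cinner_left[OF this, of 1]
    show "\<exists>f'. ((\<lambda>z. f (a + z *s v)) has_field_derivative f') (at z)"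
      by (auto simp: cinner_complex_def)
  qed
  have "f (a + 1 *s v) = 0"
  proof (rule analytic_continuation_open[of D0 D "\<lambda>z. f (a + z *s v)" "\<lambda>_. 0"])
    show "D0 \<noteq> {}"
      using mem(1) by blast
    show "D0 \<subseteq> D"
      by (auto simp: D0_def D_def)
    show "f (a + z *s v) = 0" if "z \<in> D0" for z
      using that zero by (simp add: D0_def)
  qed (use D D0 mem hol' convex_connected in auto)
  then show ?thesis
    by (simp add: v_def)
qed

text \<open>If \<open>h\<close> is orthogonal to the eigenspaces near one point of a ball on which there is a section \<open>\<gamma>\<close>, then
  the holomorphic function \<open>\<langle>\<gamma>(z), h\<rangle>\<close> vanishes on the whole ball. Connectedness spreads the
  orthogonality over \<open>\<Omega>\<close>, and the eigenvectors over \<open>\<Omega>\<close> are total.\<close>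

lemma eigenspaces_over_open_set_dense:
  fixes T :: "'m::finite \<Rightarrow> 'a \<Rightarrow> 'a::complex_hilbert_space"
  assumes T: "T \<in> cowen_douglas 1 \<Omega>" and \<Omega>: "open \<Omega>" "connected \<Omega>"
    and B: "open B" "B \<noteq> {}" "B \<subseteq> \<Omega>"
  shows "closure (complex_vs.span (\<Union>w\<in>B. joint_eigenspace T w)) = UNIV"
  unfolding dense_span_iff
proof (intro allI impI)
  fix h assume h: "\<forall>x\<in>\<Union>w\<in>B. joint_eigenspace T w. cinner x h = 0"
  define P where "P a \<longleftrightarrow> (\<exists>e>0. \<forall>z\<in>ball a e. \<forall>x\<in>joint_eigenspace T z. cinner x h = 0)" for a
  obtain b where b: "b \<in> B"
    using B by blast
  have Pb: "P b"
  proof -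
    obtain e where "e > 0" "ball b e \<subseteq> B"
      using B(1) b open_contains_ball by blast
    then show ?thesis
      unfolding P_def using h by (intro exI[of _ e] conjI ballI) auto
  qed
  have P: "P w" if w: "w \<in> \<Omega>" for w
  proof (rule connected_induction_simple[where P = P, OF \<Omega>(2) _ w Pb])
    show "b \<in> \<Omega>"
      using b B by blast
    fix a assume a: "a \<in> \<Omega>"
    obtain r \<gamma> where r: "r > 0" "ball a r \<subseteq> \<Omega>" and sec: "nonvanishing_section T (ball a r) \<gamma>"
      by (rule local_section_exists[OF T \<Omega>(1) a]) (rule that)
    have hol: "holomorphic_Cm (\<lambda>z. cinner (\<gamma> z) h) (ball a r)"
      using sec by (intro holomorphic_Cm_cinner) (simp add: nonvanishing_section_def)
    have step: "P y" if x: "x \<in> ball a r" and y: "y \<in> ball a r" and Px: "P x" for x y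
    proof -
      obtain e where e: "e > 0" "\<And>z v. z \<in> ball x e \<Longrightarrow> v \<in> joint_eigenspace T z \<Longrightarrow> cinner v h = 0"
        using Px unfolding P_def by blast
      have zero: "cinner (\<gamma> p) h = 0" if p: "p \<in> ball a r" for p
        by (rule holomorphic_Cm_zero_on_convex[OF hol open_ball convex_ball x p e(1)])
          (use e(2) sec in \<open>auto simp: nonvanishing_section_def\<close>)
      have all: "cinner v h = 0" if p: "p \<in> ball a r" and v: "v \<in> joint_eigenspace T p" for p v
      proof -
        have p\<Omega>: "p \<in> \<Omega>"
          using p r(2) by blast
        have \<gamma>p: "\<gamma> p \<in> joint_eigenspace T p" "\<gamma> p \<noteq> 0"
          using sec p by (auto simp: nonvanishing_section_def)
        obtain c where "v = c *\<^sub>C \<gamma> p"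
          using eigenvector_multiple[OF T p\<Omega> \<gamma>p v] by blast
        then show ?thesis
          using zero[OF p] by (simp add: cinner_scaleC_left)
      qed
      obtain d where "d > 0" "ball y d \<subseteq> ball a r"
        using y open_contains_ball[THEN iffD1, OF open_ball] by blast
      then show ?thesis
        using all unfolding P_def by blast
    qed
    show "\<exists>V. openin (top_of_set \<Omega>) V \<and> a \<in> V \<and> (\<forall>x\<in>V. \<forall>y\<in>V. P x \<longrightarrow> P y)"
    proof (intro exI[of _ "ball a r"] conjI ballI impI)
      show "openin (top_of_set \<Omega>) (ball a r)"
        using r(2) by (intro open_subset) auto
      show "a \<in> ball a r"
        using r(1) by simp
    qed (rule step)
  qed
  have h0: "cinner x h = 0" if x: "x \<in> joint_eigenspace T w" and w: "w \<in> \<Omega>" for x w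
  proof -
    obtain e where "e > 0" "\<forall>z\<in>ball w e. \<forall>x\<in>joint_eigenspace T z. cinner x h = 0"
      using P[OF w] unfolding P_def by (elim exE conjE)
    then show ?thesis
      using x by auto
  qed
  have dense: "closure (complex_vs.span (\<Union>w\<in>\<Omega>. joint_eigenspace T w)) = UNIV"
    using T unfolding cowen_douglas_def mem_Collect_eq by (elim conjE)
  show "h = 0"
    by (rule dense_span_iff[THEN iffD1, OF dense, rule_format]) (use h0 in auto)
qed

section \<open>Rigidity of Gram kernels in several variables\<close>

lemma sesqui_gram:
  assumes "\<And>k. k \<in> I \<Longrightarrow> has_cderiv (a k) (a' k) z" "\<And>k. k \<in> I \<Longrightarrow> has_cderiv (b k) (b' k) y"
  shows "sesqui (\<lambda>z y. gram I (\<lambda>k. a k z) (\<lambda>k. b k y))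
    (gram I a' (\<lambda>k. b k y)) (gram I (\<lambda>k. a k z) b') z y"
  unfolding gram_def by (intro sesqui_sum sesqui_cinner assms)

lemma gram_nonzero_near:
  assumes hol: "\<And>k. k \<in> I \<Longrightarrow> holomorphic_Cm (F k) U" and U: "open U" "w \<in> U"
    and nz: "gram I (\<lambda>k. F k w) (\<lambda>k. F k w) \<noteq> 0"
  obtains r where "r > 0" "ball w r \<subseteq> U"
    "\<And>p q. p \<in> ball w r \<Longrightarrow> q \<in> ball w r \<Longrightarrow> gram I (\<lambda>k. F k p) (\<lambda>k. F k q) \<noteq> 0"
proof -
  have F: "(F k \<longlongrightarrow> F k w) (nhds w)" if "k \<in> I" for k
    using holomorphic_Cm_tendsto[OF hol[OF that] U(2)] .
  have "((\<lambda>x. gram I (\<lambda>k. F k (fst x)) (\<lambda>k. F k (snd x))) \<longlongrightarrow> gram I (\<lambda>k. F k w) (\<lambda>k. F k w))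
      (nhds w \<times>\<^sub>F nhds w)"
    unfolding gram_def
    by (intro tendsto_sum bounded_bilinear.tendsto[OF bounded_bilinear_cinner]
        filterlim_compose[OF F filterlim_fst] filterlim_compose[OF F filterlim_snd])
  then have "\<forall>\<^sub>F x in nhds w \<times>\<^sub>F nhds w. gram I (\<lambda>k. F k (fst x)) (\<lambda>k. F k (snd x)) \<noteq> 0"
    by (rule tendsto_imp_eventually_ne) (rule nz)
  then obtain Q where Q: "eventually Q (nhds w)"
      "\<And>p q. Q p \<Longrightarrow> Q q \<Longrightarrow> gram I (\<lambda>k. F k p) (\<lambda>k. F k q) \<noteq> 0"
    unfolding eventually_prod_same by auto
  obtain r1 where r1: "r1 > 0" "\<And>z. dist z w < r1 \<Longrightarrow> Q z"
    using Q(1) by (auto simp: eventually_nhds_metric)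
  obtain r2 where r2: "r2 > 0" "ball w r2 \<subseteq> U"
    using U open_contains_ball by blast
  show ?thesis
  proof (rule that[of "min r1 r2"])
    show "ball w (min r1 r2) \<subseteq> U"
      using r2(2) by (auto simp: subset_iff)
  qed (use r1 r2(1) Q(2) in \<open>auto simp: dist_commute\<close>)
qed

text \<open>On the line through \<open>w\<^sub>0\<close> and \<open>p\<close>, the one-variable result gives equality at \<open>(p, p)\<close>; the base
  point has to lie on the line because the normalization is there. The line through \<open>p\<close> and \<open>q\<close>
  then carries the equality from the diagonal to \<open>(p, q)\<close> by polarization.\<close>

lemma gram_rigidity:
  fixes F :: "'k \<Rightarrow> complex^'m::finite \<Rightarrow> 'a::complex_hilbert_space"
    and G :: "'l \<Rightarrow> complex^'m \<Rightarrow> 'b::complex_hilbert_space"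
  assumes U: "open U" "convex U" "w0 \<in> U"
    and F: "\<And>k. k \<in> I \<Longrightarrow> holomorphic_Cm (F k) U" and G: "\<And>k. k \<in> J \<Longrightarrow> holomorphic_Cm (G k) U"
    and nzF: "\<And>p q. p \<in> U \<Longrightarrow> q \<in> U \<Longrightarrow> gram I (\<lambda>k. F k p) (\<lambda>k. F k q) \<noteq> 0"
    and nzG: "\<And>p q. p \<in> U \<Longrightarrow> q \<in> U \<Longrightarrow> gram J (\<lambda>k. G k p) (\<lambda>k. G k q) \<noteq> 0"
    and normF: "\<And>p. p \<in> U \<Longrightarrow> gram I (\<lambda>k. F k p) (\<lambda>k. F k w0) = 1"
    and normG: "\<And>p. p \<in> U \<Longrightarrow> gram J (\<lambda>k. G k p) (\<lambda>k. G k w0) = 1"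
    and levi: "\<And>w i j. w \<in> U \<Longrightarrow> levi I F (axis i 1) (axis j 1) w = levi J G (axis i 1) (axis j 1) w"
    and p: "p \<in> U" and q: "q \<in> U"
  shows "gram I (\<lambda>k. F k p) (\<lambda>k. F k q) = gram J (\<lambda>k. G k p) (\<lambda>k. G k q)"
proof -
  have diag: "gram I (\<lambda>k. F k p) (\<lambda>k. F k p) = gram J (\<lambda>k. G k p) (\<lambda>k. G k p)" if p: "p \<in> U" for p
  proof -
    define v where "v = p - w0"
    define x where "x z = w0 + z *s v" for z
    define D where "D = {z. x z \<in> U}"
    have D: "open D" "convex D"
      using open_line_preimage[OF U(1)] convex_line_preimage[OF U(2)] by (simp_all add: D_def x_def)
    have x01: "x 0 = w0" "x 1 = p"
      by (simp_all add: x_def v_def)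
    have mem: "0 \<in> D" "1 \<in> D"
      using p U(3) by (simp_all add: D_def x01)
    have a: "has_cderiv (\<lambda>z. F k (x z)) (dirder (F k) v (x z)) z" if "k \<in> I" "z \<in> D" for k z
      unfolding x_def by (rule has_cderiv_line[OF F[OF that(1)]]) (use that(2) in \<open>simp add: D_def x_def\<close>)
    have b: "has_cderiv (\<lambda>z. G k (x z)) (dirder (G k) v (x z)) z" if "k \<in> J" "z \<in> D" for k z
      unfolding x_def by (rule has_cderiv_line[OF G[OF that(1)]]) (use that(2) in \<open>simp add: D_def x_def\<close>)
    have "\<exists>d. has_cderiv (\<lambda>z. dirder (F k) v (x z)) d z" if "k \<in> I" "z \<in> D" for k z
      unfolding x_def by (rule dirder_has_cderiv[OF F[OF that(1)] U(1)]) (use that(2) in \<open>simp add: D_def x_def\<close>)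
    then obtain a' where a': "\<And>k z. k \<in> I \<Longrightarrow> z \<in> D \<Longrightarrow> has_cderiv (\<lambda>z. dirder (F k) v (x z)) (a' k z) z"
      by metis
    have "\<exists>d. has_cderiv (\<lambda>z. dirder (G k) v (x z)) d z" if "k \<in> J" "z \<in> D" for k z
      unfolding x_def by (rule dirder_has_cderiv[OF G[OF that(1)] U(1)]) (use that(2) in \<open>simp add: D_def x_def\<close>)
    then obtain b' where b': "\<And>k z. k \<in> J \<Longrightarrow> z \<in> D \<Longrightarrow> has_cderiv (\<lambda>z. dirder (G k) v (x z)) (b' k z) z"
      by metis
    have "gram I (\<lambda>k. F k (x 1)) (\<lambda>k. F k (x 1)) = gram J (\<lambda>k. G k (x 1)) (\<lambda>k. G k (x 1))"
    proof (rule kernel_rigidity[where z = 1 and y = 1 and D = D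
          and K = "\<lambda>z y. gram I (\<lambda>k. F k (x z)) (\<lambda>k. F k (x y))"
          and L = "\<lambda>z y. gram J (\<lambda>k. G k (x z)) (\<lambda>k. G k (x y))"
          and ?K1.0 = "\<lambda>z y. gram I (\<lambda>k. dirder (F k) v (x z)) (\<lambda>k. F k (x y))"
          and ?L1.0 = "\<lambda>z y. gram J (\<lambda>k. dirder (G k) v (x z)) (\<lambda>k. G k (x y))"
          and ?K2.0 = "\<lambda>z y. gram I (\<lambda>k. F k (x z)) (\<lambda>k. dirder (F k) v (x y))"
          and ?L2.0 = "\<lambda>z y. gram J (\<lambda>k. G k (x z)) (\<lambda>k. dirder (G k) v (x y))"
          and ?K12.0 = "\<lambda>z y. gram I (\<lambda>k. dirder (F k) v (x z)) (\<lambda>k. dirder (F k) v (x y))"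
          and ?L12.0 = "\<lambda>z y. gram J (\<lambda>k. dirder (G k) v (x z)) (\<lambda>k. dirder (G k) v (x y))", OF D mem(1)])
      fix z y assume z: "z \<in> D" and y: "y \<in> D"
      show "sesqui (\<lambda>z y. gram I (\<lambda>k. F k (x z)) (\<lambda>k. F k (x y)))
          (gram I (\<lambda>k. dirder (F k) v (x z)) (\<lambda>k. F k (x y)))
          (gram I (\<lambda>k. F k (x z)) (\<lambda>k. dirder (F k) v (x y))) z y"
        by (rule sesqui_gram[OF a[OF _ z] a[OF _ y]])
      show "sesqui (\<lambda>z y. gram J (\<lambda>k. G k (x z)) (\<lambda>k. G k (x y)))
          (gram J (\<lambda>k. dirder (G k) v (x z)) (\<lambda>k. G k (x y)))
          (gram J (\<lambda>k. G k (x z)) (\<lambda>k. dirder (G k) v (x y))) z y"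
        by (rule sesqui_gram[OF b[OF _ z] b[OF _ y]])
      show "\<exists>c d. sesqui (\<lambda>z y. gram I (\<lambda>k. dirder (F k) v (x z)) (\<lambda>k. F k (x y))) c d z y"
        by (rule exI, rule exI, rule sesqui_gram[OF a'[OF _ z] a[OF _ y]])
      show "\<exists>c d. sesqui (\<lambda>z y. gram J (\<lambda>k. dirder (G k) v (x z)) (\<lambda>k. G k (x y))) c d z y"
        by (rule exI, rule exI, rule sesqui_gram[OF b'[OF _ z] b[OF _ y]])
      show "\<exists>d. sesqui (\<lambda>z y. gram I (\<lambda>k. F k (x z)) (\<lambda>k. dirder (F k) v (x y)))
          (gram I (\<lambda>k. dirder (F k) v (x z)) (\<lambda>k. dirder (F k) v (x y))) d z y"
        by (rule exI, rule sesqui_gram[OF a[OF _ z] a'[OF _ y]])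
      show "\<exists>d. sesqui (\<lambda>z y. gram J (\<lambda>k. G k (x z)) (\<lambda>k. dirder (G k) v (x y)))
          (gram J (\<lambda>k. dirder (G k) v (x z)) (\<lambda>k. dirder (G k) v (x y))) d z y"
        by (rule exI, rule sesqui_gram[OF b[OF _ z] b'[OF _ y]])
      show "\<exists>c d. sesqui (\<lambda>z y. gram I (\<lambda>k. dirder (F k) v (x z)) (\<lambda>k. dirder (F k) v (x y))) c d z y"
        by (rule exI, rule exI, rule sesqui_gram[OF a'[OF _ z] a'[OF _ y]])
      show "\<exists>c d. sesqui (\<lambda>z y. gram J (\<lambda>k. dirder (G k) v (x z)) (\<lambda>k. dirder (G k) v (x y))) c d z y"
        by (rule exI, rule exI, rule sesqui_gram[OF b'[OF _ z] b'[OF _ y]])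
      show "gram I (\<lambda>k. F k (x z)) (\<lambda>k. F k (x y)) \<noteq> 0 \<and> gram J (\<lambda>k. G k (x z)) (\<lambda>k. G k (x y)) \<noteq> 0"
        using nzF nzG z y by (simp add: D_def)
    next
      fix z assume "z \<in> D"
      then have z: "x z \<in> U"
        by (simp add: D_def)
      show "gram I (\<lambda>k. F k (x z)) (\<lambda>k. F k (x 0)) = 1" "gram J (\<lambda>k. G k (x z)) (\<lambda>k. G k (x 0)) = 1"
        using normF[OF z] normG[OF z] by (simp_all add: x01)
      then show "gram I (\<lambda>k. F k (x 0)) (\<lambda>k. F k (x z)) = 1" "gram J (\<lambda>k. G k (x 0)) (\<lambda>k. G k (x z)) = 1"
        using gram_commute[of I "\<lambda>k. F k (x 0)" "\<lambda>k. F k (x z)"]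
          gram_commute[of J "\<lambda>k. G k (x 0)" "\<lambda>k. G k (x z)"] by simp_all
      have "levi I F v v (x z) = levi J G v v (x z)"
        using levi_expand[where I = I and F = F, OF F z, where u = v and v = v]
          levi_expand[where I = J and F = G, OF G z, where u = v and v = v] levi[OF z]
        by simp
      then show "(gram I (\<lambda>k. F k (x z)) (\<lambda>k. F k (x z)) *
          gram I (\<lambda>k. dirder (F k) v (x z)) (\<lambda>k. dirder (F k) v (x z)) -
          gram I (\<lambda>k. dirder (F k) v (x z)) (\<lambda>k. F k (x z)) *
          gram I (\<lambda>k. F k (x z)) (\<lambda>k. dirder (F k) v (x z))) /
          (gram I (\<lambda>k. F k (x z)) (\<lambda>k. F k (x z)))\<^sup>2 =
          (gram J (\<lambda>k. G k (x z)) (\<lambda>k. G k (x z)) *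
          gram J (\<lambda>k. dirder (G k) v (x z)) (\<lambda>k. dirder (G k) v (x z)) -
          gram J (\<lambda>k. dirder (G k) v (x z)) (\<lambda>k. G k (x z)) *
          gram J (\<lambda>k. G k (x z)) (\<lambda>k. dirder (G k) v (x z))) /
          (gram J (\<lambda>k. G k (x z)) (\<lambda>k. G k (x z)))\<^sup>2"
        by (simp only: levi_def)
    qed (use mem in auto)
    then show ?thesis
      by (simp add: x01)
  qed
  define v where "v = q - p"
  define x where "x z = p + z *s v" for z
  define D where "D = {z. x z \<in> U}"
  have D: "open D" "convex D"
    using open_line_preimage[OF U(1)] convex_line_preimage[OF U(2)] by (simp_all add: D_def x_def)
  have x01: "x 0 = p" "x 1 = q"
    by (simp_all add: x_def v_def)
  have mem: "0 \<in> D" "1 \<in> D"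
    using p q by (simp_all add: D_def x01)
  have a: "has_cderiv (\<lambda>z. F k (x z)) (dirder (F k) v (x z)) z" if "k \<in> I" "z \<in> D" for k z
    unfolding x_def by (rule has_cderiv_line[OF F[OF that(1)]]) (use that(2) in \<open>simp add: D_def x_def\<close>)
  have b: "has_cderiv (\<lambda>z. G k (x z)) (dirder (G k) v (x z)) z" if "k \<in> J" "z \<in> D" for k z
    unfolding x_def by (rule has_cderiv_line[OF G[OF that(1)]]) (use that(2) in \<open>simp add: D_def x_def\<close>)
  have "gram I (\<lambda>k. F k (x 0)) (\<lambda>k. F k (x 1)) - gram J (\<lambda>k. G k (x 0)) (\<lambda>k. G k (x 1)) = 0"
  proof (rule polarization[where D = D and z = 0 and y = 1 and
        f = "\<lambda>z y. gram I (\<lambda>k. F k (x z)) (\<lambda>k. F k (x y)) - gram J (\<lambda>k. G k (x z)) (\<lambda>k. G k (x y))",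
        OF D(1) convex_connected[OF D(2)]])
    fix z y assume z: "z \<in> D" and y: "y \<in> D"
    show "\<exists>c d. sesqui (\<lambda>z y. gram I (\<lambda>k. F k (x z)) (\<lambda>k. F k (x y)) - gram J (\<lambda>k. G k (x z)) (\<lambda>k. G k (x y))) c d z y"
      by (rule exI, rule exI, rule sesqui_diff[OF sesqui_gram[OF a[OF _ z] a[OF _ y]]
            sesqui_gram[OF b[OF _ z] b[OF _ y]]])
  qed (use mem diag in \<open>auto simp: D_def\<close>)
  then show ?thesis
    by (simp add: x01)
qed

lemma gram_scaled:
  fixes f :: "'k \<Rightarrow> complex^'m \<Rightarrow> complex"
  shows "gram I (\<lambda>k. f k p *\<^sub>C s) (\<lambda>k. f k q *\<^sub>C t) = gram I (\<lambda>k. f k p) (\<lambda>k. f k q) * cinner s t"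
  by (simp add: gram_def cinner_complex_def cinner_scaleC_left cinner_scaleC_right sum_distrib_left mult_ac)

lemma norm_scaled: "(\<Sum>k\<in>I. (norm (f k *\<^sub>C x))\<^sup>2) = (\<Sum>k\<in>I. (cmod (f k))\<^sup>2) * (norm x)\<^sup>2"
  by (simp add: norm_scaleC power_mult_distrib sum_distrib_right)

lemma levi_scaled:
  fixes f :: "'k \<Rightarrow> complex^'m::finite \<Rightarrow> complex" and \<sigma> :: "complex^'m \<Rightarrow> 'a::complex_hilbert_space"
  assumes U: "open U" "w \<in> U" and f: "\<And>k. k \<in> I \<Longrightarrow> holomorphic_Cm (f k) U"
    and \<sigma>: "holomorphic_Cm \<sigma> U"
    and nz: "\<And>z. z \<in> U \<Longrightarrow> (\<Sum>k\<in>I. (cmod (f k z))\<^sup>2) \<noteq> 0" "\<And>z. z \<in> U \<Longrightarrow> \<sigma> z \<noteq> 0"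
  shows "levi I (\<lambda>k z. f k z *\<^sub>C \<sigma> z) (axis i 1) (axis j 1) w
    = levi I f (axis i 1) (axis j 1) w + levi {()} (\<lambda>_. \<sigma>) (axis i 1) (axis j 1) w"
proof -
  have 1: "has_mixed_partial (\<lambda>z. ln (\<Sum>k\<in>I. (norm (f k z))\<^sup>2)) i j w (levi I f (axis i 1) (axis j 1) w)"
    by (rule has_mixed_partial_ln_norm[OF f U]) (use nz in auto)
  have 2: "has_mixed_partial (\<lambda>z. ln (\<Sum>k\<in>{()}. (norm (\<sigma> z))\<^sup>2)) i j w
      (levi {()} (\<lambda>_. \<sigma>) (axis i 1) (axis j 1) w)"
    by (rule has_mixed_partial_ln_norm[OF \<sigma> U]) (use nz in auto)
  have 3: "has_mixed_partial (\<lambda>z. ln (\<Sum>k\<in>I. (norm (f k z *\<^sub>C \<sigma> z))\<^sup>2)) i j w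
      (levi I f (axis i 1) (axis j 1) w + levi {()} (\<lambda>_. \<sigma>) (axis i 1) (axis j 1) w)"
  proof (rule has_mixed_partial_cong[OF has_mixed_partial_add[OF 1 2] U])
    fix z assume z: "z \<in> U"
    have "(\<Sum>k\<in>I. (cmod (f k z))\<^sup>2) > 0"
      using nz(1)[OF z] sum_nonneg[of I "\<lambda>k. (cmod (f k z))\<^sup>2"] by (simp add: less_le)
    then show "ln (\<Sum>k\<in>I. (norm (f k z))\<^sup>2) + ln (\<Sum>k\<in>{()}. (norm (\<sigma> z))\<^sup>2)
        = ln (\<Sum>k\<in>I. (norm (f k z *\<^sub>C \<sigma> z))\<^sup>2)"
      using nz(2)[OF z] by (simp add: norm_scaled ln_mult_pos)
  qed
  have 4: "has_mixed_partial (\<lambda>z. ln (\<Sum>k\<in>I. (norm (f k z *\<^sub>C \<sigma> z))\<^sup>2)) i j w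
      (levi I (\<lambda>k z. f k z *\<^sub>C \<sigma> z) (axis i 1) (axis j 1) w)"
    by (rule has_mixed_partial_ln_norm[OF holomorphic_Cm_scaleC[OF f \<sigma>] U])
      (use nz in \<open>auto simp: norm_scaled\<close>)
  show ?thesis
    by (rule trans[OF mixed_partial_eq[OF 4, symmetric] mixed_partial_eq[OF 3]])
qed

text \<open>A section \<open>\<tau>\<close> of \<open>S\<close> with \<open>\<langle>\<tau>(w), \<tau>(w\<^sub>0)\<rangle> = 1\<close> is rescaled to \<open>\<sigma> = g \<tau>\<close>. With
  \<open>Q(w) = \<Sum>\<^sub>k f\<^sub>k(w) cnj (f\<^sub>k(w\<^sub>0))\<close>, the kernel of the family \<open>f\<^sub>k \<sigma>\<close> has value
  \<open>g(w) cnj (g(w\<^sub>0)) Q(w)\<close> at \<open>(w, w\<^sub>0)\<close>, and this is \<open>1\<close> for \<open>g = sqrt (Q(w\<^sub>0)) / Q\<close>.\<close>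

lemma matched_local_sections:
  fixes T :: "'m::finite \<Rightarrow> 'a \<Rightarrow> 'a::complex_hilbert_space"
    and S :: "'m \<Rightarrow> 'b \<Rightarrow> 'b::complex_hilbert_space"
    and f :: "'k \<Rightarrow> complex^'m \<Rightarrow> complex"
  assumes T: "T \<in> cowen_douglas 1 \<Omega>" and S: "S \<in> cowen_douglas 1 \<Omega>"
    and \<Omega>: "open \<Omega>" and w0: "w0 \<in> \<Omega>"
    and f: "\<And>k. k \<in> I \<Longrightarrow> holomorphic_Cm (f k) \<Omega>"
    and f_nz: "\<And>w. w \<in> \<Omega> \<Longrightarrow> (\<Sum>k\<in>I. (cmod (f k w))\<^sup>2) \<noteq> 0"
    and curv: "\<And>w i j. w \<in> \<Omega> \<Longrightarrow>
      curvature_matrix S w $ i $ j - curvature_matrix T w $ i $ j = levi I f (axis i 1) (axis j 1) w"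
  obtains r \<gamma> \<sigma> where "r > 0" "ball w0 r \<subseteq> \<Omega>"
    "nonvanishing_section T (ball w0 r) \<gamma>" "nonvanishing_section S (ball w0 r) \<sigma>"
    "\<And>p q. p \<in> ball w0 r \<Longrightarrow> q \<in> ball w0 r \<Longrightarrow>
      cinner (\<gamma> p) (\<gamma> q) = gram I (\<lambda>k. f k p *\<^sub>C \<sigma> p) (\<lambda>k. f k q *\<^sub>C \<sigma> q)"
proof -
  obtain r1 \<gamma> where r1: "r1 > 0" "ball w0 r1 \<subseteq> \<Omega>" "nonvanishing_section T (ball w0 r1) \<gamma>"
      "\<And>w. w \<in> ball w0 r1 \<Longrightarrow> cinner (\<gamma> w) (\<gamma> w0) = 1"
    by (rule local_section_exists[OF T \<Omega> w0]) (rule that)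
  obtain r2 \<tau> where r2: "r2 > 0" "ball w0 r2 \<subseteq> \<Omega>" "nonvanishing_section S (ball w0 r2) \<tau>"
      "\<And>w. w \<in> ball w0 r2 \<Longrightarrow> cinner (\<tau> w) (\<tau> w0) = 1"
    by (rule local_section_exists[OF S \<Omega> w0]) (rule that)
  have hol\<gamma>: "holomorphic_Cm \<gamma> (ball w0 r1)" and hol\<tau>: "holomorphic_Cm \<tau> (ball w0 r2)"
    using r1(3) r2(3) by (simp_all add: nonvanishing_section_def)
  have gram1: "gram {()} (\<lambda>k. x) (\<lambda>k. y) = cinner x y" for x y :: "'c::complex_hilbert_space"
    by (simp add: gram_def)
  have "w0 \<in> ball w0 r1" "gram {()} (\<lambda>_. \<gamma> w0) (\<lambda>_. \<gamma> w0) \<noteq> 0"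
    using r1(1) r1(4)[of w0] by (simp_all add: gram1)
  then obtain s1 where s1: "s1 > 0" "ball w0 s1 \<subseteq> ball w0 r1"
      "\<And>p q. p \<in> ball w0 s1 \<Longrightarrow> q \<in> ball w0 s1 \<Longrightarrow> cinner (\<gamma> p) (\<gamma> q) \<noteq> 0"
    using gram_nonzero_near[of "{()}" "\<lambda>_. \<gamma>", OF hol\<gamma> open_ball] unfolding gram1 by metis
  have "w0 \<in> ball w0 r2" "gram {()} (\<lambda>_. \<tau> w0) (\<lambda>_. \<tau> w0) \<noteq> 0"
    using r2(1) r2(4)[of w0] by (simp_all add: gram1)
  then obtain s2 where s2: "s2 > 0" "ball w0 s2 \<subseteq> ball w0 r2"
      "\<And>p q. p \<in> ball w0 s2 \<Longrightarrow> q \<in> ball w0 s2 \<Longrightarrow> cinner (\<tau> p) (\<tau> q) \<noteq> 0"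
    using gram_nonzero_near[of "{()}" "\<lambda>_. \<tau>", OF hol\<tau> open_ball] unfolding gram1 by metis
  define N where "N = (\<Sum>k\<in>I. (cmod (f k w0))\<^sup>2)"
  have N: "N > 0"
    using f_nz[OF w0] sum_nonneg[of I "\<lambda>k. (cmod (f k w0))\<^sup>2"] by (simp add: less_le N_def)
  define Q where "Q w = gram I (\<lambda>k. f k w) (\<lambda>k. f k w0)" for w
  have Qw0: "Q w0 = complex_of_real N"
    by (simp add: Q_def gram_self N_def)
  have nz0: "gram I (\<lambda>k. f k w0) (\<lambda>k. f k w0) \<noteq> 0"
    using Qw0 N by (simp add: Q_def)
  obtain s3 where s3: "s3 > 0" "ball w0 s3 \<subseteq> \<Omega>"
      "\<And>p q. p \<in> ball w0 s3 \<Longrightarrow> q \<in> ball w0 s3 \<Longrightarrow> gram I (\<lambda>k. f k p) (\<lambda>k. f k q) \<noteq> 0"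
    by (rule gram_nonzero_near[OF f \<Omega> w0 nz0]) (assumption, rule that)
  define r where "r = min s1 (min s2 s3)"
  define B where "B = ball w0 r"
  have r: "r > 0"
    using s1 s2 s3 by (simp add: r_def)
  have B: "B \<subseteq> ball w0 s1" "B \<subseteq> ball w0 s2" "B \<subseteq> ball w0 s3" "open B" "convex B" "w0 \<in> B"
    using r by (auto simp: B_def r_def)
  have B\<Omega>: "B \<subseteq> \<Omega>"
    using B s3 by blast
  have Q0: "Q w \<noteq> 0" if "w \<in> B" for w
    unfolding Q_def by (rule s3(3)) (use that B(3,6) in auto)
  have holQ: "holomorphic_Cm Q B"
    unfolding Q_def[abs_def] gram_def
    by (intro holomorphic_Cm_sum holomorphic_Cm_cinner holomorphic_Cm_subset[OF f B\<Omega>])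
  define g where "g w = complex_of_real (sqrt N) / Q w" for w
  have hol_g: "holomorphic_Cm g B"
    unfolding g_def[abs_def] by (intro holomorphic_Cm_divide holomorphic_Cm_const holQ Q0)
  have g0: "g w \<noteq> 0" if "w \<in> B" for w
    using Q0[OF that] N by (simp add: g_def)
  define \<sigma> where "\<sigma> w = g w *\<^sub>C \<tau> w" for w
  have hol\<gamma>B: "holomorphic_Cm \<gamma> B" and hol\<tau>B: "holomorphic_Cm \<tau> B"
    using hol\<gamma> hol\<tau> s1(2) s2(2) B by (auto elim!: holomorphic_Cm_subset)
  have hol\<sigma>: "holomorphic_Cm \<sigma> B"
    unfolding \<sigma>_def[abs_def] by (intro holomorphic_Cm_scaleC hol_g hol\<tau>B)
  have sec\<gamma>: "nonvanishing_section T B \<gamma>"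
    using r1(3) hol\<gamma>B B s1(2) unfolding nonvanishing_section_def by blast
  have sec\<tau>: "nonvanishing_section S B \<tau>"
    using r2(3) hol\<tau>B B s2(2) unfolding nonvanishing_section_def by blast
  have sec\<sigma>: "nonvanishing_section S B \<sigma>"
    unfolding nonvanishing_section_def
  proof (intro conjI ballI)
    fix w assume w: "w \<in> B"
    have \<tau>: "\<tau> w \<in> joint_eigenspace S w" "\<tau> w \<noteq> 0"
      using sec\<tau> w by (auto simp: nonvanishing_section_def)
    have "\<And>i. bounded_clinear (S i)"
      using S by (simp add: cowen_douglas_def)
    then show "\<sigma> w \<in> joint_eigenspace S w"
      unfolding \<sigma>_def by (intro complex_vs.subspace_scale[OF subspace_joint_eigenspace] \<tau>)
    show "\<sigma> w \<noteq> 0"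
      using g0[OF w] \<tau>(2) by (simp add: \<sigma>_def)
  qed (use B hol\<sigma> in auto)
  have L: "gram I (\<lambda>k. f k p *\<^sub>C \<sigma> p) (\<lambda>k. f k q *\<^sub>C \<sigma> q)
      = gram I (\<lambda>k. f k p) (\<lambda>k. f k q) * (g p * cnj (g q) * cinner (\<tau> p) (\<tau> q))" for p q
    unfolding gram_scaled by (simp add: \<sigma>_def cinner_scaleC_left cinner_scaleC_right)
  have main: "gram {()} (\<lambda>k. \<gamma> p) (\<lambda>k. \<gamma> q) = gram I (\<lambda>k. f k p *\<^sub>C \<sigma> p) (\<lambda>k. f k q *\<^sub>C \<sigma> q)"
    if "p \<in> B" "q \<in> B" for p q
  proof (rule gram_rigidity[where F = "\<lambda>_. \<gamma>" and G = "\<lambda>k w. f k w *\<^sub>C \<sigma> w", OF B(4-6) hol\<gamma>B _ _ _ _ _ _ that])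
    show "holomorphic_Cm (\<lambda>w. f k w *\<^sub>C \<sigma> w) B" if "k \<in> I" for k
      by (intro holomorphic_Cm_scaleC hol\<sigma> holomorphic_Cm_subset[OF f[OF that] B\<Omega>])
    fix p q assume pq: "p \<in> B" "q \<in> B"
    show "gram {()} (\<lambda>k. \<gamma> p) (\<lambda>k. \<gamma> q) \<noteq> 0"
      unfolding gram1 by (rule s1(3)) (use pq B(1) in auto)
    have "gram I (\<lambda>k. f k p) (\<lambda>k. f k q) \<noteq> 0"
      by (rule s3(3)) (use pq B(3) in auto)
    moreover have "cinner (\<tau> p) (\<tau> q) \<noteq> 0"
      by (rule s2(3)) (use pq B(2) in auto)
    ultimately show "gram I (\<lambda>k. f k p *\<^sub>C \<sigma> p) (\<lambda>k. f k q *\<^sub>C \<sigma> q) \<noteq> 0"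
      unfolding L using g0 pq by simp
  next
    fix p assume p: "p \<in> B"
    show "gram {()} (\<lambda>k. \<gamma> p) (\<lambda>k. \<gamma> w0) = 1"
      unfolding gram1 by (rule r1(4)) (use p B(1) s1(2) in auto)
    have "cinner (\<tau> p) (\<tau> w0) = 1"
      by (rule r2(4)) (use p B(2) s2(2) in auto)
    moreover have "g p * cnj (g w0) = 1 / Q p"
      using N by (simp add: g_def Qw0 field_simps flip: of_real_mult)
    ultimately show "gram I (\<lambda>k. f k p *\<^sub>C \<sigma> p) (\<lambda>k. f k w0 *\<^sub>C \<sigma> w0) = 1"
      unfolding L Q_def[symmetric] using Q0[OF p] by simp
  next
    fix w i j assume w: "w \<in> B"
    have "levi I (\<lambda>k z. f k z *\<^sub>C \<sigma> z) (axis i 1) (axis j 1) w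
        = levi I f (axis i 1) (axis j 1) w + levi {()} (\<lambda>_. \<sigma>) (axis i 1) (axis j 1) w"
      by (rule levi_scaled[OF B(4) w holomorphic_Cm_subset[OF f B\<Omega>] hol\<sigma>])
        (use f_nz B\<Omega> sec\<sigma> in \<open>auto simp: nonvanishing_section_def\<close>)
    then show "levi {()} (\<lambda>_. \<gamma>) (axis i 1) (axis j 1) w = levi I (\<lambda>k w. f k w *\<^sub>C \<sigma> w) (axis i 1) (axis j 1) w"
      using curv[of w i j] w B\<Omega> curvature_matrix_section[OF T \<Omega> _ sec\<gamma> w]
        curvature_matrix_section[OF S \<Omega> _ sec\<sigma> w] by (auto simp: algebra_simps)
  qed
  show ?thesis
    by (rule that[OF r, folded B_def, OF B\<Omega> sec\<gamma> sec\<sigma>]) (use main gram1 in metis)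
qed

section \<open>From matched sections to an intertwining isomorphism\<close>

lemma form11_eq_imp:
  assumes "\<And>u v. form11 A u v - form11 B u v = form11 C u v"
  shows "A - B = C"
proof -
  have "A - B - C = 0"
    by (rule form11_zero_imp) (simp add: form11_diff assms)
  then show ?thesis
    by simp
qed

text \<open>The span \<open>G\<close> of the pairs \<open>(\<gamma>(w), \<sigma>(w))\<close> is invariant under \<open>T\<^sub>i \<times> S\<^sub>i\<close>, because both components
  are eigenvectors for the same \<open>w\<^sub>i\<close>. Its closure is the graph of the intertwiner.\<close>

lemma intertwiner_of_matched_sections:
  fixes T :: "'m::finite \<Rightarrow> 'a \<Rightarrow> 'a::complex_hilbert_space"
    and S :: "'m \<Rightarrow> 'b \<Rightarrow> 'b::complex_hilbert_space"
    and X :: "'k \<Rightarrow> 'b \<Rightarrow> 'b"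
  assumes T: "T \<in> cowen_douglas 1 \<Omega>" and S: "S \<in> cowen_douglas 1 \<Omega>"
    and \<Omega>: "open \<Omega>" "connected \<Omega>" and B: "open B" "B \<noteq> {}" "B \<subseteq> \<Omega>"
    and \<gamma>: "nonvanishing_section T B \<gamma>" and \<sigma>: "nonvanishing_section S B \<sigma>"
    and I: "finite I" "l \<in> I" and X: "\<And>k. k \<in> I \<Longrightarrow> bounded_clinear (X k)" and Xl: "X l = id"
    and eq: "\<And>p q. p \<in> B \<Longrightarrow> q \<in> B \<Longrightarrow>
      cinner (\<gamma> p) (\<gamma> q) = gram I (\<lambda>k. X k (\<sigma> p)) (\<lambda>k. X k (\<sigma> q))"
  obtains Y Z where "bounded_clinear Y" "bounded_clinear Z" "Z \<circ> Y = id" "Y \<circ> Z = id"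
    "\<And>i. Y \<circ> T i = S i \<circ> Y"
    "\<And>x y. cinner x y = gram I (\<lambda>k. X k (Y x)) (\<lambda>k. X k (Y y))"
proof -
  define A where "A = (\<lambda>w. (\<gamma> w, \<sigma> w)) ` B"
  define G where "G = complex_vs.span A"
  have Xlin: "X k 0 = 0" "X k (x + y) = X k x + X k y" "X k (c *\<^sub>C x) = c *\<^sub>C X k x"
    if "k \<in> I" for k x y c
    using X[OF that] unfolding bounded_clinear_def bounded_linear_def by (auto simp: linear_0 linear_add)
  have Tb: "bounded_clinear (T i)" and Sb: "bounded_clinear (S i)" for i
    using T S by (simp_all add: cowen_douglas_def)
  have Tlin: "T i 0 = 0" "T i (x + y) = T i x + T i y" "T i (c *\<^sub>C x) = c *\<^sub>C T i x" for i x y c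
    using Tb[of i] unfolding bounded_clinear_def bounded_linear_def by (auto simp: linear_0 linear_add)
  have Slin: "S i 0 = 0" "S i (x + y) = S i x + S i y" "S i (c *\<^sub>C x) = c *\<^sub>C S i x" for i x y c
    using Sb[of i] unfolding bounded_clinear_def bounded_linear_def by (auto simp: linear_0 linear_add)
  define E where "E p q \<longleftrightarrow> cinner (fst p) (fst q) = gram I (\<lambda>k. X k (snd p)) (\<lambda>k. X k (snd q))"
    for p q :: "'a \<times> 'b"
  have E_lin: "E (c *\<^sub>C p + p') q" if "E p q" "E p' q" for c p p' q
  proof -
    have "gram I (\<lambda>k. X k (c *\<^sub>C snd p + snd p')) y = c * gram I (\<lambda>k. X k (snd p)) y + gram I (\<lambda>k. X k (snd p')) y" for y
      unfolding gram_def sum_distrib_left sum.distrib[symmetric]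
      by (intro sum.cong refl) (simp add: Xlin cinner_add_left cinner_scaleC_left)
    then show ?thesis
      using that by (simp add: E_def scaleC_prod_def cinner_add_left cinner_scaleC_left)
  qed
  have E_sym: "E p q" if "E q p" for p q
    using that unfolding E_def by (metis cinner_commute gram_commute)
  have E_zero: "E 0 q" for q
    by (simp add: E_def gram_def Xlin)
  \<comment> \<open>The relation \<open>E\<close> is extended from the generators to the span in one argument at a time.\<close>
  have E_span1: "E p q" if "p \<in> G" "q \<in> A" for p q
    using that(1) unfolding G_def
  proof (induction rule: complex_vs.span_induct_alt)
    case (step c x y)
    then show ?case
      using that(2) by (intro E_lin) (auto simp: A_def E_def eq)
  qed (rule E_zero)
  have E_span: "E p q" if "p \<in> G" "q \<in> G" for p q
  proof -
    have "E q p"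
      using that(2) unfolding G_def
    proof (induction rule: complex_vs.span_induct_alt)
      case (step c x y)
      then show ?case
        using that(1) by (intro E_lin) (auto intro: E_sym E_span1)
    qed (rule E_zero)
    then show ?thesis
      by (rule E_sym)
  qed
  have sq: "(norm (fst p))\<^sup>2 = (\<Sum>k\<in>I. (norm (X k (snd p)))\<^sup>2)" if "p \<in> G" for p
    using E_span[OF that that] unfolding E_def cinner_self gram_self of_real_eq_iff .
  have bd1: "norm (snd p) \<le> 1 * norm (fst p)" if "p \<in> G" for p
  proof -
    have "(norm (X l (snd p)))\<^sup>2 \<le> (norm (fst p))\<^sup>2"
      unfolding sq[OF that] by (rule member_le_sum) (use I in auto)
    then show ?thesis
      unfolding Xl id_apply mult_1 by (rule power2_le_imp_le) simp
  qed
  have "\<forall>k\<in>I. \<exists>K. \<forall>x. norm (X k x) \<le> norm x * K"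
    using bounded_linear.bounded X unfolding bounded_clinear_def by blast
  then obtain K where "\<forall>k\<in>I. \<forall>x. norm (X k x) \<le> norm x * K k"
    by (rule bchoice[THEN exE])
  then have K: "norm (X k x) \<le> norm x * K k" if "k \<in> I" for k x
    using that by blast
  define C where "C = sqrt (\<Sum>k\<in>I. (K k)\<^sup>2)"
  have bd2: "norm (fst p) \<le> C * norm (snd p)" if "p \<in> G" for p
  proof (rule power2_le_imp_le)
    have "(norm (fst p))\<^sup>2 \<le> (\<Sum>k\<in>I. (norm (snd p) * K k)\<^sup>2)"
      unfolding sq[OF that] by (intro sum_mono power_mono K) auto
    also have "\<dots> = (C * norm (snd p))\<^sup>2"
      by (simp add: C_def power_mult_distrib sum_distrib_left sum_nonneg mult.commute)
    finally show "(norm (fst p))\<^sup>2 \<le> (C * norm (snd p))\<^sup>2" .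
    show "0 \<le> C * norm (snd p)"
      by (simp add: C_def sum_nonneg)
  qed
  have subG: "complex_vs.subspace G"
    unfolding G_def by (rule complex_vs.subspace_span)
  have AG: "(\<gamma> w, \<sigma> w) \<in> G" if "w \<in> B" for w
    unfolding G_def A_def using that by (intro complex_vs.span_base) auto
  have sub1: "complex_vs.subspace (fst ` G)"
  proof (rule complex_vs.subspaceI)
    show "0 \<in> fst ` G"
      using complex_vs.subspace_0[OF subG] by (metis fst_zero imageI)
    show "x + y \<in> fst ` G" if x: "x \<in> fst ` G" and y: "y \<in> fst ` G" for x y
    proof -
      obtain p q where "p \<in> G" "x = fst p" "q \<in> G" "y = fst q"
        using x y by blast
      then show ?thesis
        using complex_vs.subspace_add[OF subG, of p q] by (intro image_eqI[of _ _ "p + q"]) simp_all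
    qed
    show "c *\<^sub>C x \<in> fst ` G" if x: "x \<in> fst ` G" for c x
    proof -
      obtain p where "p \<in> G" "x = fst p"
        using x by blast
      then show ?thesis
        using complex_vs.subspace_scale[OF subG, of p c]
        by (intro image_eqI[of _ _ "c *\<^sub>C p"]) (simp_all add: scaleC_prod_def)
    qed
  qed
  have sub2: "complex_vs.subspace (snd ` G)"
  proof (rule complex_vs.subspaceI)
    show "0 \<in> snd ` G"
      using complex_vs.subspace_0[OF subG] by (metis snd_zero imageI)
    show "x + y \<in> snd ` G" if x: "x \<in> snd ` G" and y: "y \<in> snd ` G" for x y
    proof -
      obtain p q where "p \<in> G" "x = snd p" "q \<in> G" "y = snd q"
        using x y by blast
      then show ?thesis
        using complex_vs.subspace_add[OF subG, of p q] by (intro image_eqI[of _ _ "p + q"]) simp_all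
    qed
    show "c *\<^sub>C x \<in> snd ` G" if x: "x \<in> snd ` G" for c x
    proof -
      obtain p where "p \<in> G" "x = snd p"
        using x by blast
      then show ?thesis
        using complex_vs.subspace_scale[OF subG, of p c]
        by (intro image_eqI[of _ _ "c *\<^sub>C p"]) (simp_all add: scaleC_prod_def)
    qed
  qed
  have "joint_eigenspace T w \<subseteq> fst ` G" if w: "w \<in> B" for w
  proof
    fix x assume x: "x \<in> joint_eigenspace T w"
    have w\<Omega>: "w \<in> \<Omega>"
      using w B(3) by blast
    have g: "\<gamma> w \<in> joint_eigenspace T w" "\<gamma> w \<noteq> 0"
      using \<gamma> w by (auto simp: nonvanishing_section_def)
    obtain c where "x = c *\<^sub>C \<gamma> w"
      using eigenvector_multiple[OF T w\<Omega> g x] by blast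
    then show "x \<in> fst ` G"
      using complex_vs.subspace_scale[OF sub1, of "\<gamma> w" c] AG[OF w] by force
  qed
  then have "complex_vs.span (\<Union>w\<in>B. joint_eigenspace T w) \<subseteq> fst ` G"
    by (intro complex_vs.span_minimal sub1) blast
  then have dense1: "closure (fst ` G) = UNIV"
    using eigenspaces_over_open_set_dense[OF T \<Omega> B] closure_mono by (metis top.extremum_uniqueI)
  have "joint_eigenspace S w \<subseteq> snd ` G" if w: "w \<in> B" for w
  proof
    fix x assume x: "x \<in> joint_eigenspace S w"
    have w\<Omega>: "w \<in> \<Omega>"
      using w B(3) by blast
    have g: "\<sigma> w \<in> joint_eigenspace S w" "\<sigma> w \<noteq> 0"
      using \<sigma> w by (auto simp: nonvanishing_section_def)
    obtain c where "x = c *\<^sub>C \<sigma> w"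
      using eigenvector_multiple[OF S w\<Omega> g x] by blast
    then show "x \<in> snd ` G"
      using complex_vs.subspace_scale[OF sub2, of "\<sigma> w" c] AG[OF w] by force
  qed
  then have "complex_vs.span (\<Union>w\<in>B. joint_eigenspace S w) \<subseteq> snd ` G"
    by (intro complex_vs.span_minimal sub2) blast
  then have dense2: "closure (snd ` G) = UNIV"
    using eigenspaces_over_open_set_dense[OF S \<Omega> B] closure_mono by (metis top.extremum_uniqueI)
  obtain Y Z where Y: "bounded_clinear Y" and Z: "bounded_clinear Z" and inv: "Z \<circ> Y = id" "Y \<circ> Z = id"
    and graph: "\<And>x y. (x, y) \<in> closure G \<longleftrightarrow> y = Y x"
    using graph_closure_isomorphism[OF subG bd1 bd2 dense1 dense2] by blast
  have "Y \<circ> T i = S i \<circ> Y" for i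
  proof -
    define H where "H p = (T i (fst p), S i (snd p))" for p
    have "H p \<in> G" if "p \<in> G" for p
      using that unfolding G_def
    proof (induction rule: complex_vs.span_induct_alt)
      case base
      show ?case
        by (simp add: H_def Tlin Slin complex_vs.span_zero flip: zero_prod_def)
    next
      case (step c x y)
      then obtain w where w: "w \<in> B" "x = (\<gamma> w, \<sigma> w)"
        by (auto simp: A_def)
      have "H x = (w $ i) *\<^sub>C x"
        using \<gamma> \<sigma> w by (auto simp: H_def nonvanishing_section_def mem_joint_eigenspace scaleC_prod_def)
      moreover have "H (c *\<^sub>C x + y) = c *\<^sub>C H x + H y"
        by (simp add: H_def scaleC_prod_def Tlin Slin)
      ultimately show ?case
        using step by (auto intro: complex_vs.span_add complex_vs.span_scale complex_vs.span_base)
    qed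
    then have "H ` G \<subseteq> closure G"
      using closure_subset by blast
    moreover have "continuous_on (closure G) H"
    proof -
      have Tc: "continuous_on UNIV (T i)" and Sc: "continuous_on UNIV (S i)"
        using Tb[of i] Sb[of i] by (simp_all add: bounded_clinear_def linear_continuous_on)
      show ?thesis
        unfolding H_def
        by (rule continuous_on_Pair
            [OF continuous_on_compose2[OF Tc continuous_on_fst[OF continuous_on_id] subset_UNIV]
              continuous_on_compose2[OF Sc continuous_on_snd[OF continuous_on_id] subset_UNIV]])
    qed
    ultimately have cl: "H ` closure G \<subseteq> closure G"
      by (intro image_closure_subset) auto
    have "S i (Y x) = Y (T i x)" for x
    proof -
      have "H (x, Y x) \<in> closure G"
        using cl graph[of x "Y x"] by blast
      then show ?thesis
        by (simp add: H_def graph)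
    qed
    then show ?thesis
      by (auto simp: fun_eq_iff)
  qed
  moreover have "cinner x y = gram I (\<lambda>k. X k (Y x)) (\<lambda>k. X k (Y y))" for x y
  proof -
    have contX: "continuous_on UNIV (X k)" if "k \<in> I" for k
      using X[OF that] by (simp add: bounded_clinear_def linear_continuous_on)
    have closed_E: "closed {p. E p q}" for q
      unfolding E_def gram_def
      by (intro closed_Collect_eq continuous_on_sum bounded_bilinear.continuous_on[OF bounded_bilinear_cinner]
          continuous_on_const continuous_on_fst continuous_on_snd continuous_on_id subset_UNIV
          continuous_on_compose2[OF contX])
    have "closure G \<subseteq> {p. E p q}" if q: "q \<in> G" for q
    proof (rule closure_minimal[OF _ closed_E])
      show "G \<subseteq> {p. E p q}"
        using E_span[OF _ q] by blast
    qed
    then have G_sub: "G \<subseteq> {q. E q p}" if "p \<in> closure G" for p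
      using that E_sym by blast
    have "closure G \<subseteq> {q. E q (y, Y y)}"
      by (rule closure_minimal[OF G_sub closed_E]) (simp add: graph)
    then have "E (x, Y x) (y, Y y)"
      using graph[of x "Y x"] by blast
    then show ?thesis
      by (simp add: E_def)
  qed
  ultimately show ?thesis
    using that[OF Y Z inv] by blast
qed

theorem theorem1p5:
  fixes \<Omega> :: "(complex^'m::finite) set"
    and T :: "'m \<Rightarrow> 'a \<Rightarrow> 'a::{complex_hilbert_space, second_countable_topology}"
    and S :: "'m \<Rightarrow> 'b \<Rightarrow> 'b::{complex_hilbert_space, second_countable_topology}"
    and n :: nat
    and \<phi> :: "nat \<Rightarrow> complex^'m \<Rightarrow> complex"
    and \<psi> :: "complex^'m \<Rightarrow> real"
  assumes "open \<Omega>" and "connected \<Omega>" and "bounded \<Omega>" and "\<Omega> \<noteq> {}"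
    and "T \<in> cowen_douglas 1 \<Omega>" and "S \<in> cowen_douglas 1 \<Omega>"
    and "commutant_iso_Hinf \<Omega> S"
    and "\<And>k. k \<in> {1..n} \<Longrightarrow> holomorphic_Cm (\<phi> k) \<Omega>"
    and "\<And>w. w \<in> \<Omega> \<Longrightarrow> \<psi> w = ln (\<Sum>k=1..n. (cmod (\<phi> k w))\<^sup>2)"
    and "\<And>w u v. w \<in> \<Omega> \<Longrightarrow>
      curvature_form S w u v - curvature_form T w u v =
        form11 (\<chi> i j. mixed_partial i j \<psi> w) u v"
    and "\<exists>l\<in>{1..n}. (\<forall>w\<in>\<Omega>. \<phi> l w \<noteq> 0) \<and> (\<forall>k\<in>{1..n}. (\<lambda>w. \<phi> k w / \<phi> l w) \<in> Hinf \<Omega>)"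
  shows "similar_tuples T S \<and> curvature_le \<Omega> T S \<and>
    (n = 1 \<longrightarrow> unitarily_equivalent_tuples T S)"
proof -
  note \<Omega> = assms(1,2) and T = assms(5) and S = assms(6) and comm = assms(7) and \<phi> = assms(8)
    and \<psi> = assms(9) and form = assms(10)
  define I where "I = {1..n}"
  obtain l where l: "l \<in> I" "\<And>w. w \<in> \<Omega> \<Longrightarrow> \<phi> l w \<noteq> 0"
      "\<And>k. k \<in> I \<Longrightarrow> (\<lambda>w. \<phi> k w / \<phi> l w) \<in> Hinf \<Omega>"
    using assms(11) unfolding I_def by blast
  have I: "finite I"
    by (simp add: I_def)
  define f where "f k w = \<phi> k w / \<phi> l w" for k w
  have f_Hinf: "f k \<in> Hinf \<Omega>" if "k \<in> I" for k
    using l(3)[OF that] by (simp add: f_def[abs_def])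
  have f_hol: "holomorphic_Cm (f k) \<Omega>" if "k \<in> I" for k
    using f_Hinf[OF that] by (simp add: Hinf_def)
  have fl: "f l w = 1" if "w \<in> \<Omega>" for w
    using l(2)[OF that] by (simp add: f_def)
  have \<phi>l_hol: "holomorphic_Cm (\<phi> l) \<Omega>"
    using \<phi> l(1) by (simp add: I_def)
  have f_nz: "(\<Sum>k\<in>I. (cmod (f k w))\<^sup>2) \<noteq> 0" if "w \<in> \<Omega>" for w
    using fl[OF that] l(1) I by (auto simp: sum_nonneg_eq_0_iff intro!: bexI[of _ l])
  \<comment> \<open>Dividing all \<open>\<phi>\<^sub>k\<close> by \<open>\<phi>\<^sub>l\<close> changes the logarithm by a pluriharmonic term only.\<close>
  have mixed_\<psi>: "mixed_partial i j \<psi> w = levi I f (axis i 1) (axis j 1) w" if w: "w \<in> \<Omega>" for w i j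
  proof -
    have "has_mixed_partial (\<lambda>z. ln (\<Sum>k\<in>I. (norm (f k z *\<^sub>C \<phi> l z))\<^sup>2)) i j w
        (levi I (\<lambda>k z. f k z *\<^sub>C \<phi> l z) (axis i 1) (axis j 1) w)"
      by (rule has_mixed_partial_ln_norm[OF holomorphic_Cm_scaleC[OF f_hol \<phi>l_hol] \<Omega>(1) w])
        (use f_nz l(2) in \<open>auto simp: norm_scaled\<close>)
    then have "has_mixed_partial \<psi> i j w (levi I (\<lambda>k z. f k z *\<^sub>C \<phi> l z) (axis i 1) (axis j 1) w)"
    proof (rule has_mixed_partial_cong[OF _ \<Omega>(1) w])
      fix z assume z: "z \<in> \<Omega>"
      have "f k z *\<^sub>C \<phi> l z = \<phi> k z" for k
        using l(2)[OF z] by (simp add: f_def scaleC_complex_def)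
      then show "ln (\<Sum>k\<in>I. (norm (f k z *\<^sub>C \<phi> l z))\<^sup>2) = \<psi> z"
        using \<psi>[OF z] by (simp add: I_def)
    qed
    then have "mixed_partial i j \<psi> w = levi I (\<lambda>k z. f k z *\<^sub>C \<phi> l z) (axis i 1) (axis j 1) w"
      by (rule mixed_partial_eq)
    also have "\<dots> = levi I f (axis i 1) (axis j 1) w + levi {()} (\<lambda>_. \<phi> l) (axis i 1) (axis j 1) w"
      by (rule levi_scaled[OF \<Omega>(1) w f_hol \<phi>l_hol f_nz l(2)])
    finally show ?thesis
      by (simp add: levi_scalar)
  qed
  have curv: "curvature_matrix S w - curvature_matrix T w = (\<chi> i j. levi I f (axis i 1) (axis j 1) w)"
    if w: "w \<in> \<Omega>" for w
    using form11_eq_imp[OF form[OF w, unfolded curvature_form_def]] by (simp add: mixed_\<psi>[OF w])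
  have curv_le: "curvature_le \<Omega> T S"
    unfolding curvature_le_def
  proof
    fix w assume w: "w \<in> \<Omega>"
    show "pos_semidef (curvature_matrix S w - curvature_matrix T w)"
      unfolding curv[OF w] by (rule pos_semidef_levi[OF f_hol w])
  qed
  obtain w0 where w0: "w0 \<in> \<Omega>"
    using assms(4) by blast
  obtain r \<gamma> \<sigma> where r: "r > 0" "ball w0 r \<subseteq> \<Omega>"
    and \<gamma>: "nonvanishing_section T (ball w0 r) \<gamma>" and \<sigma>: "nonvanishing_section S (ball w0 r) \<sigma>"
    and eq: "\<And>p q. p \<in> ball w0 r \<Longrightarrow> q \<in> ball w0 r \<Longrightarrow>
      cinner (\<gamma> p) (\<gamma> q) = gram I (\<lambda>k. f k p *\<^sub>C \<sigma> p) (\<lambda>k. f k q *\<^sub>C \<sigma> q)"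
  proof (rule matched_local_sections[OF T S \<Omega>(1) w0 f_hol f_nz])
    show "curvature_matrix S w $ i $ j - curvature_matrix T w $ i $ j = levi I f (axis i 1) (axis j 1) w"
      if "w \<in> \<Omega>" for w i j
      using arg_cong[OF curv[OF that], of "\<lambda>A. A $ i $ j"] by simp
  qed (assumption | rule that)+
  have "\<exists>X. bounded_clinear X \<and> has_symbol \<Omega> S X (f k)" if "k \<in> I" for k
    using comm f_Hinf[OF that] unfolding commutant_iso_Hinf_def commutant_def by blast
  then obtain X0 where X0: "\<And>k. k \<in> I \<Longrightarrow> bounded_clinear (X0 k)" "\<And>k. k \<in> I \<Longrightarrow> has_symbol \<Omega> S (X0 k) (f k)"
    by metis
  \<comment> \<open>The symbol \<open>f\<^sub>l\<close> is \<open>1\<close> on \<open>\<Omega>\<close>, so the identity represents it.\<close>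
  define X where "X = X0(l := id)"
  have X: "bounded_clinear (X k)" if "k \<in> I" for k
    using X0(1)[OF that] by (auto simp: X_def bounded_clinear_def id_def)
  have X\<sigma>: "X k (\<sigma> p) = f k p *\<^sub>C \<sigma> p" if "k \<in> I" "p \<in> ball w0 r" for k p
    using X0(2)[OF that(1)] r(2) \<sigma> that(2) fl[of p] unfolding X_def has_symbol_def by auto
  have Xl: "X l = id"
    by (simp add: X_def)
  have eqX: "cinner (\<gamma> p) (\<gamma> q) = gram I (\<lambda>k. X k (\<sigma> p)) (\<lambda>k. X k (\<sigma> q))"
    if "p \<in> ball w0 r" "q \<in> ball w0 r" for p q
    unfolding eq[OF that] gram_def using X\<sigma> that by (intro sum.cong) auto
  have ne: "ball w0 r \<noteq> {}"
    using r(1) by simp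
  obtain Y Z where Y: "bounded_clinear Y" and Z: "bounded_clinear Z" and inv: "Z \<circ> Y = id" "Y \<circ> Z = id"
    and tw: "\<And>i. Y \<circ> T i = S i \<circ> Y"
    and iso: "\<And>x y. cinner x y = gram I (\<lambda>k. X k (Y x)) (\<lambda>k. X k (Y y))"
    by (rule intertwiner_of_matched_sections[where X = X, OF T S \<Omega> open_ball ne r(2) \<gamma> \<sigma> I l(1) X Xl eqX])
      (assumption | rule that)+
  have "similar_tuples T S"
    unfolding similar_tuples_def using Y Z inv tw by blast
  moreover have "unitarily_equivalent_tuples T S" if "n = 1"
  proof -
    have "I = {l}"
      using l(1) that by (auto simp: I_def)
    then have "cinner (Y x) (Y y) = cinner x y" for x y
      by (simp add: iso[of x y] gram_def Xl)
    moreover have "surj Y"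
      using inv(2) by (metis comp_apply id_apply surjI)
    ultimately show ?thesis
      unfolding unitarily_equivalent_tuples_def using Y tw by blast
  qed
  ultimately show ?thesis
    using curv_le by blast
qed

end
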